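(* Let $A:\mathcal{U}$, $B:A\to\mathcal{U}$, and $W_{AB}$, $\mathsf{sup}$ as in the context. Let $P:W_{AB}\to\mathcal{U}$. If for all $a:A$ and $r:B(a)\to W_{AB}$ we have $\big(\prod_{b:B(a)}P(r\,b)\big)\to P(\mathsf{sup}\,a\,r)$, then $\prod_{w:W_{AB}}P\,w$.
   Context: Type theory: intensional Martin-Löf type theory with universes $\mathcal{U}:\mathcal{U}_0:\cdots$, bottom universe $\mathcal{U}$ impredicative (if $A$ is a type in any universe and $a:A\vdash B:\mathcal{U}$ then $\prod_{a:A}B:\mathcal{U}$), universes closed under $\Sigma$ and identity types; $\pi_1,\pi_2$ projections, $f\circ g := \lambda x.f(g\,x)$. Axioms: function extensionality and UIP. Fix $A:\mathcal{U}$, $B:A\to\mathcal{U}$. $W^*_{AB} := \prod_{X:\mathcal{U}}\big(\prod_{a:A}(B(a)\to X)\to X\big)\to X$; $\mathsf{sup}^*\,a\,r := \lambda X\,g.\ g\,a\,(\lambda b.\ r\,b\,X\,g)$; $\mathsf{rec}^*_W\,X\,g\,w := w\,X\,g$. For $g:\prod_{a:A}(B(a)\to X)\to X$, $g':\prod_{a:A}(B(a)\to Y)\to Y$, $f:X\to Y$: $\mathsf{MorphW}\,X\,g\ Y\,g'\ f := \prod_{a:A}\prod_{t:B(a)\to X} f(g\,a\,t) = g'\,a\,(f\circ t)$. $\mathsf{LimW}\,w := \prod_{X,Y:\mathcal{U}}\prod_{g,g'}\prod_{f:X\to Y}\mathsf{MorphW}\,X\,g\ Y\,g'\ f\to f(\mathsf{rec}^*_W\,X\,g\,w)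 = \mathsf{rec}^*_W\,Y\,g'\,w$. $W_{AB} := \sum_{w:W^*_{AB}}\mathsf{LimW}\,w$. With a proof $p:\prod_{a}\prod_{r:B(a)\to W_{AB}}\mathsf{LimW}(\mathsf{sup}^*\,a\,(\pi_1\circ r))$ (which exists): $\mathsf{sup}\,a\,r := \langle\mathsf{sup}^*\,a\,(\pi_1\circ r), p\,a\,r\rangle$. *)

theory Defs
  imports Main
begin

section \<open>Raw syntax\<close>

text \<open>
  Terms use de Bruijn indices and, as in Martin-Loef's own presentation, carry no type
  annotations.  \<open>Pi A B\<close>, \<open>Sig A B\<close> bind one variable in \<open>B\<close>, \<open>Lam b\<close> binds one in \<open>b\<close>.
  \<open>Split d p\<close> is dependent elimination of \<open>\<Sigma>\<close>; in \<open>d\<close> the first component is \<open>Var 1\<close> and the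
  second is \<open>Var 0\<close>.  \<open>J d p\<close> is identity elimination; \<open>d\<close> binds one variable.
  \<open>FunExt\<close> and \<open>UIP\<close> are the two axioms, without computation rules.

  \<open>Univ 0\<close> is the impredicative bottom universe \<open>\<U>\<close>, and \<open>Univ (Suc i)\<close> is \<open>\<U>\<^sub>i\<close>.
\<close>

datatype tm =
    Var nat
  | Univ nat
  | Pi tm tm | Lam tm | App tm tm
  | Sig tm tm | Pair tm tm | Split tm tm
  | Id tm tm tm | Refl tm | J tm tm
  | FunExt tm | UIP tm tm

text \<open>Parallel renaming and substitution.\<close>

definition up_ren :: "(nat \<Rightarrow> nat) \<Rightarrow> nat \<Rightarrow> nat" where
  "up_ren f = case_nat 0 (\<lambda>n. Suc (f n))"

primrec ren :: "(nat \<Rightarrow> nat) \<Rightarrow> tm \<Rightarrow> tm" where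
  "ren f (Var n) = Var (f n)"
| "ren f (Univ i) = Univ i"
| "ren f (Pi A B) = Pi (ren f A) (ren (up_ren f) B)"
| "ren f (Lam b) = Lam (ren (up_ren f) b)"
| "ren f (App t a) = App (ren f t) (ren f a)"
| "ren f (Sig A B) = Sig (ren f A) (ren (up_ren f) B)"
| "ren f (Pair a b) = Pair (ren f a) (ren f b)"
| "ren f (Split d p) = Split (ren (up_ren (up_ren f)) d) (ren f p)"
| "ren f (Id A a b) = Id (ren f A) (ren f a) (ren f b)"
| "ren f (Refl a) = Refl (ren f a)"
| "ren f (J d p) = J (ren (up_ren f) d) (ren f p)"
| "ren f (FunExt h) = FunExt (ren f h)"
| "ren f (UIP p q) = UIP (ren f p) (ren f q)"

abbreviation lift :: "nat \<Rightarrow> tm \<Rightarrow> tm" where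
  "lift k \<equiv> ren (\<lambda>n. n + k)"

definition scons :: "tm \<Rightarrow> (nat \<Rightarrow> tm) \<Rightarrow> nat \<Rightarrow> tm" (infixr \<open>\<cdot>\<close> 65) where
  "a \<cdot> \<sigma> = case_nat a \<sigma>"

definition up_sub :: "(nat \<Rightarrow> tm) \<Rightarrow> nat \<Rightarrow> tm" where
  "up_sub \<sigma> = Var 0 \<cdot> (\<lambda>n. lift 1 (\<sigma> n))"

primrec sub :: "(nat \<Rightarrow> tm) \<Rightarrow> tm \<Rightarrow> tm" where
  "sub \<sigma> (Var n) = \<sigma> n"
| "sub \<sigma> (Univ i) = Univ i"
| "sub \<sigma> (Pi A B) = Pi (sub \<sigma> A) (sub (up_sub \<sigma>) B)"
| "sub \<sigma> (Lam b) = Lam (sub (up_sub \<sigma>) b)"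
| "sub \<sigma> (App t a) = App (sub \<sigma> t) (sub \<sigma> a)"
| "sub \<sigma> (Sig A B) = Sig (sub \<sigma> A) (sub (up_sub \<sigma>) B)"
| "sub \<sigma> (Pair a b) = Pair (sub \<sigma> a) (sub \<sigma> b)"
| "sub \<sigma> (Split d p) = Split (sub (up_sub (up_sub \<sigma>)) d) (sub \<sigma> p)"
| "sub \<sigma> (Id A a b) = Id (sub \<sigma> A) (sub \<sigma> a) (sub \<sigma> b)"
| "sub \<sigma> (Refl a) = Refl (sub \<sigma> a)"
| "sub \<sigma> (J d p) = J (sub (up_sub \<sigma>) d) (sub \<sigma> p)"
| "sub \<sigma> (FunExt h) = FunExt (sub \<sigma> h)"
| "sub \<sigma> (UIP p q) = UIP (sub \<sigma> p) (sub \<sigma> q)"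

abbreviation inst :: "tm \<Rightarrow> tm \<Rightarrow> tm" (\<open>_\<langle>_\<rangle>\<close> [1000, 0] 1000) where
  "B\<langle>a\<rangle> \<equiv> sub (a \<cdot> Var) B"

abbreviation arrow :: "tm \<Rightarrow> tm \<Rightarrow> tm" (infixr \<open>\<rightarrow>\<^sub>t\<close> 60) where
  "A \<rightarrow>\<^sub>t B \<equiv> Pi A (lift 1 B)"

section \<open>Judgements\<close>

text \<open>
  Contexts are lists with the most recent variable first.  Universes are a la Russell, so
  ``\<open>A\<close> is a type'' means \<open>\<Gamma> \<turnstile> A \<^bold>: Univ i\<close> for some \<open>i\<close>.

  The theory has only the type formers \<open>\<Pi>\<close>, \<open>\<Sigma>\<close>, \<open>Id\<close> and universes, \<open>\<beta>\<close>-rules but no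
  judgemental \<open>\<eta>\<close>-rules, and no cumulativity.  Typability only grows when rules are
  added, so inhabitants found here remain inhabitants in richer variants.
\<close>

type_synonym ctx = "tm list"

inductive
  wf_ctx :: "ctx \<Rightarrow> bool" (\<open>\<turnstile> _ ctx\<close> [50] 50) and
  has_type :: "ctx \<Rightarrow> tm \<Rightarrow> tm \<Rightarrow> bool" (\<open>_ \<turnstile> _ \<^bold>: _\<close> [50, 50, 50] 50) and
  eq_at :: "ctx \<Rightarrow> tm \<Rightarrow> tm \<Rightarrow> tm \<Rightarrow> bool" (\<open>_ \<turnstile> _ \<simeq> _ \<^bold>: _\<close> [50, 50, 50, 50] 50)
where
  ctx_nil: "\<turnstile> [] ctx"
| ctx_cons: "\<turnstile> \<Gamma> ctx \<Longrightarrow> \<Gamma> \<turnstile> A \<^bold>: Univ i \<Longrightarrow> \<turnstile> A # \<Gamma> ctx"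

| ty_var: "\<turnstile> \<Gamma> ctx \<Longrightarrow> n < length \<Gamma> \<Longrightarrow> \<Gamma> \<turnstile> Var n \<^bold>: lift (Suc n) (\<Gamma> ! n)"
| ty_conv: "\<Gamma> \<turnstile> a \<^bold>: A \<Longrightarrow> \<Gamma> \<turnstile> A \<simeq> B \<^bold>: Univ i \<Longrightarrow> \<Gamma> \<turnstile> a \<^bold>: B"
| ty_univ: "\<turnstile> \<Gamma> ctx \<Longrightarrow> \<Gamma> \<turnstile> Univ i \<^bold>: Univ (Suc i)"

\<comment> \<open>The conditional is the impredicativity of \<open>Univ 0\<close>.\<close>
| ty_pi: "\<Gamma> \<turnstile> A \<^bold>: Univ i \<Longrightarrow> A # \<Gamma> \<turnstile> B \<^bold>: Univ j \<Longrightarrow>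
    \<Gamma> \<turnstile> Pi A B \<^bold>: Univ (if j = 0 then 0 else max i j)"
| ty_lam: "A # \<Gamma> \<turnstile> b \<^bold>: B \<Longrightarrow> \<Gamma> \<turnstile> Lam b \<^bold>: Pi A B"
| ty_app: "\<Gamma> \<turnstile> t \<^bold>: Pi A B \<Longrightarrow> \<Gamma> \<turnstile> a \<^bold>: A \<Longrightarrow> \<Gamma> \<turnstile> App t a \<^bold>: B\<langle>a\<rangle>"

| ty_sig: "\<Gamma> \<turnstile> A \<^bold>: Univ i \<Longrightarrow> A # \<Gamma> \<turnstile> B \<^bold>: Univ j \<Longrightarrow> \<Gamma> \<turnstile> Sig A B \<^bold>: Univ (max i j)"
| ty_pair: "A # \<Gamma> \<turnstile> B \<^bold>: Univ j \<Longrightarrow> \<Gamma> \<turnstile> a \<^bold>: A \<Longrightarrow> \<Gamma> \<turnstile> b \<^bold>: B\<langle>a\<rangle> \<Longrightarrow>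
    \<Gamma> \<turnstile> Pair a b \<^bold>: Sig A B"
| ty_split: "Sig A B # \<Gamma> \<turnstile> C \<^bold>: Univ k \<Longrightarrow>
    B # A # \<Gamma> \<turnstile> d \<^bold>: sub (Pair (Var 1) (Var 0) \<cdot> (\<lambda>n. Var (n + 2))) C \<Longrightarrow>
    \<Gamma> \<turnstile> p \<^bold>: Sig A B \<Longrightarrow> \<Gamma> \<turnstile> Split d p \<^bold>: C\<langle>p\<rangle>"

| ty_id: "\<Gamma> \<turnstile> A \<^bold>: Univ i \<Longrightarrow> \<Gamma> \<turnstile> a \<^bold>: A \<Longrightarrow> \<Gamma> \<turnstile> b \<^bold>: A \<Longrightarrow> \<Gamma> \<turnstile> Id A a b \<^bold>: Univ i"
| ty_refl: "\<Gamma> \<turnstile> a \<^bold>: A \<Longrightarrow> \<Gamma> \<turnstile> Refl a \<^bold>: Id A a a"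
| ty_J: "Id (lift 2 A) (Var 1) (Var 0) # lift 1 A # A # \<Gamma> \<turnstile> C \<^bold>: Univ k \<Longrightarrow>
    A # \<Gamma> \<turnstile> d \<^bold>: sub (Refl (Var 0) \<cdot> Var 0 \<cdot> Var 0 \<cdot> (\<lambda>n. Var (n + 1))) C \<Longrightarrow>
    \<Gamma> \<turnstile> a \<^bold>: A \<Longrightarrow> \<Gamma> \<turnstile> b \<^bold>: A \<Longrightarrow> \<Gamma> \<turnstile> p \<^bold>: Id A a b \<Longrightarrow>
    \<Gamma> \<turnstile> J d p \<^bold>: sub (p \<cdot> b \<cdot> a \<cdot> Var) C"

| ty_funext: "\<Gamma> \<turnstile> f \<^bold>: Pi A B \<Longrightarrow> \<Gamma> \<turnstile> g \<^bold>: Pi A B \<Longrightarrow>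
    \<Gamma> \<turnstile> h \<^bold>: Pi A (Id B (App (lift 1 f) (Var 0)) (App (lift 1 g) (Var 0))) \<Longrightarrow>
    \<Gamma> \<turnstile> FunExt h \<^bold>: Id (Pi A B) f g"
| ty_uip: "\<Gamma> \<turnstile> p \<^bold>: Id A a b \<Longrightarrow> \<Gamma> \<turnstile> q \<^bold>: Id A a b \<Longrightarrow>
    \<Gamma> \<turnstile> UIP p q \<^bold>: Id (Id A a b) p q"

| eq_refl: "\<Gamma> \<turnstile> a \<^bold>: A \<Longrightarrow> \<Gamma> \<turnstile> a \<simeq> a \<^bold>: A"
| eq_sym: "\<Gamma> \<turnstile> a \<simeq> b \<^bold>: A \<Longrightarrow> \<Gamma> \<turnstile> b \<simeq> a \<^bold>: A"
| eq_trans: "\<Gamma> \<turnstile> a \<simeq> b \<^bold>: A \<Longrightarrow> \<Gamma> \<turnstile> b \<simeq> c \<^bold>: A \<Longrightarrow> \<Gamma> \<turnstile> a \<simeq> c \<^bold>: A"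
| eq_conv: "\<Gamma> \<turnstile> a \<simeq> b \<^bold>: A \<Longrightarrow> \<Gamma> \<turnstile> A \<simeq> B \<^bold>: Univ i \<Longrightarrow> \<Gamma> \<turnstile> a \<simeq> b \<^bold>: B"

| eq_pi: "\<Gamma> \<turnstile> A \<^bold>: Univ i \<Longrightarrow> \<Gamma> \<turnstile> A \<simeq> A' \<^bold>: Univ i \<Longrightarrow> A # \<Gamma> \<turnstile> B \<simeq> B' \<^bold>: Univ j \<Longrightarrow>
    \<Gamma> \<turnstile> Pi A B \<simeq> Pi A' B' \<^bold>: Univ (if j = 0 then 0 else max i j)"
| eq_lam: "A # \<Gamma> \<turnstile> b \<simeq> b' \<^bold>: B \<Longrightarrow> \<Gamma> \<turnstile> Lam b \<simeq> Lam b' \<^bold>: Pi A B"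
| eq_app: "\<Gamma> \<turnstile> t \<simeq> t' \<^bold>: Pi A B \<Longrightarrow> \<Gamma> \<turnstile> a \<simeq> a' \<^bold>: A \<Longrightarrow> \<Gamma> \<turnstile> App t a \<simeq> App t' a' \<^bold>: B\<langle>a\<rangle>"
| eq_beta: "A # \<Gamma> \<turnstile> b \<^bold>: B \<Longrightarrow> \<Gamma> \<turnstile> a \<^bold>: A \<Longrightarrow> \<Gamma> \<turnstile> App (Lam b) a \<simeq> b\<langle>a\<rangle> \<^bold>: B\<langle>a\<rangle>"

| eq_sig: "\<Gamma> \<turnstile> A \<^bold>: Univ i \<Longrightarrow> \<Gamma> \<turnstile> A \<simeq> A' \<^bold>: Univ i \<Longrightarrow> A # \<Gamma> \<turnstile> B \<simeq> B' \<^bold>: Univ j \<Longrightarrow>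
    \<Gamma> \<turnstile> Sig A B \<simeq> Sig A' B' \<^bold>: Univ (max i j)"
| eq_pair: "A # \<Gamma> \<turnstile> B \<^bold>: Univ j \<Longrightarrow> \<Gamma> \<turnstile> a \<simeq> a' \<^bold>: A \<Longrightarrow> \<Gamma> \<turnstile> b \<simeq> b' \<^bold>: B\<langle>a\<rangle> \<Longrightarrow>
    \<Gamma> \<turnstile> Pair a b \<simeq> Pair a' b' \<^bold>: Sig A B"
| eq_split: "Sig A B # \<Gamma> \<turnstile> C \<^bold>: Univ k \<Longrightarrow>
    B # A # \<Gamma> \<turnstile> d \<simeq> d' \<^bold>: sub (Pair (Var 1) (Var 0) \<cdot> (\<lambda>n. Var (n + 2))) C \<Longrightarrow>
    \<Gamma> \<turnstile> p \<simeq> p' \<^bold>: Sig A B \<Longrightarrow> \<Gamma> \<turnstile> Split d p \<simeq> Split d' p' \<^bold>: C\<langle>p\<rangle>"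
| eq_split_beta: "Sig A B # \<Gamma> \<turnstile> C \<^bold>: Univ k \<Longrightarrow>
    B # A # \<Gamma> \<turnstile> d \<^bold>: sub (Pair (Var 1) (Var 0) \<cdot> (\<lambda>n. Var (n + 2))) C \<Longrightarrow>
    \<Gamma> \<turnstile> a \<^bold>: A \<Longrightarrow> \<Gamma> \<turnstile> b \<^bold>: B\<langle>a\<rangle> \<Longrightarrow>
    \<Gamma> \<turnstile> Split d (Pair a b) \<simeq> sub (b \<cdot> a \<cdot> Var) d \<^bold>: C\<langle>Pair a b\<rangle>"

| eq_id: "\<Gamma> \<turnstile> A \<simeq> A' \<^bold>: Univ i \<Longrightarrow> \<Gamma> \<turnstile> a \<simeq> a' \<^bold>: A \<Longrightarrow> \<Gamma> \<turnstile> b \<simeq> b' \<^bold>: A \<Longrightarrow>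
    \<Gamma> \<turnstile> Id A a b \<simeq> Id A' a' b' \<^bold>: Univ i"
| eq_refl_cong: "\<Gamma> \<turnstile> a \<simeq> a' \<^bold>: A \<Longrightarrow> \<Gamma> \<turnstile> Refl a \<simeq> Refl a' \<^bold>: Id A a a"
| eq_J: "Id (lift 2 A) (Var 1) (Var 0) # lift 1 A # A # \<Gamma> \<turnstile> C \<^bold>: Univ k \<Longrightarrow>
    A # \<Gamma> \<turnstile> d \<simeq> d' \<^bold>: sub (Refl (Var 0) \<cdot> Var 0 \<cdot> Var 0 \<cdot> (\<lambda>n. Var (n + 1))) C \<Longrightarrow>
    \<Gamma> \<turnstile> a \<^bold>: A \<Longrightarrow> \<Gamma> \<turnstile> b \<^bold>: A \<Longrightarrow> \<Gamma> \<turnstile> p \<simeq> p' \<^bold>: Id A a b \<Longrightarrow>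
    \<Gamma> \<turnstile> J d p \<simeq> J d' p' \<^bold>: sub (p \<cdot> b \<cdot> a \<cdot> Var) C"
| eq_J_beta: "Id (lift 2 A) (Var 1) (Var 0) # lift 1 A # A # \<Gamma> \<turnstile> C \<^bold>: Univ k \<Longrightarrow>
    A # \<Gamma> \<turnstile> d \<^bold>: sub (Refl (Var 0) \<cdot> Var 0 \<cdot> Var 0 \<cdot> (\<lambda>n. Var (n + 1))) C \<Longrightarrow>
    \<Gamma> \<turnstile> a \<^bold>: A \<Longrightarrow>
    \<Gamma> \<turnstile> J d (Refl a) \<simeq> d\<langle>a\<rangle> \<^bold>: sub (Refl a \<cdot> a \<cdot> a \<cdot> Var) C"

| eq_funext: "\<Gamma> \<turnstile> f \<^bold>: Pi A B \<Longrightarrow> \<Gamma> \<turnstile> g \<^bold>: Pi A B \<Longrightarrow>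
    \<Gamma> \<turnstile> h \<simeq> h' \<^bold>: Pi A (Id B (App (lift 1 f) (Var 0)) (App (lift 1 g) (Var 0))) \<Longrightarrow>
    \<Gamma> \<turnstile> FunExt h \<simeq> FunExt h' \<^bold>: Id (Pi A B) f g"
| eq_uip: "\<Gamma> \<turnstile> p \<simeq> p' \<^bold>: Id A a b \<Longrightarrow> \<Gamma> \<turnstile> q \<simeq> q' \<^bold>: Id A a b \<Longrightarrow>
    \<Gamma> \<turnstile> UIP p q \<simeq> UIP p' q' \<^bold>: Id (Id A a b) p q"

definition inhabited :: "tm \<Rightarrow> bool" where
  "inhabited A \<longleftrightarrow> (\<exists>t. [] \<turnstile> t \<^bold>: A)"

section \<open>The impredicative encoding of W-types\<close>

text \<open>
  All definitions below are schematic in terms \<open>A\<close>, \<open>B\<close>, ... of one common context, and are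
  transported under binders by explicit lifting.  The comments list the variables bound
  around an expression, each with its index at the innermost point.
\<close>

abbreviation \<U> :: tm where
  "\<U> \<equiv> Univ 0"

definition proj1 :: tm (\<open>\<pi>\<^sub>1\<close>) where
  "\<pi>\<^sub>1 = Lam (Split (Var 1) (Var 0))"

definition comp :: "tm \<Rightarrow> tm \<Rightarrow> tm" (infixl \<open>\<circ>\<^sub>t\<close> 55) where
  "f \<circ>\<^sub>t g = Lam (App (lift 1 f) (App (lift 1 g) (Var 0)))"

text \<open>\<open>\<Pi>a:A. (B a \<rightarrow> X) \<rightarrow> X\<close>\<close>

definition AlgW :: "tm \<Rightarrow> tm \<Rightarrow> tm \<Rightarrow> tm" where
  "AlgW A B X = Pi A ((App (lift 1 B) (Var 0) \<rightarrow>\<^sub>t lift 1 X) \<rightarrow>\<^sub>t lift 1 X)"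

definition Wstar :: "tm \<Rightarrow> tm \<Rightarrow> tm" where
  "Wstar A B = Pi \<U> (AlgW (lift 1 A) (lift 1 B) (Var 0) \<rightarrow>\<^sub>t Var 0)"

text \<open>\<open>\<lambda>X g. g a (\<lambda>b. r b X g)\<close>; innermost \<open>X = 2, g = 1, b = 0\<close>\<close>

definition sup_star :: "tm \<Rightarrow> tm \<Rightarrow> tm" where
  "sup_star a r = Lam (Lam (App (App (Var 0) (lift 2 a))
     (Lam (App (App (App (lift 3 r) (Var 0)) (Var 2)) (Var 1)))))"

definition rec_star :: "tm \<Rightarrow> tm \<Rightarrow> tm \<Rightarrow> tm" where
  "rec_star X g w = App (App w X) g"

text \<open>\<open>\<Pi>a:A. \<Pi>t:B a \<rightarrow> X. f (g a t) = g' a (f \<circ> t)\<close>; innermost \<open>a = 1, t = 0\<close>\<close>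

definition MorphW :: "tm \<Rightarrow> tm \<Rightarrow> tm \<Rightarrow> tm \<Rightarrow> tm \<Rightarrow> tm \<Rightarrow> tm \<Rightarrow> tm" where
  "MorphW A B X g Y g' f =
     Pi A (Pi (App (lift 1 B) (Var 0) \<rightarrow>\<^sub>t lift 1 X)
       (Id (lift 2 Y)
         (App (lift 2 f) (App (App (lift 2 g) (Var 1)) (Var 0)))
         (App (App (lift 2 g') (Var 1)) (lift 2 f \<circ>\<^sub>t Var 0))))"

text \<open>\<open>\<Pi>X Y:\<U>. \<Pi>g g'. \<Pi>f:X \<rightarrow> Y. MorphW X g Y g' f \<rightarrow> f (rec X g w) = rec Y g' w\<close>;
  innermost \<open>X = 4, Y = 3, g = 2, g' = 1, f = 0\<close>\<close>

definition LimW :: "tm \<Rightarrow> tm \<Rightarrow> tm \<Rightarrow> tm" where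
  "LimW A B w =
     Pi \<U> (Pi \<U>
      (Pi (AlgW (lift 2 A) (lift 2 B) (Var 1))
      (Pi (AlgW (lift 3 A) (lift 3 B) (Var 1))
      (Pi (Var 3 \<rightarrow>\<^sub>t Var 2)
        (MorphW (lift 5 A) (lift 5 B) (Var 4) (Var 2) (Var 3) (Var 1) (Var 0) \<rightarrow>\<^sub>t
         Id (Var 3)
           (App (Var 0) (rec_star (Var 4) (Var 2) (lift 5 w)))
           (rec_star (Var 3) (Var 1) (lift 5 w)))))))"

definition W :: "tm \<Rightarrow> tm \<Rightarrow> tm" where
  "W A B = Sig (Wstar A B) (LimW (lift 1 A) (lift 1 B) (Var 0))"

text \<open>The type \<open>\<Pi>a:A. \<Pi>r:B a \<rightarrow> W. LimW (sup* a (\<pi>\<^sub>1 \<circ> r))\<close> of the proof \<open>p\<close> used in \<open>sup\<close>;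
  innermost \<open>a = 1, r = 0\<close>\<close>

definition SupLim :: "tm \<Rightarrow> tm \<Rightarrow> tm" where
  "SupLim A B =
     Pi A (Pi (App (lift 1 B) (Var 0) \<rightarrow>\<^sub>t lift 1 (W A B))
       (LimW (lift 2 A) (lift 2 B) (sup_star (Var 1) (\<pi>\<^sub>1 \<circ>\<^sub>t Var 0))))"

definition sup_W :: "tm \<Rightarrow> tm \<Rightarrow> tm \<Rightarrow> tm" where
  "sup_W p a r = Pair (sup_star a (\<pi>\<^sub>1 \<circ>\<^sub>t r)) (App (App p a) r)"

text \<open>\<open>\<Pi>a:A. \<Pi>r:B a \<rightarrow> W. (\<Pi>b:B a. P (r b)) \<rightarrow> P (sup a r)\<close>; innermost \<open>a = 2, r = 1, b = 0\<close>\<close>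

definition IndStep :: "tm \<Rightarrow> tm \<Rightarrow> tm \<Rightarrow> tm \<Rightarrow> tm" where
  "IndStep A B p P =
     Pi A (Pi (App (lift 1 B) (Var 0) \<rightarrow>\<^sub>t lift 1 (W A B))
       (Pi (App (lift 2 B) (Var 1)) (App (lift 3 P) (App (Var 1) (Var 0)))
        \<rightarrow>\<^sub>t App (lift 2 P) (sup_W (lift 2 p) (Var 1) (Var 0))))"

text \<open>\<open>\<Pi>w:W. P w\<close>\<close>

definition IndConcl :: "tm \<Rightarrow> tm \<Rightarrow> tm \<Rightarrow> tm" where
  "IndConcl A B P = Pi (W A B) (App (lift 1 P) (Var 0))"

end

theory Submission
  imports Defs
begin

text \<open>
  The element \<open>p\<close> of \<open>SupLim\<close> comes from a morphism \<open>f\<close> by rewriting \<open>f (g a t)\<close> to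
  \<open>g' a (f \<circ> t)\<close> and then, by function extensionality, using the limit conditions of the
  branches.  For induction, \<open>Q = \<Sigma>w. P w\<close> carries an algebra \<open>h\<close> built from the induction step, and
  \<open>\<pi>\<^sub>1\<close> is judgementally a morphism from \<open>h\<close> to \<open>sup\<close>.  For \<open>w = \<langle>w\<^sup>*, l\<rangle>\<close> the limit condition \<open>l\<close>
  therefore identifies \<open>\<pi>\<^sub>1 (rec Q h w\<^sup>*)\<close> with \<open>rec W sup w\<^sup>*\<close>.  The latter equals \<open>w\<close>: the map
  \<open>\<lambda>v. \<pi>\<^sub>1 v X g\<close> is judgementally a morphism from \<open>sup\<close> to \<open>g\<close>, so \<open>l\<close> and function
  extensionality give equality of first components, and \<open>LimW\<close> is a proposition by UIP.
  Transporting \<open>\<pi>\<^sub>2 (rec Q h w\<^sup>*)\<close> along these equalities proves \<open>P w\<close>.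
\<close>

section \<open>Substitution calculus\<close>

text \<open>\<open>LimW\<close> quantifies only over types in \<open>\<U>\<close>, so its instances
  at the carrier \<open>W A B\<close> and at the total space of \<open>P\<close> must both live
  there. The first does because \<open>Wstar\<close> and \<open>LimW\<close> are products ending in
  \<open>\<U>\<close>, which is impredicative; the second because \<open>P\<close> is
  \<open>\<U>\<close>-valued. Without the limit condition \<open>Wstar\<close> has the recursor but
  no uniqueness for it, and uniqueness is exactly what dependent elimination asks for. The absence
  of judgemental eta shapes the details. Maps out of \<open>B a\<close> are brought to one common
  lambda form before they are compared; an element of \<open>W A B\<close> is opened by
  \<open>Split\<close>; and its equality with the pair of its components is a propositional
  statement that has to be proved. The calculus is a bare inductive definition, so weakening,
  substitution and well-formedness of contexts must be derived before any term of it can be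
  handled.\<close>

definition wk :: "nat \<Rightarrow> nat \<Rightarrow> tm" where
  "wk k n = Var (n + k)"

definition subcomp :: "(nat \<Rightarrow> tm) \<Rightarrow> (nat \<Rightarrow> tm) \<Rightarrow> nat \<Rightarrow> tm" (infixr \<open>\<odot>\<close> 70) where
  "(\<sigma> \<odot> \<tau>) n = sub \<tau> (\<sigma> n)"

lemma up_ren_Var: "up_sub (\<lambda>n. Var (f n)) = (\<lambda>n. Var (up_ren f n))"
  by (rule ext) (simp add: up_sub_def up_ren_def scons_def split: nat.split)

text \<open>A renaming is a substitution by variables. Through this equation \<open>lift\<close>
  becomes substitution by \<open>wk\<close>, and one calculus serves both operations.\<close>

lemma ren_eq_sub: "ren f t = sub (\<lambda>n. Var (f n)) t"
  by (induction t arbitrary: f) (simp_all add: up_ren_Var)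

lemma lift_eq_wk: "lift k t = sub (wk k) t"
  by (simp add: ren_eq_sub wk_def[abs_def])

lemma sub_Var: "sub Var t = t"
proof -
  have "up_sub Var = Var"
    by (rule ext) (simp add: up_sub_def scons_def split: nat.split)
  then show ?thesis by (induction t) simp_all
qed

lemma wk_0: "wk 0 = Var"
  by (rule ext) (simp add: wk_def)

lemma up_sub_ren: "(\<lambda>n. up_sub \<sigma> (up_ren f n)) = up_sub (\<lambda>n. \<sigma> (f n))"
  by (rule ext) (simp add: up_sub_def up_ren_def scons_def split: nat.split)

text \<open>Start of the usual ladder towards \<open>sub_sub\<close>: \<open>up_sub\<close> weakens
  under a binder, so composing two substitutions presupposes that substitution commutes with
  renaming on either side, and that in turn presupposes composition of renamings.\<close>

lemma sub_ren: "sub \<sigma> (ren f t) = sub (\<lambda>n. \<sigma> (f n)) t"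
  by (induction t arbitrary: f \<sigma>) (simp_all add: up_sub_ren)

lemma ren_ren: "ren g (ren f t) = ren (\<lambda>n. g (f n)) t"
  by (simp only: ren_eq_sub[of g] sub_ren) (simp only: ren_eq_sub[of "\<lambda>n. g (f n)"])

lemma ren_up_sub: "(\<lambda>n. ren (up_ren f) (up_sub \<sigma> n)) = up_sub (\<lambda>n. ren f (\<sigma> n))"
  by (rule ext) (simp add: up_sub_def up_ren_def scons_def ren_ren split: nat.split)

lemma ren_sub: "ren f (sub \<sigma> t) = sub (\<lambda>n. ren f (\<sigma> n)) t"
  by (induction t arbitrary: f \<sigma>) (simp_all add: ren_up_sub)

lemma up_sub_sub: "(\<lambda>n. sub (up_sub \<tau>) (up_sub \<sigma> n)) = up_sub (\<sigma> \<odot> \<tau>)"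
  by (rule ext) (simp add: up_sub_def scons_def subcomp_def sub_ren ren_sub split: nat.split)

lemma sub_sub_fun: "sub \<tau> (sub \<sigma> t) = sub (\<lambda>n. sub \<tau> (\<sigma> n)) t"
  by (induction t arbitrary: \<sigma> \<tau>) (simp_all add: up_sub_sub subcomp_def[abs_def])

lemma sub_sub: "sub \<tau> (sub \<sigma> t) = sub (\<sigma> \<odot> \<tau>) t"
  by (simp add: sub_sub_fun subcomp_def[abs_def])

lemma scons_comp: "(a \<cdot> \<sigma>) \<odot> \<tau> = sub \<tau> a \<cdot> (\<sigma> \<odot> \<tau>)"
  by (rule ext) (simp add: subcomp_def scons_def split: nat.split)

lemma comp_assoc: "(\<sigma> \<odot> \<tau>) \<odot> \<rho> = \<sigma> \<odot> \<tau> \<odot> \<rho>"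
  by (rule ext) (simp add: subcomp_def[abs_def] sub_sub_fun)

lemma Var_comp: "Var \<odot> \<sigma> = \<sigma>"
  by (rule ext) (simp add: subcomp_def)

lemma comp_Var: "\<sigma> \<odot> Var = \<sigma>"
  by (rule ext) (simp add: subcomp_def sub_Var)

lemma wk_Suc_scons: "wk (Suc k) \<odot> (a \<cdot> \<sigma>) = wk k \<odot> \<sigma>"
  by (rule ext) (simp add: subcomp_def scons_def wk_def)

lemma wk_wk: "wk j \<odot> wk k = wk (j + k)"
  by (rule ext) (simp add: subcomp_def wk_def)

lemma wk_wk_comp: "wk j \<odot> wk k \<odot> \<sigma> = wk (j + k) \<odot> \<sigma>"
  by (simp add: comp_assoc[symmetric] wk_wk)

lemma Var_scons_wk: "Var k \<cdot> wk (Suc k) = wk k"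
  by (rule ext) (simp add: scons_def wk_def split: nat.split)

text \<open>Keeps the simplifier from rewriting the renaming
  in \<open>lift\<close> out of the shape that \<open>lift_eq_wk\<close> expects.\<close>

lemma ren_weak_cong [cong]: "t = t' \<Longrightarrow> ren f t = ren f t'"
  by simp

lemma up_sub_scons: "up_sub \<sigma> = Var 0 \<cdot> (\<sigma> \<odot> wk 1)"
  by (rule ext) (simp add: up_sub_def subcomp_def scons_def lift_eq_wk split: nat.split)

lemma scons_0: "(a \<cdot> \<sigma>) 0 = a" and scons_Suc: "(a \<cdot> \<sigma>) (Suc n) = \<sigma> n"
  by (simp_all add: scons_def)

lemma wk_fun: "(\<lambda>n. Var (n + k)) = wk k"
  by (rule ext) (simp add: wk_def)

lemma wk_fun_numeral: "(\<lambda>n. Var (Suc n)) = wk (Suc 0)" "(\<lambda>n. Var (Suc (Suc n))) = wk (Suc (Suc 0))"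
  by (simp_all add: wk_def[abs_def])

text \<open>The rewrite rules of the sigma-calculus of explicit substitutions. Numerals are unfolded
  to \<open>Suc\<close> so that \<open>wk_Suc_scons\<close> also fires on shifts such as
  \<open>wk 2\<close>.\<close>

lemmas sigma = lift_eq_wk sub_Var wk_0 sub_sub scons_comp comp_assoc Var_comp comp_Var
  wk_Suc_scons wk_wk wk_wk_comp Var_scons_wk up_sub_scons scons_0 scons_Suc wk_fun wk_fun_numeral
  subcomp_def wk_def numeral_eq_Suc

section \<open>Stability under substitution\<close>

lemma wf_ctx_ConsE:
  assumes "\<turnstile> A # \<Gamma> ctx"
  obtains i where "\<turnstile> \<Gamma> ctx" "\<Gamma> \<turnstile> A \<^bold>: Univ i"
  using assms by (cases rule: wf_ctx.cases) auto

text \<open>Most rules have a premise over the same context. For \<open>ty_lam\<close> and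
  \<open>eq_lam\<close> the only premise is over the extended context, which is then
  inverted.\<close>

lemma judgement_ctx:
  "\<turnstile> \<Gamma> ctx \<Longrightarrow> True"
  "\<Gamma> \<turnstile> t \<^bold>: A \<Longrightarrow> \<turnstile> \<Gamma> ctx"
  "\<Gamma> \<turnstile> t \<simeq> u \<^bold>: A \<Longrightarrow> \<turnstile> \<Gamma> ctx"
  by (induction rule: wf_ctx_has_type_eq_at.inducts) (auto elim: wf_ctx_ConsE)

text \<open>Separates a typing rule from the syntax it produces: the rule is applied to terms with
  the substitution pushed inwards, and the equations between composed substitutions are left to
  \<open>sigma\<close>.\<close>

lemma ty_cast: "\<Gamma> \<turnstile> t \<^bold>: A \<Longrightarrow> t = t' \<Longrightarrow> A = A' \<Longrightarrow> \<Gamma> \<turnstile> t' \<^bold>: A'"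
  by simp

lemma eq_cast: "\<Gamma> \<turnstile> t \<simeq> u \<^bold>: A \<Longrightarrow> t = t' \<Longrightarrow> u = u' \<Longrightarrow> A = A' \<Longrightarrow> \<Gamma> \<turnstile> t' \<simeq> u' \<^bold>: A'"
  by simp

text \<open>
  \<open>ty_lam\<close> has no premise about its domain, so stability of the types in the context must be
  carried through the induction.
\<close>

primrec ctx_stable :: "((nat \<Rightarrow> tm) \<Rightarrow> tm list \<Rightarrow> tm list \<Rightarrow> bool) \<Rightarrow> tm list \<Rightarrow> bool" where
  "ctx_stable K [] \<longleftrightarrow> True"
| "ctx_stable K (A # \<Gamma>) \<longleftrightarrow> ctx_stable K \<Gamma> \<and>
    (\<exists>i. \<forall>\<sigma> \<Delta>. K \<sigma> \<Gamma> \<Delta> \<longrightarrow> \<Delta> \<turnstile> sub \<sigma> A \<^bold>: Univ i)"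

text \<open>
  Abstracting over the class \<open>K\<close> of substitutions yields renaming and substitution from one
  induction; renaming is needed first, because \<open>up_sub\<close> weakens.
\<close>

lemma substitution:
  assumes ctx: "\<And>\<sigma> \<Gamma> \<Delta>. K \<sigma> \<Gamma> \<Delta> \<Longrightarrow> \<turnstile> \<Delta> ctx"
    and var: "\<And>\<sigma> \<Gamma> \<Delta> n. K \<sigma> \<Gamma> \<Delta> \<Longrightarrow> n < length \<Gamma> \<Longrightarrow>
      \<Delta> \<turnstile> \<sigma> n \<^bold>: sub (wk (Suc n) \<odot> \<sigma>) (\<Gamma> ! n)"
    and up: "\<And>\<sigma> \<Gamma> \<Delta> A i. K \<sigma> \<Gamma> \<Delta> \<Longrightarrow> \<Delta> \<turnstile> sub \<sigma> A \<^bold>: Univ i \<Longrightarrow>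
      K (up_sub \<sigma>) (A # \<Gamma>) (sub \<sigma> A # \<Delta>)"
  shows "\<turnstile> \<Gamma> ctx \<Longrightarrow> ctx_stable K \<Gamma>"
    and "\<Gamma> \<turnstile> t \<^bold>: A \<Longrightarrow>
      ctx_stable K \<Gamma> \<and> (\<forall>\<sigma> \<Delta>. K \<sigma> \<Gamma> \<Delta> \<longrightarrow> \<Delta> \<turnstile> sub \<sigma> t \<^bold>: sub \<sigma> A)"
    and "\<Gamma> \<turnstile> t \<simeq> u \<^bold>: A \<Longrightarrow>
      ctx_stable K \<Gamma> \<and> (\<forall>\<sigma> \<Delta>. K \<sigma> \<Gamma> \<Delta> \<longrightarrow> \<Delta> \<turnstile> sub \<sigma> t \<simeq> sub \<sigma> u \<^bold>: sub \<sigma> A)"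
proof (induction rule: wf_ctx_has_type_eq_at.inducts)
  \<comment> \<open>The level that the assumption \<open>up\<close> asks for is the one recorded for
    the new entry in \<open>ctx_stable\<close>.\<close>
  have up': "K (up_sub \<sigma>) (A # \<Gamma>) (sub \<sigma> A # \<Delta>)"
    if "ctx_stable K (A # \<Gamma>)" "K \<sigma> \<Gamma> \<Delta>" for A \<Gamma> \<sigma> \<Delta>
    using that by (auto intro!: up)
  let ?ty = "\<lambda>\<Gamma> t A. ctx_stable K \<Gamma> \<and> (\<forall>\<sigma> \<Delta>. K \<sigma> \<Gamma> \<Delta> \<longrightarrow> \<Delta> \<turnstile> sub \<sigma> t \<^bold>: sub \<sigma> A)"
  let ?eq = "\<lambda>\<Gamma> t u A. ctx_stable K \<Gamma> \<and>
    (\<forall>\<sigma> \<Delta>. K \<sigma> \<Gamma> \<Delta> \<longrightarrow> \<Delta> \<turnstile> sub \<sigma> t \<simeq> sub \<sigma> u \<^bold>: sub \<sigma> A)"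
  \<comment> \<open>The digit in these names counts the binders crossed; three are needed only for
    the motive of \<open>J\<close>. Each case below re-applies its own rule to the results.\<close>
  have ty0: "\<Delta> \<turnstile> sub \<sigma> t \<^bold>: sub \<sigma> A" if "?ty \<Gamma> t A" "K \<sigma> \<Gamma> \<Delta>" for \<Gamma> \<Delta> \<sigma> t A
    using that by blast
  have eq0: "\<Delta> \<turnstile> sub \<sigma> t \<simeq> sub \<sigma> u \<^bold>: sub \<sigma> A"
    if "?eq \<Gamma> t u A" "K \<sigma> \<Gamma> \<Delta>" for \<Gamma> \<Delta> \<sigma> t u A
    using that by blast
  have ty1: "sub \<sigma> X # \<Delta> \<turnstile> sub (up_sub \<sigma>) t \<^bold>: sub (up_sub \<sigma>) A"
    if "?ty (X # \<Gamma>) t A" "K \<sigma> \<Gamma> \<Delta>" for X \<Gamma> \<Delta> \<sigma> t A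
    using that up' by blast
  have eq1: "sub \<sigma> X # \<Delta> \<turnstile> sub (up_sub \<sigma>) t \<simeq> sub (up_sub \<sigma>) u \<^bold>: sub (up_sub \<sigma>) A"
    if "?eq (X # \<Gamma>) t u A" "K \<sigma> \<Gamma> \<Delta>" for X \<Gamma> \<Delta> \<sigma> t u A
    using that up' by blast
  have ty2: "sub (up_sub \<sigma>) Y # sub \<sigma> X # \<Delta> \<turnstile> sub (up_sub (up_sub \<sigma>)) t \<^bold>: sub (up_sub (up_sub \<sigma>)) A"
    if "?ty (Y # X # \<Gamma>) t A" "K \<sigma> \<Gamma> \<Delta>" for X Y \<Gamma> \<Delta> \<sigma> t A
    by (rule ty1[OF that(1) up'[OF _ that(2)]]) (use that(1) in simp)
  have eq2: "sub (up_sub \<sigma>) Y # sub \<sigma> X # \<Delta> \<turnstile>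
      sub (up_sub (up_sub \<sigma>)) t \<simeq> sub (up_sub (up_sub \<sigma>)) u \<^bold>: sub (up_sub (up_sub \<sigma>)) A"
    if "?eq (Y # X # \<Gamma>) t u A" "K \<sigma> \<Gamma> \<Delta>" for X Y \<Gamma> \<Delta> \<sigma> t u A
    by (rule eq1[OF that(1) up'[OF _ that(2)]]) (use that(1) in simp)
  have ty3: "sub (up_sub (up_sub \<sigma>)) Z # sub (up_sub \<sigma>) Y # sub \<sigma> X # \<Delta> \<turnstile>
      sub (up_sub (up_sub (up_sub \<sigma>))) t \<^bold>: sub (up_sub (up_sub (up_sub \<sigma>))) A"
    if "?ty (Z # Y # X # \<Gamma>) t A" "K \<sigma> \<Gamma> \<Delta>" for X Y Z \<Gamma> \<Delta> \<sigma> t A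
    by (rule ty2[OF that(1) up'[OF _ that(2)]]) (use that(1) in simp)
  have tyI: "?ty \<Gamma> t A" if "ctx_stable K \<Gamma>" "\<And>\<sigma> \<Delta>. K \<sigma> \<Gamma> \<Delta> \<Longrightarrow> \<Delta> \<turnstile> sub \<sigma> t \<^bold>: sub \<sigma> A" for \<Gamma> t A
    using that by blast
  have eqI: "?eq \<Gamma> t u A"
    if "ctx_stable K \<Gamma>" "\<And>\<sigma> \<Delta>. K \<sigma> \<Gamma> \<Delta> \<Longrightarrow> \<Delta> \<turnstile> sub \<sigma> t \<simeq> sub \<sigma> u \<^bold>: sub \<sigma> A" for \<Gamma> t u A
    using that by blast
  {
    case ctx_nil
    show ?case by simp
  next
    case (ctx_cons \<Gamma> A i)
    then show ?case by auto
  next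
    case (ty_var \<Gamma> n)
    then show ?case by (simp add: var sigma)
  next
    case (ty_conv \<Gamma> a A B i)
    show ?case
    proof (rule tyI)
      show "ctx_stable K \<Gamma>" using ty_conv.IH by simp
      fix \<sigma> \<Delta> assume K: "K \<sigma> \<Gamma> \<Delta>"
      show "\<Delta> \<turnstile> sub \<sigma> a \<^bold>: sub \<sigma> B"
        by (rule ty_cast[OF wf_ctx_has_type_eq_at.ty_conv[where a = "sub \<sigma> a" and A = "sub \<sigma> A"
          and B = "sub \<sigma> B"]])
          (use ty0[OF ty_conv.IH(1) K] eq0[OF ty_conv.IH(2) K]
            in \<open>simp_all add: sigma split del: if_split\<close>)
    qed
  next
    case (ty_univ \<Gamma> i)
    then show ?case by (simp add: ctx wf_ctx_has_type_eq_at.ty_univ)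
  next
    case (ty_pi \<Gamma> A i B j)
    show ?case
    proof (rule tyI)
      show "ctx_stable K \<Gamma>" using ty_pi.IH by simp
      fix \<sigma> \<Delta> assume K: "K \<sigma> \<Gamma> \<Delta>"
      show "\<Delta> \<turnstile> sub \<sigma> (Pi A B) \<^bold>: sub \<sigma> (Univ (if j = 0 then 0 else max i j))"
        by (rule ty_cast[OF wf_ctx_has_type_eq_at.ty_pi[where A = "sub \<sigma> A"
          and B = "sub (up_sub \<sigma>) B"]])
          (use ty0[OF ty_pi.IH(1) K] ty1[OF ty_pi.IH(2) K]
            in \<open>simp_all add: sigma split del: if_split\<close>)
    qed
  next
    case (ty_lam A \<Gamma> b B)
    show ?case
    proof (rule tyI)
      show "ctx_stable K \<Gamma>" using ty_lam.IH by simp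
      fix \<sigma> \<Delta> assume K: "K \<sigma> \<Gamma> \<Delta>"
      show "\<Delta> \<turnstile> sub \<sigma> (Lam b) \<^bold>: sub \<sigma> (Pi A B)"
        by (rule ty_cast[OF wf_ctx_has_type_eq_at.ty_lam[where A = "sub \<sigma> A"
          and b = "sub (up_sub \<sigma>) b" and B = "sub (up_sub \<sigma>) B"]])
          (use ty1[OF ty_lam.IH(1) K] in \<open>simp_all add: sigma split del: if_split\<close>)
    qed
  next
    case (ty_app \<Gamma> t A B a)
    show ?case
    proof (rule tyI)
      show "ctx_stable K \<Gamma>" using ty_app.IH by simp
      fix \<sigma> \<Delta> assume K: "K \<sigma> \<Gamma> \<Delta>"
      show "\<Delta> \<turnstile> sub \<sigma> (App t a) \<^bold>: sub \<sigma> (B\<langle>a\<rangle>)"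
        by (rule ty_cast[OF wf_ctx_has_type_eq_at.ty_app[where t = "sub \<sigma> t" and A = "sub \<sigma> A"
          and B = "sub (up_sub \<sigma>) B" and a = "sub \<sigma> a"]])
          (use ty0[OF ty_app.IH(1) K] ty0[OF ty_app.IH(2) K]
            in \<open>simp_all add: sigma split del: if_split\<close>)
    qed
  next
    case (ty_sig \<Gamma> A i B j)
    show ?case
    proof (rule tyI)
      show "ctx_stable K \<Gamma>" using ty_sig.IH by simp
      fix \<sigma> \<Delta> assume K: "K \<sigma> \<Gamma> \<Delta>"
      show "\<Delta> \<turnstile> sub \<sigma> (Sig A B) \<^bold>: sub \<sigma> (Univ (max i j))"
        by (rule ty_cast[OF wf_ctx_has_type_eq_at.ty_sig[where A = "sub \<sigma> A"
          and B = "sub (up_sub \<sigma>) B"]])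
          (use ty0[OF ty_sig.IH(1) K] ty1[OF ty_sig.IH(2) K]
            in \<open>simp_all add: sigma split del: if_split\<close>)
    qed
  next
    case (ty_pair A \<Gamma> B j a b)
    show ?case
    proof (rule tyI)
      show "ctx_stable K \<Gamma>" using ty_pair.IH by simp
      fix \<sigma> \<Delta> assume K: "K \<sigma> \<Gamma> \<Delta>"
      show "\<Delta> \<turnstile> sub \<sigma> (Pair a b) \<^bold>: sub \<sigma> (Sig A B)"
        by (rule ty_cast[OF wf_ctx_has_type_eq_at.ty_pair[where A = "sub \<sigma> A"
          and B = "sub (up_sub \<sigma>) B" and a = "sub \<sigma> a" and b = "sub \<sigma> b"]])
          (use ty1[OF ty_pair.IH(1) K] ty0[OF ty_pair.IH(2) K] ty0[OF ty_pair.IH(3) K]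
            in \<open>simp_all add: sigma split del: if_split\<close>)
    qed
  next
    case (ty_split A B \<Gamma> C k d p)
    show ?case
    proof (rule tyI)
      show "ctx_stable K \<Gamma>" using ty_split.IH by simp
      fix \<sigma> \<Delta> assume K: "K \<sigma> \<Gamma> \<Delta>"
      show "\<Delta> \<turnstile> sub \<sigma> (Split d p) \<^bold>: sub \<sigma> (C\<langle>p\<rangle>)"
        by (rule ty_cast[OF wf_ctx_has_type_eq_at.ty_split[where A = "sub \<sigma> A"
          and B = "sub (up_sub \<sigma>) B" and C = "sub (up_sub \<sigma>) C"
            and d = "sub (up_sub (up_sub \<sigma>)) d" and p = "sub \<sigma> p"]])
          (use ty1[OF ty_split.IH(1) K] ty2[OF ty_split.IH(2) K] ty0[OF ty_split.IH(3) K]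
            in \<open>simp_all add: sigma split del: if_split\<close>)
    qed
  next
    case (ty_id \<Gamma> A i a b)
    show ?case
    proof (rule tyI)
      show "ctx_stable K \<Gamma>" using ty_id.IH by simp
      fix \<sigma> \<Delta> assume K: "K \<sigma> \<Gamma> \<Delta>"
      show "\<Delta> \<turnstile> sub \<sigma> (Id A a b) \<^bold>: sub \<sigma> (Univ i)"
        by (rule ty_cast[OF wf_ctx_has_type_eq_at.ty_id[where A = "sub \<sigma> A" and a = "sub \<sigma> a"
          and b = "sub \<sigma> b"]])
          (use ty0[OF ty_id.IH(1) K] ty0[OF ty_id.IH(2) K] ty0[OF ty_id.IH(3) K]
            in \<open>simp_all add: sigma split del: if_split\<close>)
    qed
  next
    case (ty_refl \<Gamma> a A)
    show ?case
    proof (rule tyI)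
      show "ctx_stable K \<Gamma>" using ty_refl.IH by simp
      fix \<sigma> \<Delta> assume K: "K \<sigma> \<Gamma> \<Delta>"
      show "\<Delta> \<turnstile> sub \<sigma> (Refl a) \<^bold>: sub \<sigma> (Id A a a)"
        by (rule ty_cast[OF wf_ctx_has_type_eq_at.ty_refl[where a = "sub \<sigma> a" and A = "sub \<sigma> A"]])
          (use ty0[OF ty_refl.IH(1) K] in \<open>simp_all add: sigma split del: if_split\<close>)
    qed
  next
    case (ty_J A \<Gamma> C k d a b p)
    show ?case
    proof (rule tyI)
      show "ctx_stable K \<Gamma>" using ty_J.IH by simp
      fix \<sigma> \<Delta> assume K: "K \<sigma> \<Gamma> \<Delta>"
      show "\<Delta> \<turnstile> sub \<sigma> (J d p) \<^bold>: sub \<sigma> (sub (p \<cdot> b \<cdot> a \<cdot> Var) C)"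
        by (rule ty_cast[OF wf_ctx_has_type_eq_at.ty_J[where A = "sub \<sigma> A"
          and C = "sub (up_sub (up_sub (up_sub \<sigma>))) C" and d = "sub (up_sub \<sigma>) d"
            and a = "sub \<sigma> a" and b = "sub \<sigma> b" and p = "sub \<sigma> p"]])
          (use ty3[OF ty_J.IH(1) K] ty1[OF ty_J.IH(2) K] ty0[OF ty_J.IH(3) K] ty0[OF ty_J.IH(4) K]
            ty0[OF ty_J.IH(5) K] in \<open>simp_all add: sigma split del: if_split\<close>)
    qed
  next
    case (ty_funext \<Gamma> f A B g h)
    show ?case
    proof (rule tyI)
      show "ctx_stable K \<Gamma>" using ty_funext.IH by simp
      fix \<sigma> \<Delta> assume K: "K \<sigma> \<Gamma> \<Delta>"
      show "\<Delta> \<turnstile> sub \<sigma> (FunExt h) \<^bold>: sub \<sigma> (Id (Pi A B) f g)"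
        by (rule ty_cast[OF wf_ctx_has_type_eq_at.ty_funext[where f = "sub \<sigma> f" and A = "sub \<sigma> A"
          and B = "sub (up_sub \<sigma>) B" and g = "sub \<sigma> g" and h = "sub \<sigma> h"]])
          (use ty0[OF ty_funext.IH(1) K] ty0[OF ty_funext.IH(2) K] ty0[OF ty_funext.IH(3) K]
            in \<open>simp_all add: sigma split del: if_split\<close>)
    qed
  next
    case (ty_uip \<Gamma> p A a b q)
    show ?case
    proof (rule tyI)
      show "ctx_stable K \<Gamma>" using ty_uip.IH by simp
      fix \<sigma> \<Delta> assume K: "K \<sigma> \<Gamma> \<Delta>"
      show "\<Delta> \<turnstile> sub \<sigma> (UIP p q) \<^bold>: sub \<sigma> (Id (Id A a b) p q)"
        by (rule ty_cast[OF wf_ctx_has_type_eq_at.ty_uip[where p = "sub \<sigma> p" and A = "sub \<sigma> A"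
          and a = "sub \<sigma> a" and b = "sub \<sigma> b" and q = "sub \<sigma> q"]])
          (use ty0[OF ty_uip.IH(1) K] ty0[OF ty_uip.IH(2) K]
            in \<open>simp_all add: sigma split del: if_split\<close>)
    qed
  next
    case (eq_refl \<Gamma> a A)
    show ?case
    proof (rule eqI)
      show "ctx_stable K \<Gamma>" using eq_refl.IH by simp
      fix \<sigma> \<Delta> assume K: "K \<sigma> \<Gamma> \<Delta>"
      show "\<Delta> \<turnstile> sub \<sigma> a \<simeq> sub \<sigma> a \<^bold>: sub \<sigma> A"
        by (rule eq_cast[OF wf_ctx_has_type_eq_at.eq_refl[where a = "sub \<sigma> a" and A = "sub \<sigma> A"]])
          (use ty0[OF eq_refl.IH(1) K] in \<open>simp_all add: sigma split del: if_split\<close>)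
    qed
  next
    case (eq_sym \<Gamma> a b A)
    show ?case
    proof (rule eqI)
      show "ctx_stable K \<Gamma>" using eq_sym.IH by simp
      fix \<sigma> \<Delta> assume K: "K \<sigma> \<Gamma> \<Delta>"
      show "\<Delta> \<turnstile> sub \<sigma> b \<simeq> sub \<sigma> a \<^bold>: sub \<sigma> A"
        by (rule eq_cast[OF wf_ctx_has_type_eq_at.eq_sym[where a = "sub \<sigma> a" and b = "sub \<sigma> b"
          and A = "sub \<sigma> A"]])
          (use eq0[OF eq_sym.IH(1) K] in \<open>simp_all add: sigma split del: if_split\<close>)
    qed
  next
    case (eq_trans \<Gamma> a b A c)
    show ?case
    proof (rule eqI)
      show "ctx_stable K \<Gamma>" using eq_trans.IH by simp
      fix \<sigma> \<Delta> assume K: "K \<sigma> \<Gamma> \<Delta>"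
      show "\<Delta> \<turnstile> sub \<sigma> a \<simeq> sub \<sigma> c \<^bold>: sub \<sigma> A"
        by (rule eq_cast[OF wf_ctx_has_type_eq_at.eq_trans[where a = "sub \<sigma> a" and b = "sub \<sigma> b"
          and A = "sub \<sigma> A" and c = "sub \<sigma> c"]])
          (use eq0[OF eq_trans.IH(1) K] eq0[OF eq_trans.IH(2) K]
            in \<open>simp_all add: sigma split del: if_split\<close>)
    qed
  next
    case (eq_conv \<Gamma> a b A B i)
    show ?case
    proof (rule eqI)
      show "ctx_stable K \<Gamma>" using eq_conv.IH by simp
      fix \<sigma> \<Delta> assume K: "K \<sigma> \<Gamma> \<Delta>"
      show "\<Delta> \<turnstile> sub \<sigma> a \<simeq> sub \<sigma> b \<^bold>: sub \<sigma> B"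
        by (rule eq_cast[OF wf_ctx_has_type_eq_at.eq_conv[where a = "sub \<sigma> a" and b = "sub \<sigma> b"
          and A = "sub \<sigma> A" and B = "sub \<sigma> B"]])
          (use eq0[OF eq_conv.IH(1) K] eq0[OF eq_conv.IH(2) K]
            in \<open>simp_all add: sigma split del: if_split\<close>)
    qed
  next
    case (eq_pi \<Gamma> A i A' B B' j)
    show ?case
    proof (rule eqI)
      show "ctx_stable K \<Gamma>" using eq_pi.IH by simp
      fix \<sigma> \<Delta> assume K: "K \<sigma> \<Gamma> \<Delta>"
      show "\<Delta> \<turnstile> sub \<sigma> (Pi A B) \<simeq> sub \<sigma> (Pi A' B') \<^bold>: sub \<sigma> (Univ (if j = 0 then 0 else max i j))"
        by (rule eq_cast[OF wf_ctx_has_type_eq_at.eq_pi[where A = "sub \<sigma> A" and A' = "sub \<sigma> A'"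
          and B = "sub (up_sub \<sigma>) B" and B' = "sub (up_sub \<sigma>) B'"]])
          (use ty0[OF eq_pi.IH(1) K] eq0[OF eq_pi.IH(2) K] eq1[OF eq_pi.IH(3) K]
            in \<open>simp_all add: sigma split del: if_split\<close>)
    qed
  next
    case (eq_lam A \<Gamma> b b' B)
    show ?case
    proof (rule eqI)
      show "ctx_stable K \<Gamma>" using eq_lam.IH by simp
      fix \<sigma> \<Delta> assume K: "K \<sigma> \<Gamma> \<Delta>"
      show "\<Delta> \<turnstile> sub \<sigma> (Lam b) \<simeq> sub \<sigma> (Lam b') \<^bold>: sub \<sigma> (Pi A B)"
        by (rule eq_cast[OF wf_ctx_has_type_eq_at.eq_lam[where A = "sub \<sigma> A"
          and b = "sub (up_sub \<sigma>) b" and b' = "sub (up_sub \<sigma>) b'" and B = "sub (up_sub \<sigma>) B"]])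
          (use eq1[OF eq_lam.IH(1) K] in \<open>simp_all add: sigma split del: if_split\<close>)
    qed
  next
    case (eq_app \<Gamma> t t' A B a a')
    show ?case
    proof (rule eqI)
      show "ctx_stable K \<Gamma>" using eq_app.IH by simp
      fix \<sigma> \<Delta> assume K: "K \<sigma> \<Gamma> \<Delta>"
      show "\<Delta> \<turnstile> sub \<sigma> (App t a) \<simeq> sub \<sigma> (App t' a') \<^bold>: sub \<sigma> (B\<langle>a\<rangle>)"
        by (rule eq_cast[OF wf_ctx_has_type_eq_at.eq_app[where t = "sub \<sigma> t" and t' = "sub \<sigma> t'"
          and A = "sub \<sigma> A" and B = "sub (up_sub \<sigma>) B" and a = "sub \<sigma> a" and a' = "sub \<sigma> a'"]])
          (use eq0[OF eq_app.IH(1) K] eq0[OF eq_app.IH(2) K]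
            in \<open>simp_all add: sigma split del: if_split\<close>)
    qed
  next
    case (eq_beta A \<Gamma> b B a)
    show ?case
    proof (rule eqI)
      show "ctx_stable K \<Gamma>" using eq_beta.IH by simp
      fix \<sigma> \<Delta> assume K: "K \<sigma> \<Gamma> \<Delta>"
      show "\<Delta> \<turnstile> sub \<sigma> (App (Lam b) a) \<simeq> sub \<sigma> (b\<langle>a\<rangle>) \<^bold>: sub \<sigma> (B\<langle>a\<rangle>)"
        by (rule eq_cast[OF wf_ctx_has_type_eq_at.eq_beta[where A = "sub \<sigma> A"
          and b = "sub (up_sub \<sigma>) b" and B = "sub (up_sub \<sigma>) B" and a = "sub \<sigma> a"]])
          (use ty1[OF eq_beta.IH(1) K] ty0[OF eq_beta.IH(2) K]
            in \<open>simp_all add: sigma split del: if_split\<close>)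
    qed
  next
    case (eq_sig \<Gamma> A i A' B B' j)
    show ?case
    proof (rule eqI)
      show "ctx_stable K \<Gamma>" using eq_sig.IH by simp
      fix \<sigma> \<Delta> assume K: "K \<sigma> \<Gamma> \<Delta>"
      show "\<Delta> \<turnstile> sub \<sigma> (Sig A B) \<simeq> sub \<sigma> (Sig A' B') \<^bold>: sub \<sigma> (Univ (max i j))"
        by (rule eq_cast[OF wf_ctx_has_type_eq_at.eq_sig[where A = "sub \<sigma> A" and A' = "sub \<sigma> A'"
          and B = "sub (up_sub \<sigma>) B" and B' = "sub (up_sub \<sigma>) B'"]])
          (use ty0[OF eq_sig.IH(1) K] eq0[OF eq_sig.IH(2) K] eq1[OF eq_sig.IH(3) K]
            in \<open>simp_all add: sigma split del: if_split\<close>)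
    qed
  next
    case (eq_pair A \<Gamma> B j a a' b b')
    show ?case
    proof (rule eqI)
      show "ctx_stable K \<Gamma>" using eq_pair.IH by simp
      fix \<sigma> \<Delta> assume K: "K \<sigma> \<Gamma> \<Delta>"
      show "\<Delta> \<turnstile> sub \<sigma> (Pair a b) \<simeq> sub \<sigma> (Pair a' b') \<^bold>: sub \<sigma> (Sig A B)"
        by (rule eq_cast[OF wf_ctx_has_type_eq_at.eq_pair[where A = "sub \<sigma> A"
          and B = "sub (up_sub \<sigma>) B" and a = "sub \<sigma> a" and a' = "sub \<sigma> a'"
            and b = "sub \<sigma> b" and b' = "sub \<sigma> b'"]])
          (use ty1[OF eq_pair.IH(1) K] eq0[OF eq_pair.IH(2) K] eq0[OF eq_pair.IH(3) K]
            in \<open>simp_all add: sigma split del: if_split\<close>)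
    qed
  next
    case (eq_split A B \<Gamma> C k d d' p p')
    show ?case
    proof (rule eqI)
      show "ctx_stable K \<Gamma>" using eq_split.IH by simp
      fix \<sigma> \<Delta> assume K: "K \<sigma> \<Gamma> \<Delta>"
      show "\<Delta> \<turnstile> sub \<sigma> (Split d p) \<simeq> sub \<sigma> (Split d' p') \<^bold>: sub \<sigma> (C\<langle>p\<rangle>)"
        by (rule eq_cast[OF wf_ctx_has_type_eq_at.eq_split[where A = "sub \<sigma> A"
          and B = "sub (up_sub \<sigma>) B" and C = "sub (up_sub \<sigma>) C"
            and d = "sub (up_sub (up_sub \<sigma>)) d" and d' = "sub (up_sub (up_sub \<sigma>)) d'"
              and p = "sub \<sigma> p" and p' = "sub \<sigma> p'"]])
          (use ty1[OF eq_split.IH(1) K] eq2[OF eq_split.IH(2) K] eq0[OF eq_split.IH(3) K]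
            in \<open>simp_all add: sigma split del: if_split\<close>)
    qed
  next
    case (eq_split_beta A B \<Gamma> C k d a b)
    show ?case
    proof (rule eqI)
      show "ctx_stable K \<Gamma>" using eq_split_beta.IH by simp
      fix \<sigma> \<Delta> assume K: "K \<sigma> \<Gamma> \<Delta>"
      show "\<Delta> \<turnstile> sub \<sigma> (Split d (Pair a b)) \<simeq> sub \<sigma> (sub (b \<cdot> a \<cdot> Var) d) \<^bold>: sub \<sigma> (C\<langle>Pair a b\<rangle>)"
        by (rule eq_cast[OF wf_ctx_has_type_eq_at.eq_split_beta[where A = "sub \<sigma> A"
          and B = "sub (up_sub \<sigma>) B" and C = "sub (up_sub \<sigma>) C"
            and d = "sub (up_sub (up_sub \<sigma>)) d" and a = "sub \<sigma> a" and b = "sub \<sigma> b"]])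
          (use ty1[OF eq_split_beta.IH(1) K] ty2[OF eq_split_beta.IH(2) K]
            ty0[OF eq_split_beta.IH(3) K] ty0[OF eq_split_beta.IH(4) K]
              in \<open>simp_all add: sigma split del: if_split\<close>)
    qed
  next
    case (eq_id \<Gamma> A A' i a a' b b')
    show ?case
    proof (rule eqI)
      show "ctx_stable K \<Gamma>" using eq_id.IH by simp
      fix \<sigma> \<Delta> assume K: "K \<sigma> \<Gamma> \<Delta>"
      show "\<Delta> \<turnstile> sub \<sigma> (Id A a b) \<simeq> sub \<sigma> (Id A' a' b') \<^bold>: sub \<sigma> (Univ i)"
        by (rule eq_cast[OF wf_ctx_has_type_eq_at.eq_id[where A = "sub \<sigma> A" and A' = "sub \<sigma> A'"
          and a = "sub \<sigma> a" and a' = "sub \<sigma> a'" and b = "sub \<sigma> b" and b' = "sub \<sigma> b'"]])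
          (use eq0[OF eq_id.IH(1) K] eq0[OF eq_id.IH(2) K] eq0[OF eq_id.IH(3) K]
            in \<open>simp_all add: sigma split del: if_split\<close>)
    qed
  next
    case (eq_refl_cong \<Gamma> a a' A)
    show ?case
    proof (rule eqI)
      show "ctx_stable K \<Gamma>" using eq_refl_cong.IH by simp
      fix \<sigma> \<Delta> assume K: "K \<sigma> \<Gamma> \<Delta>"
      show "\<Delta> \<turnstile> sub \<sigma> (Refl a) \<simeq> sub \<sigma> (Refl a') \<^bold>: sub \<sigma> (Id A a a)"
        by (rule eq_cast[OF wf_ctx_has_type_eq_at.eq_refl_cong[where a = "sub \<sigma> a" and a' = "sub \<sigma> a'" and A = "sub \<sigma> A"]])
          (use eq0[OF eq_refl_cong.IH(1) K] in \<open>simp_all add: sigma split del: if_split\<close>)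
    qed
  next
    case (eq_J A \<Gamma> C k d d' a b p p')
    show ?case
    proof (rule eqI)
      show "ctx_stable K \<Gamma>" using eq_J.IH by simp
      fix \<sigma> \<Delta> assume K: "K \<sigma> \<Gamma> \<Delta>"
      show "\<Delta> \<turnstile> sub \<sigma> (J d p) \<simeq> sub \<sigma> (J d' p') \<^bold>: sub \<sigma> (sub (p \<cdot> b \<cdot> a \<cdot> Var) C)"
        by (rule eq_cast[OF wf_ctx_has_type_eq_at.eq_J[where A = "sub \<sigma> A"
          and C = "sub (up_sub (up_sub (up_sub \<sigma>))) C"
            and d = "sub (up_sub \<sigma>) d" and d' = "sub (up_sub \<sigma>) d'" and a = "sub \<sigma> a"
              and b = "sub \<sigma> b" and p = "sub \<sigma> p" and p' = "sub \<sigma> p'"]])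
          (use ty3[OF eq_J.IH(1) K] eq1[OF eq_J.IH(2) K] ty0[OF eq_J.IH(3) K] ty0[OF eq_J.IH(4) K]
            eq0[OF eq_J.IH(5) K] in \<open>simp_all add: sigma split del: if_split\<close>)
    qed
  next
    case (eq_J_beta A \<Gamma> C k d a)
    show ?case
    proof (rule eqI)
      show "ctx_stable K \<Gamma>" using eq_J_beta.IH by simp
      fix \<sigma> \<Delta> assume K: "K \<sigma> \<Gamma> \<Delta>"
      show "\<Delta> \<turnstile> sub \<sigma> (J d (Refl a)) \<simeq> sub \<sigma> (d\<langle>a\<rangle>) \<^bold>: sub \<sigma> (sub (Refl a \<cdot> a \<cdot> a \<cdot> Var) C)"
        by (rule eq_cast[OF wf_ctx_has_type_eq_at.eq_J_beta[where A = "sub \<sigma> A"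
          and C = "sub (up_sub (up_sub (up_sub \<sigma>))) C" and d = "sub (up_sub \<sigma>) d"
            and a = "sub \<sigma> a"]])
          (use ty3[OF eq_J_beta.IH(1) K] ty1[OF eq_J_beta.IH(2) K] ty0[OF eq_J_beta.IH(3) K]
            in \<open>simp_all add: sigma split del: if_split\<close>)
    qed
  next
    case (eq_funext \<Gamma> f A B g h h')
    show ?case
    proof (rule eqI)
      show "ctx_stable K \<Gamma>" using eq_funext.IH by simp
      fix \<sigma> \<Delta> assume K: "K \<sigma> \<Gamma> \<Delta>"
      show "\<Delta> \<turnstile> sub \<sigma> (FunExt h) \<simeq> sub \<sigma> (FunExt h') \<^bold>: sub \<sigma> (Id (Pi A B) f g)"
        by (rule eq_cast[OF wf_ctx_has_type_eq_at.eq_funext[where f = "sub \<sigma> f" and A = "sub \<sigma> A"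
          and B = "sub (up_sub \<sigma>) B" and g = "sub \<sigma> g" and h = "sub \<sigma> h" and h' = "sub \<sigma> h'"]])
          (use ty0[OF eq_funext.IH(1) K] ty0[OF eq_funext.IH(2) K] eq0[OF eq_funext.IH(3) K]
            in \<open>simp_all add: sigma split del: if_split\<close>)
    qed
  next
    case (eq_uip \<Gamma> p p' A a b q q')
    show ?case
    proof (rule eqI)
      show "ctx_stable K \<Gamma>" using eq_uip.IH by simp
      fix \<sigma> \<Delta> assume K: "K \<sigma> \<Gamma> \<Delta>"
      show "\<Delta> \<turnstile> sub \<sigma> (UIP p q) \<simeq> sub \<sigma> (UIP p' q') \<^bold>: sub \<sigma> (Id (Id A a b) p q)"
        by (rule eq_cast[OF wf_ctx_has_type_eq_at.eq_uip[where p = "sub \<sigma> p" and p' = "sub \<sigma> p'"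
          and A = "sub \<sigma> A" and a = "sub \<sigma> a" and b = "sub \<sigma> b"
            and q = "sub \<sigma> q" and q' = "sub \<sigma> q'"]])
          (use eq0[OF eq_uip.IH(1) K] eq0[OF eq_uip.IH(2) K]
            in \<open>simp_all add: sigma split del: if_split\<close>)
    qed
  }
qed

section \<open>Renaming, weakening and well-typed substitution\<close>

declare sigma [simp]

abbreviation sh :: "nat \<Rightarrow> tm \<Rightarrow> tm" where
  "sh k \<equiv> sub (wk k)"

text \<open>Types are required to agree as syntax instead of through a typing judgement. Passing
  under a binder then needs no weakening, which is only obtained afterwards as a special
  case.\<close>

definition renames :: "(nat \<Rightarrow> tm) \<Rightarrow> tm list \<Rightarrow> tm list \<Rightarrow> bool" where
  "renames \<sigma> \<Gamma> \<Delta> \<longleftrightarrow> \<turnstile> \<Delta> ctx \<and> (\<forall>n<length \<Gamma>. \<exists>m<length \<Delta>. \<sigma> n = Var m \<and>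
     sh (Suc m) (\<Delta> ! m) = sub (wk (Suc n) \<odot> \<sigma>) (\<Gamma> ! n))"

lemma var_type: "\<turnstile> \<Gamma> ctx \<Longrightarrow> n < length \<Gamma> \<Longrightarrow> A = sh (Suc n) (\<Gamma> ! n) \<Longrightarrow> \<Gamma> \<turnstile> Var n \<^bold>: A"
  using ty_var by (simp only: lift_eq_wk)

lemma renaming:
  assumes "\<Gamma> \<turnstile> t \<^bold>: A" "renames \<sigma> \<Gamma> \<Delta>"
  shows "\<Delta> \<turnstile> sub \<sigma> t \<^bold>: sub \<sigma> A"
proof -
  have up: "renames (up_sub \<sigma>) (A # \<Gamma>) (sub \<sigma> A # \<Delta>)"
    if r: "renames \<sigma> \<Gamma> \<Delta>" and A: "\<Delta> \<turnstile> sub \<sigma> A \<^bold>: Univ i" for \<sigma> \<Gamma> \<Delta> A i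
    unfolding renames_def
  proof (intro conjI allI impI)
    show "\<turnstile> sub \<sigma> A # \<Delta> ctx" using r A ctx_cons by (auto simp: renames_def)
    fix n assume n: "n < length (A # \<Gamma>)"
    show "\<exists>m<length (sub \<sigma> A # \<Delta>). up_sub \<sigma> n = Var m \<and>
        sh (Suc m) ((sub \<sigma> A # \<Delta>) ! m) = sub (wk (Suc n) \<odot> up_sub \<sigma>) ((A # \<Gamma>) ! n)"
    proof (cases n)
      case 0
      then show ?thesis by (intro exI[of _ 0]) simp
    next
      case (Suc k)
      then obtain m where m: "m < length \<Delta>" "\<sigma> k = Var m"
        "sh (Suc m) (\<Delta> ! m) = sub (wk (Suc k) \<odot> \<sigma>) (\<Gamma> ! k)"
        using r n unfolding renames_def by auto
      \<comment> \<open>Shifting both sides of the equation for \<open>k\<close> yields the equation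
        for \<open>Suc k\<close>, because \<open>up_sub\<close> composes with
        \<open>wk 1\<close>.\<close>
      have "sh (Suc 0) (sh (Suc m) (\<Delta> ! m)) = sh (Suc 0) (sub (wk (Suc k) \<odot> \<sigma>) (\<Gamma> ! k))"
        by (simp only: m)
      then show ?thesis using Suc m(1,2) by (intro exI[of _ "Suc m"]) simp
    qed
  qed
  have c: "\<turnstile> \<Delta> ctx" if "renames \<sigma> \<Gamma> \<Delta>" for \<sigma> \<Gamma> \<Delta>
    using that by (simp add: renames_def)
  have var: "\<Delta> \<turnstile> \<sigma> n \<^bold>: sub (wk (Suc n) \<odot> \<sigma>) (\<Gamma> ! n)"
    if "renames \<sigma> \<Gamma> \<Delta>" "n < length \<Gamma>" for \<sigma> \<Gamma> \<Delta> n
    using that var_type unfolding renames_def by metis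
  show ?thesis
    using substitution(2)[where K = renames, rotated 3, OF assms(1)] assms(2) c var up by auto
qed

lemma weakening:
  assumes "\<Gamma> \<turnstile> t \<^bold>: A" "\<turnstile> \<Delta> @ \<Gamma> ctx"
  shows "\<Delta> @ \<Gamma> \<turnstile> sh (length \<Delta>) t \<^bold>: sh (length \<Delta>) A"
  by (rule renaming[OF assms(1)])
    (auto simp: renames_def assms(2) nth_append intro!: exI[of _ "_ + length \<Delta>"])

lemmas weaken1 = weakening[of _ _ _ "[D1]" for D1, simplified]
  and weaken2 = weakening[of _ _ _ "[D2, D1]" for D1 D2, simplified]

text \<open>The second instance of the class \<open>K\<close>. Here the images are arbitrary typed
  terms, so passing under a binder relies on \<open>weaken1\<close>.\<close>

definition substitutes :: "(nat \<Rightarrow> tm) \<Rightarrow> tm list \<Rightarrow> tm list \<Rightarrow> bool" where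
  "substitutes \<sigma> \<Gamma> \<Delta> \<longleftrightarrow> \<turnstile> \<Delta> ctx \<and>
    (\<forall>n<length \<Gamma>. \<Delta> \<turnstile> \<sigma> n \<^bold>: sub (wk (Suc n) \<odot> \<sigma>) (\<Gamma> ! n))"

lemma substituting:
  assumes "substitutes \<sigma> \<Gamma> \<Delta>"
  shows "\<Gamma> \<turnstile> t \<^bold>: A \<Longrightarrow> \<Delta> \<turnstile> sub \<sigma> t \<^bold>: sub \<sigma> A"
    and "\<Gamma> \<turnstile> t \<simeq> u \<^bold>: A \<Longrightarrow> \<Delta> \<turnstile> sub \<sigma> t \<simeq> sub \<sigma> u \<^bold>: sub \<sigma> A"
proof -
  have up: "substitutes (up_sub \<sigma>) (A # \<Gamma>) (sub \<sigma> A # \<Delta>)"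
    if r: "substitutes \<sigma> \<Gamma> \<Delta>" and A: "\<Delta> \<turnstile> sub \<sigma> A \<^bold>: Univ i" for \<sigma> \<Gamma> \<Delta> A i
    unfolding substitutes_def
  proof (intro conjI allI impI)
    show c: "\<turnstile> sub \<sigma> A # \<Delta> ctx" using r A ctx_cons by (auto simp: substitutes_def)
    fix n assume n: "n < length (A # \<Gamma>)"
    show "sub \<sigma> A # \<Delta> \<turnstile> up_sub \<sigma> n \<^bold>: sub (wk (Suc n) \<odot> up_sub \<sigma>) ((A # \<Gamma>) ! n)"
    proof (cases n)
      case 0
      then show ?thesis using var_type[OF c, of 0] by simp
    next
      case (Suc k)
      then have "\<Delta> \<turnstile> \<sigma> k \<^bold>: sub (wk (Suc k) \<odot> \<sigma>) (\<Gamma> ! k)"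
        using r n by (auto simp: substitutes_def)
      from weaken1[OF this c] show ?thesis using Suc by simp
    qed
  qed
  have c: "\<turnstile> \<Delta> ctx" if "substitutes \<sigma> \<Gamma> \<Delta>" for \<sigma> \<Gamma> \<Delta>
    using that by (simp add: substitutes_def)
  have var: "\<Delta> \<turnstile> \<sigma> n \<^bold>: sub (wk (Suc n) \<odot> \<sigma>) (\<Gamma> ! n)"
    if "substitutes \<sigma> \<Gamma> \<Delta>" "n < length \<Gamma>" for \<sigma> \<Gamma> \<Delta> n
    using that unfolding substitutes_def by metis
  show "\<Gamma> \<turnstile> t \<^bold>: A \<Longrightarrow> \<Delta> \<turnstile> sub \<sigma> t \<^bold>: sub \<sigma> A"
    using
      substitution(2)[where K = substitutes, rotated 3, of \<Gamma> t A] assms c var up by auto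
  show "\<Gamma> \<turnstile> t \<simeq> u \<^bold>: A \<Longrightarrow> \<Delta> \<turnstile> sub \<sigma> t \<simeq> sub \<sigma> u \<^bold>: sub \<sigma> A"
    using
      substitution(3)[where K = substitutes, rotated 3, of \<Gamma> t u A] assms c var up by auto
qed

lemma substitutes_scons:
  assumes "substitutes \<sigma> \<Gamma> \<Delta>" "\<Delta> \<turnstile> a \<^bold>: sub \<sigma> A"
  shows "substitutes (a \<cdot> \<sigma>) (A # \<Gamma>) \<Delta>"
  unfolding substitutes_def
proof (intro conjI allI impI)
  show "\<turnstile> \<Delta> ctx" using assms(1) by (simp add: substitutes_def)
  show "\<Delta> \<turnstile> (a \<cdot> \<sigma>) n \<^bold>: sub (wk (Suc n) \<odot> (a \<cdot> \<sigma>)) ((A # \<Gamma>) ! n)" if "n < length (A # \<Gamma>)" for n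
    using assms that by (cases n) (auto simp: substitutes_def)
qed

lemma substitutes_Var: "\<turnstile> \<Gamma> ctx \<Longrightarrow> substitutes Var \<Gamma> \<Gamma>"
  by (auto simp: substitutes_def intro!: var_type)

lemma subst1:
  assumes "A # \<Gamma> \<turnstile> b \<^bold>: B" "\<Gamma> \<turnstile> a \<^bold>: A"
  shows "\<Gamma> \<turnstile> b\<langle>a\<rangle> \<^bold>: B\<langle>a\<rangle>"
  using assms by (intro substituting(1)[OF substitutes_scons[OF substitutes_Var]])
    (auto dest: judgement_ctx)

section \<open>Derived rules\<close>

text \<open>Kept folded, so that substitution distributes over it by \<open>sub_arr\<close> and the
  shift of the codomain never merges with other substitutions.\<close>

definition arr :: "tm \<Rightarrow> tm \<Rightarrow> tm" where
  "arr X Y = Pi X (sh 1 Y)"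

lemma arrow_eq_arr: "X \<rightarrow>\<^sub>t Y = arr X Y"
  by (simp add: arr_def)

lemma sub_arr [simp]: "sub \<sigma> (arr X Y) = arr (sub \<sigma> X) (sub \<sigma> Y)"
  by (simp add: arr_def)

lemma ctx_consI: "\<Gamma> \<turnstile> A \<^bold>: Univ i \<Longrightarrow> \<turnstile> A # \<Gamma> ctx"
  using ctx_cons judgement_ctx(2) by blast

text \<open>The form in which impredicativity is used: the level of the domain is recovered from the
  well-formed context and disappears from the result.\<close>

lemma pi_type0: "A # \<Gamma> \<turnstile> B \<^bold>: \<U> \<Longrightarrow> \<Gamma> \<turnstile> Pi A B \<^bold>: \<U>"
  using ty_pi[where j = 0] judgement_ctx(2) wf_ctx_ConsE by (metis (full_types))

lemma arr_type: "\<Gamma> \<turnstile> X \<^bold>: Univ i \<Longrightarrow> \<Gamma> \<turnstile> Y \<^bold>: Univ j \<Longrightarrow>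
    \<Gamma> \<turnstile> arr X Y \<^bold>: Univ (if j = 0 then 0 else max i j)"
  unfolding arr_def using weaken1[of \<Gamma> Y "Univ j" X] by (intro ty_pi) (auto intro: ctx_consI)

lemmas arr_type0 = arr_type[where j = 0, simplified]

lemma arr_app: "\<Gamma> \<turnstile> t \<^bold>: arr X Y \<Longrightarrow> \<Gamma> \<turnstile> a \<^bold>: X \<Longrightarrow> \<Gamma> \<turnstile> App t a \<^bold>: Y"
  unfolding arr_def by (drule ty_app) auto

lemma arr_lam: "X # \<Gamma> \<turnstile> b \<^bold>: sh 1 Y \<Longrightarrow> \<Gamma> \<turnstile> Lam b \<^bold>: arr X Y"
  unfolding arr_def by (rule ty_lam)

lemma arr_eq_app: "\<Gamma> \<turnstile> t \<simeq> t' \<^bold>: arr X Y \<Longrightarrow> \<Gamma> \<turnstile> a \<simeq> a' \<^bold>: X \<Longrightarrow> \<Gamma> \<turnstile> App t a \<simeq> App t' a' \<^bold>: Y"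
  unfolding arr_def by (drule eq_app) auto

lemma fam_app: "\<Gamma> \<turnstile> B \<^bold>: arr A (Univ i) \<Longrightarrow> \<Gamma> \<turnstile> a \<^bold>: A \<Longrightarrow> \<Gamma> \<turnstile> App B a \<^bold>: Univ i"
  by (rule arr_app)

lemma beta: "A # \<Gamma> \<turnstile> b \<^bold>: B \<Longrightarrow> \<Gamma> \<turnstile> a \<^bold>: A \<Longrightarrow> u = b\<langle>a\<rangle> \<Longrightarrow> T = B\<langle>a\<rangle> \<Longrightarrow>
    \<Gamma> \<turnstile> App (Lam b) a \<simeq> u \<^bold>: T"
  by (simp only: eq_beta)

text \<open>The first contraction moves \<open>a\<close> under the inner binder, so \<open>e\<close>
  has to be retyped along \<open>up_sub (a \<cdot> Var)\<close> before the second one.\<close>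

lemma beta2:
  assumes e: "D # A # \<Gamma> \<turnstile> e \<^bold>: C" and a: "\<Gamma> \<turnstile> a \<^bold>: A" and r: "\<Gamma> \<turnstile> r \<^bold>: D\<langle>a\<rangle>"
    and u: "u = sub (r \<cdot> a \<cdot> Var) e" and T: "T = sub (r \<cdot> a \<cdot> Var) C"
  shows "\<Gamma> \<turnstile> App (App (Lam (Lam e)) a) r \<simeq> u \<^bold>: T"
proof -
  have c: "\<turnstile> D # A # \<Gamma> ctx" using e by (rule judgement_ctx)
  then obtain i where D: "A # \<Gamma> \<turnstile> D \<^bold>: Univ i" by (rule wf_ctx_ConsE)
  have D': "\<Gamma> \<turnstile> D\<langle>a\<rangle> \<^bold>: Univ i" using subst1[OF D a] by simp
  have s: "substitutes (up_sub (a \<cdot> Var)) (D # A # \<Gamma>) (D\<langle>a\<rangle> # \<Gamma>)"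
    using ctx_consI[OF D'] weaken1[OF a ctx_consI[OF D']]
    by (auto simp: substitutes_def nth_Cons' gr0_conv_Suc intro!: var_type split: nat.split)
  have 1: "\<Gamma> \<turnstile> App (Lam (Lam e)) a \<simeq> (Lam e)\<langle>a\<rangle> \<^bold>: (Pi D C)\<langle>a\<rangle>"
    by (rule eq_beta[OF ty_lam[OF e] a])
  have 2: "\<Gamma> \<turnstile> App (App (Lam (Lam e)) a) r \<simeq> App ((Lam e)\<langle>a\<rangle>) r \<^bold>: T"
    by (rule eq_cast[OF eq_app[OF 1[simplified] eq_refl[OF r]]]) (simp_all add: T)
  have 3: "\<Gamma> \<turnstile> App ((Lam e)\<langle>a\<rangle>) r \<simeq> u \<^bold>: T"
    by (rule eq_cast[OF eq_beta[OF substituting(1)[OF s e] r]]) (simp_all add: T u)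
  show ?thesis by (rule eq_trans[OF 2 3])
qed

section \<open>Conversion, transport and equality up to inhabitation\<close>

lemma id_conv:
  assumes "\<Gamma> \<turnstile> e \<^bold>: Id A a b" "\<Gamma> \<turnstile> A \<^bold>: Univ i" "\<Gamma> \<turnstile> a \<simeq> a' \<^bold>: A" "\<Gamma> \<turnstile> b \<simeq> b' \<^bold>: A"
  shows "\<Gamma> \<turnstile> e \<^bold>: Id A a' b'"
  using ty_conv[OF assms(1) eq_id[OF eq_refl[OF assms(2)] assms(3,4)]] .

lemma refl_conv:
  assumes "\<Gamma> \<turnstile> A \<^bold>: Univ i" "\<Gamma> \<turnstile> c \<^bold>: A" "\<Gamma> \<turnstile> a \<simeq> c \<^bold>: A" "\<Gamma> \<turnstile> b \<simeq> c \<^bold>: A"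
  shows "\<Gamma> \<turnstile> Refl c \<^bold>: Id A a b"
  by (rule id_conv[OF ty_refl[OF assms(2)] assms(1) eq_sym[OF assms(3)] eq_sym[OF assms(4)]])

lemma fam_conv:
  assumes "\<Gamma> \<turnstile> P \<^bold>: arr A (Univ i)" "\<Gamma> \<turnstile> u \<^bold>: App P a" "\<Gamma> \<turnstile> a \<simeq> b \<^bold>: A"
  shows "\<Gamma> \<turnstile> u \<^bold>: App P b"
  by (rule ty_conv[OF assms(2) arr_eq_app[OF eq_refl[OF assms(1)] assms(3)]])

text \<open>The detour through \<open>App (Lam C) a\<close> reduces this to congruence of
  application and two beta steps, so no separate induction over judgements is needed for equal
  substitutions.\<close>

lemma subst_cong:
  assumes C: "A # \<Gamma> \<turnstile> C \<^bold>: Univ i" and ab: "\<Gamma> \<turnstile> a \<simeq> b \<^bold>: A" and a: "\<Gamma> \<turnstile> a \<^bold>: A" and b: "\<Gamma> \<turnstile> b \<^bold>: A"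
  shows "\<Gamma> \<turnstile> C\<langle>a\<rangle> \<simeq> C\<langle>b\<rangle> \<^bold>: Univ i"
proof -
  have L: "\<Gamma> \<turnstile> Lam C \<^bold>: arr A (Univ i)" using C by (intro arr_lam) simp
  show ?thesis
    by (rule eq_trans[OF eq_sym[OF beta[OF C a refl]] eq_trans[OF arr_eq_app[OF eq_refl[OF L] ab]
      beta[OF C b refl]]]) simp_all
qed

text \<open>\<open>J\<close> at the motive \<open>C x \<rightarrow> C y\<close>\<close>

definition transp :: "tm \<Rightarrow> tm \<Rightarrow> tm" where
  "transp p u = App (J (Lam (Var 0)) p) u"

lemma transp_type:
  assumes C: "A # \<Gamma> \<turnstile> C \<^bold>: Univ i" and A: "\<Gamma> \<turnstile> A \<^bold>: Univ k"
    and a: "\<Gamma> \<turnstile> a \<^bold>: A" and b: "\<Gamma> \<turnstile> b \<^bold>: A" and p: "\<Gamma> \<turnstile> p \<^bold>: Id A a b" and u: "\<Gamma> \<turnstile> u \<^bold>: C\<langle>a\<rangle>"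
  shows "\<Gamma> \<turnstile> transp p u \<^bold>: C\<langle>b\<rangle>"
proof -
  let ?\<Delta> = "Id (sh 2 A) (Var 1) (Var 0) # sh 1 A # A # \<Gamma>"
  \<comment> \<open>The motive \<open>C x \<rightarrow> C y\<close>: in \<open>?\<Delta>\<close> the
    endpoints are \<open>Var 2\<close> and \<open>Var 1\<close>, the identity proof is
    \<open>Var 0\<close>, and \<open>wk 3\<close> passes over all three.\<close>
  let ?M = "arr (sub (Var 2 \<cdot> wk 3) C) (sub (Var 1 \<cdot> wk 3) C)"
  have c1: "\<turnstile> A # \<Gamma> ctx" using ctx_consI[OF A] .
  have c2: "\<turnstile> sh 1 A # A # \<Gamma> ctx" using ctx_consI[OF weaken1[OF A c1, simplified]] by simp
  have c: "\<turnstile> ?\<Delta> ctx"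
    using weaken2[OF A c2] c2 by (intro ctx_consI[OF ty_id[where i = k]]) (auto intro!: var_type)
  have "renames (Var 2 \<cdot> wk 3) (A # \<Gamma>) ?\<Delta>" "renames (Var 1 \<cdot> wk 3) (A # \<Gamma>) ?\<Delta>"
    using c by (auto simp: renames_def less_Suc_eq_0_disj)
  from this[THEN renaming[OF C]] have "?\<Delta> \<turnstile> ?M \<^bold>: Univ (if i = 0 then 0 else max i i)"
    by (intro arr_type) simp_all
  moreover have "A # \<Gamma> \<turnstile> Lam (Var 0) \<^bold>: arr C C"
    using ctx_consI[OF C] by (intro arr_lam) (auto intro!: var_type)
  ultimately have "\<Gamma> \<turnstile> J (Lam (Var 0)) p \<^bold>: arr (C\<langle>a\<rangle>) (C\<langle>b\<rangle>)"
    using ty_cast[OF ty_J[where C = ?M, OF _ _ a b p] refl] by simp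
  then show ?thesis unfolding transp_def using u by (rule arr_app)
qed

text \<open>The goal asks only for the existence of an element. Identity proofs and limit conditions
  can therefore be handled through inhabitation, without carrying their terms along.\<close>

definition inh :: "tm list \<Rightarrow> tm \<Rightarrow> bool" where
  "inh \<Gamma> T \<longleftrightarrow> (\<exists>t. \<Gamma> \<turnstile> t \<^bold>: T)"

lemma inhI: "\<Gamma> \<turnstile> t \<^bold>: T \<Longrightarrow> inh \<Gamma> T" by (auto simp: inh_def)

lemma inh_transp:
  assumes C: "A # \<Gamma> \<turnstile> C \<^bold>: Univ i" and A: "\<Gamma> \<turnstile> A \<^bold>: Univ k"
    and a: "\<Gamma> \<turnstile> a \<^bold>: A" and b: "\<Gamma> \<turnstile> b \<^bold>: A" and p: "inh \<Gamma> (Id A a b)" and u: "inh \<Gamma> (C\<langle>a\<rangle>)"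
  shows "inh \<Gamma> (C\<langle>b\<rangle>)"
  using transp_type[OF C A a b] p u by (auto simp: inh_def)

text \<open>Transport of \<open>p\<close> along \<open>q\<close> in the family
  \<open>Id A a x\<close>.\<close>

lemma inh_trans:
  assumes A: "\<Gamma> \<turnstile> A \<^bold>: Univ k" and a: "\<Gamma> \<turnstile> a \<^bold>: A" and b: "\<Gamma> \<turnstile> b \<^bold>: A" and c: "\<Gamma> \<turnstile> c \<^bold>: A"
    and p: "inh \<Gamma> (Id A a b)" and q: "inh \<Gamma> (Id A b c)"
  shows "inh \<Gamma> (Id A a c)"
proof -
  note w = ctx_consI[OF A]
  have "A # \<Gamma> \<turnstile> Id (sh 1 A) (sh 1 a) (Var 0) \<^bold>: Univ k"
    using weaken1[OF A w] weaken1[OF a w] by (intro ty_id) (auto intro!: var_type w)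
  from inh_transp[OF this A b c q] p show ?thesis by simp
qed

text \<open>Transport of reflexivity at \<open>e\<langle>a\<rangle>\<close> in the family of
  identities from \<open>e\<langle>a\<rangle>\<close> to
  \<open>e\<langle>x\<rangle>\<close>.\<close>

lemma inh_ap:
  assumes A: "\<Gamma> \<turnstile> A \<^bold>: Univ k" and B: "\<Gamma> \<turnstile> B \<^bold>: Univ j"
    and e: "A # \<Gamma> \<turnstile> e \<^bold>: sh 1 B" and a: "\<Gamma> \<turnstile> a \<^bold>: A" and b: "\<Gamma> \<turnstile> b \<^bold>: A" and p: "inh \<Gamma> (Id A a b)"
  shows "inh \<Gamma> (Id B (e\<langle>a\<rangle>) (e\<langle>b\<rangle>))"
proof -
  note w = ctx_consI[OF A]
  have ea: "\<Gamma> \<turnstile> e\<langle>a\<rangle> \<^bold>: B" using subst1[OF e a] by simp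
  have "A # \<Gamma> \<turnstile> Id (sh 1 B) (sh 1 (e\<langle>a\<rangle>)) e \<^bold>: Univ j"
    using weaken1[OF B w] weaken1[OF ea w] e by (intro ty_id) auto
  from inh_transp[OF this A a b p] ty_refl[OF ea] show ?thesis by (auto intro: inhI)
qed

lemma app_Var0: "\<Gamma> \<turnstile> f \<^bold>: Pi A B \<Longrightarrow> \<turnstile> A # \<Gamma> ctx \<Longrightarrow> A # \<Gamma> \<turnstile> App (sh 1 f) (Var 0) \<^bold>: B"
  using weaken1[of \<Gamma> f "Pi A B" A, simplified, THEN ty_app, of "Var 0"]
  by (simp add: var_type)

lemma inh_funext:
  assumes "\<Gamma> \<turnstile> f \<^bold>: Pi A B" "\<Gamma> \<turnstile> g \<^bold>: Pi A B"
    "inh (A # \<Gamma>) (Id B (App (sh 1 f) (Var 0)) (App (sh 1 g) (Var 0)))"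
  shows "inh \<Gamma> (Id (Pi A B) f g)"
  using assms ty_funext[OF assms(1,2) ty_lam] by (auto simp: inh_def)

definition isprop :: "tm list \<Rightarrow> tm \<Rightarrow> bool" where
  "isprop \<Gamma> T \<longleftrightarrow> (\<forall>s t. \<Gamma> \<turnstile> s \<^bold>: T \<longrightarrow> \<Gamma> \<turnstile> t \<^bold>: T \<longrightarrow> inh \<Gamma> (Id T s t))"

lemma isprop_Id: "isprop \<Gamma> (Id A a b)"
  by (auto simp: isprop_def intro: inhI ty_uip)

text \<open>Two functions are compared at a fresh variable. The hypothesis covers all terms of the
  extended context, in particular their applications to that variable.\<close>

lemma isprop_Pi: "isprop (A # \<Gamma>) B \<Longrightarrow> \<turnstile> A # \<Gamma> ctx \<Longrightarrow> isprop \<Gamma> (Pi A B)"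
  unfolding isprop_def by (blast intro: inh_funext app_Var0)

text \<open>Inserts \<open>\<Delta>\<close> below the most recent variable. The second component of
  a \<open>Sig\<close> lives over one extra variable and is weakened in this way.\<close>

lemma weaken_under:
  assumes B: "A # \<Gamma> \<turnstile> B \<^bold>: T" and c: "\<turnstile> \<Delta> @ \<Gamma> ctx"
  shows "sh (length \<Delta>) A # \<Delta> @ \<Gamma> \<turnstile> sub (Var 0 \<cdot> wk (Suc (length \<Delta>))) B \<^bold>:
    sub (Var 0 \<cdot> wk (Suc (length \<Delta>))) T"
proof (rule renaming[OF B])
  obtain i where "\<Gamma> \<turnstile> A \<^bold>: Univ i" using B judgement_ctx wf_ctx_ConsE by metis
  from weakening[OF this c] have "\<turnstile> sh (length \<Delta>) A # \<Delta> @ \<Gamma> ctx" by (auto intro: ctx_consI)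
  then show "renames (Var 0 \<cdot> wk (Suc (length \<Delta>))) (A # \<Gamma>) (sh (length \<Delta>) A # \<Delta> @ \<Gamma>)"
    by (auto simp: renames_def less_Suc_eq_0_disj nth_append)
qed

lemma eq_lam_arr:
  "X # \<Gamma> \<turnstile> b \<simeq> b' \<^bold>: sh 1 Y \<Longrightarrow> \<Gamma> \<turnstile> Lam b \<simeq> Lam b' \<^bold>: arr X Y"
  unfolding arr_def by (rule eq_lam)

lemma beta_arr: "X # \<Gamma> \<turnstile> b \<^bold>: sh 1 Y \<Longrightarrow> \<Gamma> \<turnstile> a \<^bold>: X \<Longrightarrow> u = b\<langle>a\<rangle> \<Longrightarrow> \<Gamma> \<turnstile> App (Lam b) a \<simeq> u \<^bold>: Y"
  by (rule beta[where B = "sh 1 Y"]) simp_all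

section \<open>Composition and projections\<close>

lemma sub_comp [simp]: "sub \<sigma> (f \<circ>\<^sub>t g) = sub \<sigma> f \<circ>\<^sub>t sub \<sigma> g"
  by (simp add: comp_def)

lemma comp_body_type:
  assumes f: "\<Gamma> \<turnstile> f \<^bold>: arr X Y" and t: "\<Gamma> \<turnstile> t \<^bold>: arr D X" and D: "\<Gamma> \<turnstile> D \<^bold>: Univ i"
  shows "D # \<Gamma> \<turnstile> App (sh 1 f) (App (sh 1 t) (Var 0)) \<^bold>: sh 1 Y"
proof -
  note c = ctx_consI[OF D]
  have "D # \<Gamma> \<turnstile> Var 0 \<^bold>: sh 1 D" using c by (simp add: var_type)
  then show ?thesis
    using weaken1[OF f c] weaken1[OF t c] by (auto intro: arr_app)
qed

lemma comp_type:
  assumes "\<Gamma> \<turnstile> f \<^bold>: arr X Y" "\<Gamma> \<turnstile> t \<^bold>: arr D X" "\<Gamma> \<turnstile> D \<^bold>: Univ i"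
  shows "\<Gamma> \<turnstile> f \<circ>\<^sub>t t \<^bold>: arr D Y"
  unfolding comp_def lift_eq_wk by (rule arr_lam[OF comp_body_type[OF assms]])

lemma comp_beta:
  assumes "\<Gamma> \<turnstile> f \<^bold>: arr X Y" "\<Gamma> \<turnstile> t \<^bold>: arr D X" "\<Gamma> \<turnstile> D \<^bold>: Univ i" "\<Gamma> \<turnstile> b \<^bold>: D"
  shows "\<Gamma> \<turnstile> App (f \<circ>\<^sub>t t) b \<simeq> App f (App t b) \<^bold>: Y"
  unfolding comp_def lift_eq_wk by (rule beta_arr[OF comp_body_type[OF assms(1-3)] assms(4)]) simp

section \<open>Sigma-types and their two projections\<close>

definition is_sig :: "tm list \<Rightarrow> tm \<Rightarrow> tm \<Rightarrow> bool" where
  "is_sig \<Gamma> A B \<longleftrightarrow> (\<exists>i j. \<Gamma> \<turnstile> A \<^bold>: Univ i \<and> A # \<Gamma> \<turnstile> B \<^bold>: Univ j)"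

lemma is_sig_ctx: "is_sig \<Gamma> A B \<Longrightarrow> \<turnstile> Sig A B # \<Gamma> ctx"
  by (auto simp: is_sig_def intro: ctx_consI ty_sig)

lemma is_sig_weaken: "is_sig \<Gamma> A B \<Longrightarrow> \<turnstile> \<Delta> @ \<Gamma> ctx \<Longrightarrow>
    is_sig (\<Delta> @ \<Gamma>) (sh (length \<Delta>) A) (sub (Var 0 \<cdot> wk (Suc (length \<Delta>))) B)"
  by (force simp: is_sig_def dest: weakening weaken_under)

lemma
  assumes s: "is_sig \<Gamma> A B"
  shows split1_type: "\<Gamma> \<turnstile> p \<^bold>: Sig A B \<Longrightarrow> \<Gamma> \<turnstile> Split (Var 1) p \<^bold>: A"
    and split1_beta: "\<Gamma> \<turnstile> a \<^bold>: A \<Longrightarrow> \<Gamma> \<turnstile> b \<^bold>: B\<langle>a\<rangle> \<Longrightarrow> \<Gamma> \<turnstile> Split (Var 1) (Pair a b) \<simeq> a \<^bold>: A"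
proof -
  obtain i j where A: "\<Gamma> \<turnstile> A \<^bold>: Univ i" and B: "A # \<Gamma> \<turnstile> B \<^bold>: Univ j"
    using s by (auto simp: is_sig_def)
  have C: "Sig A B # \<Gamma> \<turnstile> sh 1 A \<^bold>: Univ i" using weaken1[OF A is_sig_ctx[OF s]] by simp
  have d: "B # A # \<Gamma> \<turnstile> Var 1 \<^bold>: sub (Pair (Var 1) (Var 0) \<cdot> (\<lambda>n. Var (n + 2))) (sh 1 A)"
    using ctx_consI[OF B] by (auto intro!: var_type)
  show "\<Gamma> \<turnstile> Split (Var 1) p \<^bold>: A" if "\<Gamma> \<turnstile> p \<^bold>: Sig A B"
    using ty_split[OF C d that] by simp
  show "\<Gamma> \<turnstile> Split (Var 1) (Pair a b) \<simeq> a \<^bold>: A" if "\<Gamma> \<turnstile> a \<^bold>: A" "\<Gamma> \<turnstile> b \<^bold>: B\<langle>a\<rangle>"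
    using eq_split_beta[OF C d that] by simp
qed

lemma sub_proj1 [simp]: "sub \<sigma> \<pi>\<^sub>1 = \<pi>\<^sub>1"
  by (simp add: proj1_def)

lemma proj1_body_type:
  assumes s: "is_sig \<Gamma> A B"
  shows "Sig A B # \<Gamma> \<turnstile> Split (Var 1) (Var 0) \<^bold>: sh 1 A"
proof -
  let ?S = "Sig A B"
  have c: "\<turnstile> [?S] @ \<Gamma> ctx" using is_sig_ctx[OF s] by simp
  have "?S # \<Gamma> \<turnstile> Var 0 \<^bold>: Sig (sh (Suc 0) A) (sub (Var 0 \<cdot> wk (Suc (Suc 0))) B)"
    using c by (auto intro!: var_type)
  from split1_type[OF is_sig_weaken[OF s c, simplified] this] show ?thesis by simp
qed

lemma proj1_type: "is_sig \<Gamma> A B \<Longrightarrow> \<Gamma> \<turnstile> \<pi>\<^sub>1 \<^bold>: arr (Sig A B) A"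
  unfolding proj1_def by (intro arr_lam proj1_body_type)

lemma proj1_beta:
  assumes s: "is_sig \<Gamma> A B" and a: "\<Gamma> \<turnstile> a \<^bold>: A" and b: "\<Gamma> \<turnstile> b \<^bold>: B\<langle>a\<rangle>"
  shows "\<Gamma> \<turnstile> App \<pi>\<^sub>1 (Pair a b) \<simeq> a \<^bold>: A"
proof -
  have p: "\<Gamma> \<turnstile> Pair a b \<^bold>: Sig A B" using s a b by (auto simp: is_sig_def intro: ty_pair)
  have "\<Gamma> \<turnstile> App \<pi>\<^sub>1 (Pair a b) \<simeq> Split (Var 1) (Pair a b) \<^bold>: A"
    unfolding proj1_def by (rule beta_arr[OF proj1_body_type[OF s] p]) simp
  from eq_trans[OF this split1_beta[OF s a b]] show ?thesis .
qed

definition proj2 :: "tm \<Rightarrow> tm" where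
  "proj2 p = Split (Var 0) p"

lemma sub_proj2 [simp]: "sub \<sigma> (proj2 p) = proj2 (sub \<sigma> p)"
  by (simp add: proj2_def)

text \<open>The motive at \<open>x\<close> is \<open>B\<close> at
  \<open>App \<pi>\<^sub>1 x\<close>. On a pair the second component has type \<open>B\<close> at
  \<open>Var 1\<close>, while the motive speaks of the projection of the pair;
  \<open>subst_cong\<close> applied to the beta rule for \<open>\<pi>\<^sub>1\<close> closes the
  gap.\<close>

lemma proj2_type:
  assumes s: "is_sig \<Gamma> A B" and p: "\<Gamma> \<turnstile> p \<^bold>: Sig A B"
  shows "\<Gamma> \<turnstile> proj2 p \<^bold>: B\<langle>App \<pi>\<^sub>1 p\<rangle>"
proof -
  let ?S = "Sig A B" and ?C = "sub (App \<pi>\<^sub>1 (Var 0) \<cdot> wk 1) B" and ?\<Delta> = "B # A # \<Gamma>"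
  obtain i j where A: "\<Gamma> \<turnstile> A \<^bold>: Univ i" and B: "A # \<Gamma> \<turnstile> B \<^bold>: Univ j"
    using s by (auto simp: is_sig_def)
  have c: "\<turnstile> [?S] @ \<Gamma> ctx" using is_sig_ctx[OF s] by simp
  have v: "?S # \<Gamma> \<turnstile> Var 0 \<^bold>: Sig (sh (Suc 0) A) (sub (Var 0 \<cdot> wk (Suc (Suc 0))) B)"
    using c by (auto intro!: var_type)
  have C: "?S # \<Gamma> \<turnstile> ?C \<^bold>: Univ j"
    using subst1[OF weaken_under[OF B c, simplified]
        arr_app[OF proj1_type[OF is_sig_weaken[OF s c, simplified]] v]] by simp
  have c2: "\<turnstile> [B, A] @ \<Gamma> ctx" using ctx_consI[OF B] by simp
  note s2 = is_sig_weaken[OF s c2, simplified]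
  have v1: "?\<Delta> \<turnstile> Var 1 \<^bold>: sh (Suc (Suc 0)) A" using c2 by (auto intro!: var_type)
  have v0: "?\<Delta> \<turnstile> Var 0 \<^bold>: (sub (Var 0 \<cdot> wk (Suc (Suc (Suc 0)))) B)\<langle>Var 1\<rangle>"
    using c2 by (auto intro!: var_type)
  have q: "?\<Delta> \<turnstile> Pair (Var 1) (Var 0) \<^bold>: Sig (sh (Suc (Suc 0)) A) (sub (Var 0 \<cdot> wk (Suc (Suc (Suc 0)))) B)"
    using s2 v1 v0 by (auto simp: is_sig_def intro: ty_pair)
  have e: "?\<Delta> \<turnstile> App \<pi>\<^sub>1 (Pair (Var 1) (Var 0)) \<simeq> Var 1 \<^bold>: sh (Suc (Suc 0)) A"
    by (rule proj1_beta[OF s2 v1 v0])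
  have "?\<Delta> \<turnstile> Var 0 \<^bold>: sub (Pair (Var 1) (Var 0) \<cdot> (\<lambda>n. Var (n + 2))) ?C"
    using ty_conv[OF v0 eq_sym[OF subst_cong[OF weaken_under[OF B c2, simplified] e
          arr_app[OF proj1_type[OF s2] q] v1]]] by simp
  from ty_split[OF C this p] show ?thesis by (simp add: proj2_def)
qed

section \<open>Algebras and the impredicative encoding\<close>

definition params :: "tm list \<Rightarrow> tm \<Rightarrow> tm \<Rightarrow> bool" where
  "params \<Gamma> A B \<longleftrightarrow> \<Gamma> \<turnstile> A \<^bold>: \<U> \<and> \<Gamma> \<turnstile> B \<^bold>: arr A \<U>"

lemma params_ctx: "params \<Gamma> A B \<Longrightarrow> \<turnstile> \<Gamma> ctx"
  by (auto simp: params_def judgement_ctx)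

lemma params_weaken: "params \<Gamma> A B \<Longrightarrow> \<turnstile> \<Delta> @ \<Gamma> ctx \<Longrightarrow>
    params (\<Delta> @ \<Gamma>) (sh (length \<Delta>) A) (sh (length \<Delta>) B)"
  by (force simp: params_def dest: weakening)

lemma params_fam: "params \<Gamma> A B \<Longrightarrow> \<Gamma> \<turnstile> a \<^bold>: A \<Longrightarrow> \<Gamma> \<turnstile> App B a \<^bold>: \<U>"
  by (auto simp: params_def intro: arr_app)

lemma sub_AlgW [simp]: "sub \<sigma> (AlgW A B X) = AlgW (sub \<sigma> A) (sub \<sigma> B) (sub \<sigma> X)"
  by (simp add: AlgW_def)

lemma sub_Wstar [simp]: "sub \<sigma> (Wstar A B) = Wstar (sub \<sigma> A) (sub \<sigma> B)"
  by (simp add: Wstar_def)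

lemma sub_rec_star [simp]: "sub \<sigma> (rec_star X g w) = rec_star (sub \<sigma> X) (sub \<sigma> g) (sub \<sigma> w)"
  by (simp add: rec_star_def)

lemma sub_sup_star [simp]: "sub \<sigma> (sup_star a r) = sup_star (sub \<sigma> a) (sub \<sigma> r)"
  by (simp add: sup_star_def)

lemma sub_MorphW [simp]: "sub \<sigma> (MorphW A B X g Y g' f) =
    MorphW (sub \<sigma> A) (sub \<sigma> B) (sub \<sigma> X) (sub \<sigma> g) (sub \<sigma> Y) (sub \<sigma> g') (sub \<sigma> f)"
  by (simp add: MorphW_def)

lemma sub_LimW [simp]: "sub \<sigma> (LimW A B w) = LimW (sub \<sigma> A) (sub \<sigma> B) (sub \<sigma> w)"
  by (simp add: LimW_def)

lemma sub_W [simp]: "sub \<sigma> (W A B) = W (sub \<sigma> A) (sub \<sigma> B)"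
  by (simp add: W_def)

lemma sub_SupLim [simp]: "sub \<sigma> (SupLim A B) = SupLim (sub \<sigma> A) (sub \<sigma> B)"
  by (simp add: SupLim_def)

lemma sub_sup_W [simp]: "sub \<sigma> (sup_W p a r) = sup_W (sub \<sigma> p) (sub \<sigma> a) (sub \<sigma> r)"
  by (simp add: sup_W_def)

lemma sub_IndStep [simp]: "sub \<sigma> (IndStep A B p P) = IndStep (sub \<sigma> A) (sub \<sigma> B) (sub \<sigma> p) (sub \<sigma> P)"
  by (simp add: IndStep_def)

abbreviation alg_ctx :: "tm \<Rightarrow> tm \<Rightarrow> tm \<Rightarrow> tm list" where
  "alg_ctx A B X \<equiv> [arr (App (sh 1 B) (Var 0)) (sh 1 X), A]"

lemma alg_ctx_wf:
  assumes p: "params \<Gamma> A B" and X: "\<Gamma> \<turnstile> X \<^bold>: \<U>"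
  shows "\<turnstile> alg_ctx A B X @ \<Gamma> ctx"
proof -
  have c: "\<turnstile> [A] @ \<Gamma> ctx" using p by (auto simp: params_def intro: ctx_consI)
  have "A # \<Gamma> \<turnstile> Var 0 \<^bold>: sh (Suc 0) A" using c by (auto intro: var_type)
  from params_fam[OF params_weaken[OF p c, simplified] this]
  show ?thesis using weakening[OF X c] by (auto intro!: ctx_consI arr_type0)
qed

lemma alg_ctx_vars:
  assumes c: "\<turnstile> alg_ctx A B X @ \<Gamma> ctx"
  shows "alg_ctx A B X @ \<Gamma> \<turnstile> Var (Suc 0) \<^bold>: sh (Suc (Suc 0)) A"
    and "alg_ctx A B X @ \<Gamma> \<turnstile> Var 0 \<^bold>:
      arr (App (sh (Suc (Suc 0)) B) (Var (Suc 0))) (sh (Suc (Suc 0)) X)"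
  using c by (auto intro!: var_type)

text \<open>Outer arrows become \<open>Pi\<close>, so that every argument is a variable of a
  context, and arrows that are themselves arguments become \<open>arr\<close>. The corresponding
  equations for the other encoded types follow the same pattern.\<close>

lemma AlgW_eq: "AlgW A B X = Pi A (Pi (arr (App (sh 1 B) (Var 0)) (sh 1 X)) (sh 2 X))"
  by (simp add: AlgW_def arr_def)

lemma AlgW_type:
  assumes p: "params \<Gamma> A B" and X: "\<Gamma> \<turnstile> X \<^bold>: \<U>"
  shows "\<Gamma> \<turnstile> AlgW A B X \<^bold>: \<U>"
  unfolding AlgW_eq using weakening[OF X alg_ctx_wf[OF assms]] by (intro pi_type0) simp

lemma AlgW_app:
  assumes g: "\<Gamma> \<turnstile> g \<^bold>: AlgW A B X" and a: "\<Gamma> \<turnstile> a \<^bold>: A" and t: "\<Gamma> \<turnstile> t \<^bold>: arr (App B a) X"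
  shows "\<Gamma> \<turnstile> App (App g a) t \<^bold>: X"
  using ty_app[OF ty_app[OF g[unfolded AlgW_eq] a, simplified] t] by simp

lemma AlgW_eq_app:
  assumes g: "\<Gamma> \<turnstile> g \<^bold>: AlgW A B X" and a: "\<Gamma> \<turnstile> a \<^bold>: A" and t: "\<Gamma> \<turnstile> t \<simeq> t' \<^bold>: arr (App B a) X"
  shows "\<Gamma> \<turnstile> App (App g a) t \<simeq> App (App g a) t' \<^bold>: X"
  using eq_app[OF eq_refl[OF ty_app[OF g[unfolded AlgW_eq] a, simplified]] t] by simp

lemma AlgW_lam: "alg_ctx A B X @ \<Gamma> \<turnstile> e \<^bold>: sh 2 X \<Longrightarrow> \<Gamma> \<turnstile> Lam (Lam e) \<^bold>: AlgW A B X"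
  unfolding AlgW_eq by (intro ty_lam) simp

abbreviation rec_ctx :: "tm \<Rightarrow> tm \<Rightarrow> tm list" where
  "rec_ctx A B \<equiv> [AlgW (sh 1 A) (sh 1 B) (Var 0), \<U>]"

lemma rec_ctx_wf:
  assumes p: "params \<Gamma> A B"
  shows "\<turnstile> rec_ctx A B @ \<Gamma> ctx"
proof -
  have c: "\<turnstile> [\<U>] @ \<Gamma> ctx" using params_ctx[OF p] by (auto intro: ctx_consI ty_univ)
  have "\<U> # \<Gamma> \<turnstile> Var 0 \<^bold>: \<U>" using c by (auto intro: var_type)
  from AlgW_type[OF params_weaken[OF p c, simplified] this] show ?thesis by (auto intro: ctx_consI)
qed

lemma Wstar_eq: "Wstar A B = Pi \<U> (Pi (AlgW (sh 1 A) (sh 1 B) (Var 0)) (Var 1))"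
  by (simp add: Wstar_def)

lemma Wstar_type: "params \<Gamma> A B \<Longrightarrow> \<Gamma> \<turnstile> Wstar A B \<^bold>: \<U>"
  unfolding Wstar_eq using rec_ctx_wf by (intro pi_type0) (auto intro!: var_type)

lemma Wstar_lam: "rec_ctx A B @ \<Gamma> \<turnstile> e \<^bold>: Var 1 \<Longrightarrow> \<Gamma> \<turnstile> Lam (Lam e) \<^bold>: Wstar A B"
  unfolding Wstar_eq by (intro ty_lam) simp

lemma rec_star_cong:
  assumes w: "\<Gamma> \<turnstile> w \<simeq> w' \<^bold>: Wstar A B" and X: "\<Gamma> \<turnstile> X \<^bold>: \<U>" and g: "\<Gamma> \<turnstile> g \<^bold>: AlgW A B X"
  shows "\<Gamma> \<turnstile> rec_star X g w \<simeq> rec_star X g w' \<^bold>: X"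
proof -
  have "\<Gamma> \<turnstile> App w X \<simeq> App w' X \<^bold>: Pi (AlgW A B X) (sh (Suc 0) X)"
    using eq_app[OF w[unfolded Wstar_eq] eq_refl[OF X]] by simp
  from eq_app[OF this eq_refl[OF g]] show ?thesis by (simp add: rec_star_def)
qed

lemma rec_star_type:
  assumes w: "\<Gamma> \<turnstile> w \<^bold>: Wstar A B" and X: "\<Gamma> \<turnstile> X \<^bold>: \<U>" and g: "\<Gamma> \<turnstile> g \<^bold>: AlgW A B X"
  shows "\<Gamma> \<turnstile> rec_star X g w \<^bold>: X"
proof -
  have "\<Gamma> \<turnstile> App w X \<^bold>: Pi (AlgW A B X) (sh (Suc 0) X)"
    using ty_app[OF w[unfolded Wstar_eq] X] by simp
  from ty_app[OF this g] show ?thesis by (simp add: rec_star_def)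
qed

text \<open>The function that \<open>sup_star a r\<close> hands to the algebra. Naming it lets the
  computation rule of the recursor be stated without its raw indices.\<close>

definition sup_branches :: "tm \<Rightarrow> tm \<Rightarrow> tm \<Rightarrow> tm" where
  "sup_branches r X g = Lam (rec_star (sh 1 X) (sh 1 g) (App (sh 1 r) (Var 0)))"

lemma sub_sup_branches [simp]:
  "sub \<sigma> (sup_branches r X g) = sup_branches (sub \<sigma> r) (sub \<sigma> X) (sub \<sigma> g)"
  by (simp add: sup_branches_def)

lemma sup_star_eq: "sup_star a r =
    Lam (Lam (App (App (Var 0) (sh 2 a)) (sup_branches (sh 2 r) (Var 1) (Var 0))))"
  by (simp add: sup_star_def sup_branches_def rec_star_def)

lemma fam_ctx: "params \<Gamma> A B \<Longrightarrow> \<Gamma> \<turnstile> a \<^bold>: A \<Longrightarrow> \<turnstile> [App B a] @ \<Gamma> ctx"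
  by (auto intro: ctx_consI params_fam)

lemma fam_ctx_app:
  assumes c: "\<turnstile> [D] @ \<Gamma> ctx" and r: "\<Gamma> \<turnstile> r \<^bold>: arr D X"
  shows "D # \<Gamma> \<turnstile> App (sh (Suc 0) r) (Var 0) \<^bold>: sh (Suc 0) X"
  using arr_app[of "D # \<Gamma>" "sh (Suc 0) r" "sh (Suc 0) D" "sh (Suc 0) X" "Var 0"]
    weakening[OF r c] c by (simp add: var_type)

lemma sup_branches_type:
  assumes p: "params \<Gamma> A B" and a: "\<Gamma> \<turnstile> a \<^bold>: A" and r: "\<Gamma> \<turnstile> r \<^bold>: arr (App B a) (Wstar A B)"
    and X: "\<Gamma> \<turnstile> X \<^bold>: \<U>" and g: "\<Gamma> \<turnstile> g \<^bold>: AlgW A B X"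
  shows "\<Gamma> \<turnstile> sup_branches r X g \<^bold>: arr (App B a) X"
proof -
  note c = fam_ctx[OF p a]
  show ?thesis unfolding sup_branches_def
    using rec_star_type[OF fam_ctx_app[OF c r, simplified] weakening[OF X c, simplified]
        weakening[OF g c, simplified]] by (intro arr_lam) simp
qed

lemma sup_star_body_type:
  assumes p: "params \<Gamma> A B" and a: "\<Gamma> \<turnstile> a \<^bold>: A" and r: "\<Gamma> \<turnstile> r \<^bold>: arr (App B a) (Wstar A B)"
  shows "rec_ctx A B @ \<Gamma> \<turnstile> App
    (App (Var 0) (sh 2 a)) (sup_branches (sh 2 r) (Var 1) (Var 0)) \<^bold>: Var 1"
proof -
  note c = rec_ctx_wf[OF p]
  have X: "rec_ctx A B @ \<Gamma> \<turnstile> Var 1 \<^bold>: \<U>"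
    and g: "rec_ctx A B @ \<Gamma> \<turnstile> Var 0 \<^bold>: AlgW (sh 2 A) (sh 2 B) (Var 1)"
    using c by (auto intro!: var_type)
  note w = params_weaken[OF p c, simplified] weakening[OF a c, simplified]
    weakening[OF r c, simplified]
  from AlgW_app[OF g[simplified] w(2) sup_branches_type[OF w X[simplified] g[simplified]]]
  show ?thesis by simp
qed

lemma sup_star_type:
  assumes "params \<Gamma> A B" "\<Gamma> \<turnstile> a \<^bold>: A" "\<Gamma> \<turnstile> r \<^bold>: arr (App B a) (Wstar A B)"
  shows "\<Gamma> \<turnstile> sup_star a r \<^bold>: Wstar A B"
  unfolding sup_star_eq by (rule Wstar_lam[OF sup_star_body_type[OF assms]])

lemma rec_star_sup_star:
  assumes p: "params \<Gamma> A B" and a: "\<Gamma> \<turnstile> a \<^bold>: A" and r: "\<Gamma> \<turnstile> r \<^bold>: arr (App B a) (Wstar A B)"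
    and X: "\<Gamma> \<turnstile> X \<^bold>: \<U>" and g: "\<Gamma> \<turnstile> g \<^bold>: AlgW A B X"
  shows "\<Gamma> \<turnstile> rec_star X g (sup_star a r) \<simeq> App (App g a) (sup_branches r X g) \<^bold>: X"
  using beta2[OF sup_star_body_type[OF p a r, simplified] X _ refl refl, of g] g
  by (simp add: sup_star_eq rec_star_def)

section \<open>Morphisms and the subtype of limit elements\<close>

definition lim_data :: "tm list \<Rightarrow> tm \<Rightarrow> tm \<Rightarrow> tm \<Rightarrow> tm \<Rightarrow> tm \<Rightarrow> tm \<Rightarrow> tm \<Rightarrow> bool" where
  "lim_data \<Gamma> A B X Y g g' f \<longleftrightarrow> params \<Gamma> A B \<and> \<Gamma> \<turnstile> X \<^bold>: \<U> \<and> \<Gamma> \<turnstile> Y \<^bold>: \<U> \<and>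
    \<Gamma> \<turnstile> g \<^bold>: AlgW A B X \<and> \<Gamma> \<turnstile> g' \<^bold>: AlgW A B Y \<and> \<Gamma> \<turnstile> f \<^bold>: arr X Y"

lemma lim_dataD:
  assumes "lim_data \<Gamma> A B X Y g g' f"
  shows "params \<Gamma> A B" "\<Gamma> \<turnstile> X \<^bold>: \<U>" "\<Gamma> \<turnstile> Y \<^bold>: \<U>"
    "\<Gamma> \<turnstile> g \<^bold>: AlgW A B X" "\<Gamma> \<turnstile> g' \<^bold>: AlgW A B Y" "\<Gamma> \<turnstile> f \<^bold>: arr X Y"
  using assms by (auto simp: lim_data_def)

lemma lim_data_weaken: 
  assumes d: "lim_data \<Gamma> A B X Y g g' f" and c: "\<turnstile> \<Delta> @ \<Gamma> ctx"
  shows "lim_data (\<Delta> @ \<Gamma>) (sh (length \<Delta>) A) (sh (length \<Delta>) B) (sh (length \<Delta>) X)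
    (sh (length \<Delta>) Y) (sh (length \<Delta>) g) (sh (length \<Delta>) g') (sh (length \<Delta>) f)"
  using params_weaken[OF lim_dataD(1)[OF d] c] lim_dataD(2-)[OF d, THEN weakening[OF _ c]]
  by (simp add: lim_data_def)

lemma MorphW_eq: "MorphW A B X g Y g' f = Pi A (Pi (arr (App (sh 1 B) (Var 0)) (sh 1 X))
    (Id (sh 2 Y) (App (sh 2 f) (App (App (sh 2 g) (Var 1)) (Var 0)))
      (App (App (sh 2 g') (Var 1)) (sh 2 f \<circ>\<^sub>t Var 0))))"
  by (simp add: MorphW_def arr_def)

lemma morph_sides:
  assumes d: "lim_data \<Gamma> A B X Y g g' f" and a: "\<Gamma> \<turnstile> a \<^bold>: A" and t: "\<Gamma> \<turnstile> t \<^bold>: arr (App B a) X"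
  shows "\<Gamma> \<turnstile> App f (App (App g a) t) \<^bold>: Y" "\<Gamma> \<turnstile> App (App g' a) (f \<circ>\<^sub>t t) \<^bold>: Y"
proof -
  note D = lim_dataD[OF d]
  show "\<Gamma> \<turnstile> App f (App (App g a) t) \<^bold>: Y" by (rule arr_app[OF D(6) AlgW_app[OF D(4) a t]])
  show "\<Gamma> \<turnstile> App (App g' a) (f \<circ>\<^sub>t t) \<^bold>: Y"
    by (rule AlgW_app[OF D(5) a comp_type[OF D(6) t params_fam[OF D(1) a]]])
qed

lemma MorphW_type:
  assumes d: "lim_data \<Gamma> A B X Y g g' f"
  shows "\<Gamma> \<turnstile> MorphW A B X g Y g' f \<^bold>: \<U>"
proof -
  note D = lim_dataD[OF d]
  note c = alg_ctx_wf[OF D(1,2)]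
  note s = morph_sides[OF lim_data_weaken[OF d c, simplified]
    alg_ctx_vars[OF c, simplified], simplified]
  show ?thesis unfolding MorphW_eq
    using s weakening[OF D(3) c] by (intro pi_type0 ty_id) simp_all
qed

lemma MorphW_app:
  assumes m: "\<Gamma> \<turnstile> m \<^bold>: MorphW A B X g Y g' f" and a: "\<Gamma> \<turnstile> a \<^bold>: A" and t: "\<Gamma> \<turnstile> t \<^bold>: arr (App B a) X"
  shows "\<Gamma> \<turnstile> App (App m a) t \<^bold>: Id Y (App f (App (App g a) t)) (App (App g' a) (f \<circ>\<^sub>t t))"
  using ty_app[OF ty_app[OF m[unfolded MorphW_eq] a, simplified] t] by simp

lemma inh_lam: "inh (A # \<Gamma>) B \<Longrightarrow> inh \<Gamma> (Pi A B)"
  by (auto simp: inh_def intro: ty_lam)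

lemma inh_MorphW:
  assumes "inh (alg_ctx A B X @ \<Gamma>) (Id (sh 2 Y) (App (sh 2 f) (App (App (sh 2 g) (Var 1)) (Var 0)))
      (App (App (sh 2 g') (Var 1)) (sh 2 f \<circ>\<^sub>t Var 0)))"
  shows "inh \<Gamma> (MorphW A B X g Y g' f)"
  unfolding MorphW_eq using assms by (intro inh_lam) simp

definition lim_eq :: "tm \<Rightarrow> tm \<Rightarrow> tm \<Rightarrow> tm \<Rightarrow> tm \<Rightarrow> tm \<Rightarrow> tm" where
  "lim_eq X Y g g' f w = Id Y (App f (rec_star X g w)) (rec_star Y g' w)"

lemma sub_lim_eq [simp]: "sub \<sigma> (lim_eq X Y g g' f w) =
    lim_eq (sub \<sigma> X) (sub \<sigma> Y) (sub \<sigma> g) (sub \<sigma> g') (sub \<sigma> f) (sub \<sigma> w)"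
  by (simp add: lim_eq_def)

lemma LimW_eq: "LimW A B w = Pi \<U> (Pi \<U> (Pi (AlgW (sh 2 A) (sh 2 B) (Var 1))
    (Pi (AlgW (sh 3 A) (sh 3 B) (Var 1)) (Pi (arr (Var 3) (Var 2))
    (Pi (MorphW (sh 5 A) (sh 5 B) (Var 4) (Var 2) (Var 3) (Var 1) (Var 0))
      (lim_eq (Var 5) (Var 4) (Var 3) (Var 2) (Var 1) (sh 6 w)))))))"
  by (simp add: LimW_def arr_def lim_eq_def)

text \<open>The context below all six binders of \<open>LimW\<close>. There the type
  \<open>X\<close> is \<open>Var 5\<close>, \<open>Y\<close> is \<open>Var 4\<close>, the algebras
  are \<open>Var 3\<close> and \<open>Var 2\<close>, the map is \<open>Var 1\<close>, and the
  morphism proof is \<open>Var 0\<close>.\<close>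

abbreviation lim_ctx :: "tm \<Rightarrow> tm \<Rightarrow> tm list" where
  "lim_ctx A B \<equiv> [MorphW (sh 5 A) (sh 5 B) (Var 4) (Var 2) (Var 3) (Var 1) (Var 0),
     arr (Var 3) (Var 2), AlgW (sh 3 A) (sh 3 B) (Var 1), AlgW (sh 2 A) (sh 2 B) (Var 1), \<U>, \<U>]"

lemma lim_ctx_wf:
  assumes p: "params \<Gamma> A B"
  shows "\<turnstile> lim_ctx A B @ \<Gamma> ctx"
proof -
  let ?G2 = "[\<U>, \<U>]" and ?G3 = "[AlgW (sh 2 A) (sh 2 B) (Var 1), \<U>, \<U>]"
  let ?G4 = "[AlgW (sh 3 A) (sh 3 B) (Var 1), AlgW (sh 2 A) (sh 2 B) (Var 1), \<U>, \<U>]"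
  let ?G5 = "arr (Var 3) (Var 2) # ?G4"
  have c2: "\<turnstile> ?G2 @ \<Gamma> ctx" using params_ctx[OF p] by (auto intro!: ctx_consI ty_univ ctx_cons)
  have "?G2 @ \<Gamma> \<turnstile> AlgW (sh 2 A) (sh 2 B) (Var 1) \<^bold>: \<U>"
    using params_weaken[OF p c2] c2 by (intro AlgW_type) (auto intro!: var_type)
  then have c3: "\<turnstile> ?G3 @ \<Gamma> ctx" using ctx_consI by simp
  have "?G3 @ \<Gamma> \<turnstile> AlgW (sh 3 A) (sh 3 B) (Var 1) \<^bold>: \<U>"
    using params_weaken[OF p c3] c3 by (intro AlgW_type) (auto intro!: var_type)
  then have c4: "\<turnstile> ?G4 @ \<Gamma> ctx" using ctx_consI by simp
  have "?G4 @ \<Gamma> \<turnstile> arr (Var 3) (Var 2) \<^bold>: \<U>"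
    using c4 by (intro arr_type0) (auto intro!: var_type)
  then have c5: "\<turnstile> ?G5 @ \<Gamma> ctx" using ctx_consI by simp
  have "lim_data (?G5 @ \<Gamma>) (sh 5 A) (sh 5 B) (Var 4) (Var 3) (Var 2) (Var 1) (Var 0)"
    using params_weaken[OF p c5] c5 by (auto simp: lim_data_def intro!: var_type)
  from MorphW_type[OF this] show ?thesis using ctx_consI by simp
qed

lemma lim_ctx_vars:
  assumes p: "params \<Gamma> A B"
  shows "lim_data (lim_ctx A B @ \<Gamma>) (sh 6 A) (sh 6 B) (Var 5) (Var 4) (Var 3) (Var 2) (Var 1)"
    and "lim_ctx A B @ \<Gamma> \<turnstile> Var 0 \<^bold>:
      MorphW (sh 6 A) (sh 6 B) (Var 5) (Var 3) (Var 4) (Var 2) (Var 1)"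
  using lim_ctx_wf[OF p] params_weaken[OF p lim_ctx_wf[OF p]]
  by (auto simp: lim_data_def intro!: var_type)

lemma lim_eq_type:
  assumes d: "lim_data \<Gamma> A B X Y g g' f" and w: "\<Gamma> \<turnstile> w \<^bold>: Wstar A B"
  shows "\<Gamma> \<turnstile> lim_eq X Y g g' f w \<^bold>: \<U>"
proof -
  note D = lim_dataD[OF d]
  show ?thesis unfolding lim_eq_def
    by (intro ty_id D arr_app[OF D(6)] rec_star_type[OF w D(2,4)] rec_star_type[OF w D(3,5)])
qed

lemma LimW_type:
  assumes p: "params \<Gamma> A B" and w: "\<Gamma> \<turnstile> w \<^bold>: Wstar A B"
  shows "\<Gamma> \<turnstile> LimW A B w \<^bold>: \<U>"
proof -
  note c = lim_ctx_wf[OF p]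
  have "lim_ctx A B @ \<Gamma> \<turnstile> lim_eq (Var 5) (Var 4) (Var 3) (Var 2) (Var 1) (sh 6 w) \<^bold>: \<U>"
    using weakening[OF w c] by (intro lim_eq_type[OF lim_ctx_vars(1)[OF p]]) simp
  then show ?thesis unfolding LimW_eq by (intro pi_type0) simp
qed

lemma inh_LimW:
  assumes "inh (lim_ctx A B @ \<Gamma>) (lim_eq (Var 5) (Var 4) (Var 3) (Var 2) (Var 1) (sh 6 w))"
  shows "inh \<Gamma> (LimW A B w)"
  unfolding LimW_eq using assms by (intro inh_lam) simp

lemma inh_LimW_app:
  assumes l: "\<Gamma> \<turnstile> l \<^bold>: LimW A B w" and d: "lim_data \<Gamma> A B X Y g g' f"
    and m: "inh \<Gamma> (MorphW A B X g Y g' f)"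
  shows "inh \<Gamma> (lim_eq X Y g g' f w)"
proof -
  note D = lim_dataD[OF d]
  obtain m' where m': "\<Gamma> \<turnstile> m' \<^bold>: MorphW A B X g Y g' f" using m by (auto simp: inh_def)
  note 1 = ty_app[OF l[unfolded LimW_eq] D(2), simplified]
  note 2 = ty_app[OF 1 D(3), simplified]
  note 3 = ty_app[OF 2 D(4), simplified]
  note 4 = ty_app[OF 3 D(5), simplified]
  note 5 = ty_app[OF 4 D(6), simplified]
  from ty_app[OF 5 m', simplified] show ?thesis by (rule inhI)
qed

text \<open>An iterated product ending in an identity type: UIP settles the end and function
  extensionality each product in front of it.\<close>

lemma isprop_LimW:
  assumes p: "params \<Gamma> A B"
  shows "isprop \<Gamma> (LimW A B w)"
proof -
  note c = lim_ctx_wf[OF p]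
  show ?thesis unfolding LimW_eq lim_eq_def
    using c by (intro isprop_Pi isprop_Id) (auto elim!: wf_ctx_ConsE)
qed

lemma is_sig_W:
  assumes p: "params \<Gamma> A B"
  shows "is_sig \<Gamma> (Wstar A B) (LimW (sh 1 A) (sh 1 B) (Var 0))"
proof -
  note T = Wstar_type[OF p]
  have c: "\<turnstile> [Wstar A B] @ \<Gamma> ctx" using ctx_consI[OF T] by simp
  have "Wstar A B # \<Gamma> \<turnstile> Var 0 \<^bold>: Wstar (sh (Suc 0) A) (sh (Suc 0) B)"
    using c by (auto intro!: var_type)
  from LimW_type[OF params_weaken[OF p c, simplified] this] T show ?thesis
    by (auto simp: is_sig_def)
qed

lemma W_eq: "W A B = Sig (Wstar A B) (LimW (sh 1 A) (sh 1 B) (Var 0))"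
  by (simp add: W_def)

lemma LimW_family_type:
  "params \<Gamma> A B \<Longrightarrow> Wstar A B # \<Gamma> \<turnstile> LimW (sh 1 A) (sh 1 B) (Var 0) \<^bold>: \<U>"
  using params_weaken[of \<Gamma> A B "[Wstar A B]"] ctx_consI[OF Wstar_type]
  by (intro LimW_type) (auto intro!: var_type)

lemma W_type: "params \<Gamma> A B \<Longrightarrow> \<Gamma> \<turnstile> W A B \<^bold>: \<U>"
  using ty_sig[OF Wstar_type LimW_family_type] by (simp add: W_eq)

lemma W_proj1_type: "params \<Gamma> A B \<Longrightarrow> \<Gamma> \<turnstile> \<pi>\<^sub>1 \<^bold>: arr (W A B) (Wstar A B)"
  unfolding W_eq by (intro proj1_type is_sig_W)

lemma W_proj2_type: "params \<Gamma> A B \<Longrightarrow> \<Gamma> \<turnstile> v \<^bold>: W A B \<Longrightarrow> \<Gamma> \<turnstile> proj2 v \<^bold>: LimW A B (App \<pi>\<^sub>1 v)"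
  unfolding W_eq by (drule (1) proj2_type[OF is_sig_W]) simp

lemma W_pair_type: "params \<Gamma> A B \<Longrightarrow> \<Gamma> \<turnstile> w \<^bold>: Wstar A B \<Longrightarrow> \<Gamma> \<turnstile> l \<^bold>: LimW A B w \<Longrightarrow>
    \<Gamma> \<turnstile> Pair w l \<^bold>: W A B"
  unfolding W_eq by (rule ty_pair[OF LimW_family_type]) simp_all

lemma W_proj1_beta: "params \<Gamma> A B \<Longrightarrow> \<Gamma> \<turnstile> w \<^bold>: Wstar A B \<Longrightarrow> \<Gamma> \<turnstile> l \<^bold>: LimW A B w \<Longrightarrow>
    \<Gamma> \<turnstile> App \<pi>\<^sub>1 (Pair w l) \<simeq> w \<^bold>: Wstar A B"
  by (rule proj1_beta[OF is_sig_W]) simp_all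

lemma LimW_cong:
  assumes p: "params \<Gamma> A B" and e: "\<Gamma> \<turnstile> v \<simeq> w \<^bold>: Wstar A B" and v: "\<Gamma> \<turnstile> v \<^bold>: Wstar A B"
    and w: "\<Gamma> \<turnstile> w \<^bold>: Wstar A B"
  shows "\<Gamma> \<turnstile> LimW A B v \<simeq> LimW A B w \<^bold>: \<U>"
  using subst_cong[OF LimW_family_type[OF p] e v w] by simp

section \<open>The constructor preserves the limit condition\<close>

lemma branch_type:
  assumes p: "params \<Gamma> A B" and a: "\<Gamma> \<turnstile> a \<^bold>: A" and r: "\<Gamma> \<turnstile> r \<^bold>: arr (App B a) (W A B)"
  shows "\<Gamma> \<turnstile> \<pi>\<^sub>1 \<circ>\<^sub>t r \<^bold>: arr (App B a) (Wstar A B)"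
  by (rule comp_type[OF W_proj1_type[OF p] r params_fam[OF p a]])

text \<open>The contracted form of
  \<open>sup_branches (\<pi>\<^sub>1 \<circ>\<^sub>t r) X g\<close>. The composite
  \<open>eval_W X g \<circ>\<^sub>t r\<close> reduces to it as well, so this is where the two sides
  of the morphism equation for \<open>eval_W\<close> meet.\<close>

definition W_branches :: "tm \<Rightarrow> tm \<Rightarrow> tm \<Rightarrow> tm" where
  "W_branches r X g = Lam (rec_star (sh 1 X) (sh 1 g) (App \<pi>\<^sub>1 (App (sh 1 r) (Var 0))))"

lemma sub_W_branches [simp]:
  "sub \<sigma> (W_branches r X g) = W_branches (sub \<sigma> r) (sub \<sigma> X) (sub \<sigma> g)"
  by (simp add: W_branches_def)

context
  fixes \<Gamma> A B a r X g
  assumes p: "params \<Gamma> A B" and a: "\<Gamma> \<turnstile> a \<^bold>: A" and r: "\<Gamma> \<turnstile> r \<^bold>: arr (App B a) (W A B)"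
    and X: "\<Gamma> \<turnstile> X \<^bold>: \<U>" and g: "\<Gamma> \<turnstile> g \<^bold>: AlgW A B X"
begin

lemma W_branches_body:
  "App B a # \<Gamma> \<turnstile> rec_star (sh 1 X) (sh 1 g) (App \<pi>\<^sub>1 (App (sh 1 r) (Var 0))) \<^bold>: sh 1 X"
proof -
  note c = fam_ctx[OF p a]
  note q = params_weaken[OF p c, simplified] and x = fam_ctx_app[OF c r, simplified]
  show ?thesis
    using rec_star_type[OF arr_app[OF W_proj1_type[OF q] x] weakening[OF X c, simplified]
        weakening[OF g c, simplified]] by simp
qed

lemma W_branches_type: "\<Gamma> \<turnstile> W_branches r X g \<^bold>: arr (App B a) X"
  unfolding W_branches_def by (rule arr_lam[OF W_branches_body])

lemma W_branches_beta: "\<Gamma> \<turnstile> b \<^bold>: App B a \<Longrightarrow>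
    \<Gamma> \<turnstile> App (W_branches r X g) b \<simeq> rec_star X g (App \<pi>\<^sub>1 (App r b)) \<^bold>: X"
  unfolding W_branches_def by (rule beta_arr[OF W_branches_body]) simp_all

lemma rec_star_sup_W: "\<Gamma> \<turnstile> rec_star X g (sup_star a (\<pi>\<^sub>1 \<circ>\<^sub>t r)) \<simeq> App
  (App g a) (W_branches r X g) \<^bold>: X"
proof -
  note c = fam_ctx[OF p a]
  note q = params_weaken[OF p c, simplified] and x = fam_ctx_app[OF c r, simplified]
  note b = branch_type[OF p a r]
  have v: "App B a # \<Gamma> \<turnstile> Var 0 \<^bold>: App (sh (Suc 0) B) (sh (Suc 0) a)" using c
    by (auto intro!: var_type)
  have "App B a # \<Gamma> \<turnstile> App (\<pi>\<^sub>1 \<circ>\<^sub>t sh (Suc 0) r) (Var 0) \<simeq> App \<pi>\<^sub>1 (App (sh (Suc 0) r) (Var 0))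
      \<^bold>: Wstar (sh (Suc 0) A) (sh (Suc 0) B)"
    by (rule comp_beta[OF W_proj1_type[OF q] weakening[OF r c, simplified]
          params_fam[OF q weakening[OF a c, simplified]] v])
  from rec_star_cong[OF this weakening[OF X c, simplified] weakening[OF g c, simplified]]
  have "\<Gamma> \<turnstile> sup_branches (\<pi>\<^sub>1 \<circ>\<^sub>t r) X g \<simeq> W_branches r X g \<^bold>: arr (App B a) X"
    unfolding sup_branches_def W_branches_def by (intro eq_lam_arr) simp
  from eq_trans[OF rec_star_sup_star[OF p a b X g] AlgW_eq_app[OF g a this]] show ?thesis .
qed

end

lemma inh_lim_eq_sup:
  assumes d: "lim_data \<Gamma> A B X Y g g' f" and m: "\<Gamma> \<turnstile> m \<^bold>: MorphW A B X g Y g' f"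
    and a: "\<Gamma> \<turnstile> a \<^bold>: A" and r: "\<Gamma> \<turnstile> r \<^bold>: arr (App B a) (W A B)"
  shows "inh \<Gamma> (lim_eq X Y g g' f (sup_star a (\<pi>\<^sub>1 \<circ>\<^sub>t r)))"
proof -
  note D = lim_dataD[OF d]
  let ?s = "sup_star a (\<pi>\<^sub>1 \<circ>\<^sub>t r)" and ?t = "W_branches r X g" and ?t' = "W_branches r Y g'"
  note t = W_branches_type[OF D(1) a r D(2,4)] and t' = W_branches_type[OF D(1) a r D(3,5)]
  note F = params_fam[OF D(1) a]
  note ft = comp_type[OF D(6) t F]
  note c = fam_ctx[OF D(1) a]
  note d1 = lim_data_weaken[OF d c, simplified]
  note D1 = lim_dataD[OF d1] and r1 = weakening[OF r c, simplified]
    and a1 = weakening[OF a c, simplified]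
  note x = fam_ctx_app[OF c r, simplified]
  have v: "App B a # \<Gamma> \<turnstile> Var 0 \<^bold>: App (sh (Suc 0) B) (sh (Suc 0) a)" using c
    by (auto intro!: var_type)
  \<comment> \<open>Each branch is an element of \<open>W A B\<close>, so its second projection is a
    limit condition; it is instantiated at the given morphism, weakened by the branch index.\<close>
  have "inh (App B a # \<Gamma>) (lim_eq (sh (Suc 0) X) (sh (Suc 0) Y) (sh (Suc 0) g) (sh (Suc 0) g')
      (sh (Suc 0) f) (App \<pi>\<^sub>1 (App (sh (Suc 0) r) (Var 0))))"
    using inh_LimW_app[OF W_proj2_type[OF D1(1) x] d1] weakening[OF m c] by (auto intro: inhI)
  then obtain e where e: "App B a # \<Gamma> \<turnstile> e \<^bold>: Id (sh (Suc 0) Y)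
      (App (sh (Suc 0) f) (rec_star (sh (Suc 0) X) (sh (Suc 0) g) (App \<pi>\<^sub>1
        (App (sh (Suc 0) r) (Var 0)))))
      (rec_star (sh (Suc 0) Y) (sh (Suc 0) g') (App \<pi>\<^sub>1 (App (sh (Suc 0) r) (Var 0))))"
    by (auto simp: inh_def lim_eq_def)
  note t1 = W_branches_type[OF D1(1) a1 r1 D1(2,4)]
  \<comment> \<open>Function extensionality compares applications to \<open>Var 0\<close>, so both
    sides of the equation for a branch are expanded into such applications.\<close>
  have l: "App B a # \<Gamma> \<turnstile> App (sh (Suc 0) f) (rec_star (sh (Suc 0) X) (sh (Suc 0) g) (App \<pi>\<^sub>1
    (App (sh (Suc 0) r) (Var 0))))
      \<simeq> App (sh (Suc 0) (f \<circ>\<^sub>t ?t)) (Var 0) \<^bold>: sh (Suc 0) Y"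
    using eq_sym[OF eq_trans[OF comp_beta[OF D1(6) t1 params_fam[OF D1(1) a1] v]
          arr_eq_app[OF eq_refl[OF D1(6)] W_branches_beta[OF D1(1) a1 r1 D1(2,4) v]]]] by simp
  have r': "App B a # \<Gamma> \<turnstile> rec_star (sh (Suc 0) Y) (sh (Suc 0) g') (App \<pi>\<^sub>1
    (App (sh (Suc 0) r) (Var 0)))
      \<simeq> App (sh (Suc 0) ?t') (Var 0) \<^bold>: sh (Suc 0) Y"
    using eq_sym[OF W_branches_beta[OF D1(1) a1 r1 D1(3,5) v]] by simp
  have h: "inh \<Gamma> (Id (arr (App B a) Y) (f \<circ>\<^sub>t ?t) ?t')"
    using ft t' id_conv[OF e D1(3) l r'] unfolding arr_def by (intro inh_funext) (auto intro: inhI)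
  have T: "\<Gamma> \<turnstile> arr (App B a) Y \<^bold>: \<U>" by (rule arr_type0[OF F D(3)])
  note cT = ctx_consI[OF T]
  \<comment> \<open>The map that applies \<open>g'\<close> to \<open>a\<close> and a variable
    function, along which the equality \<open>h\<close> of branch functions is pushed.\<close>
  have "arr (App B a) Y # \<Gamma> \<turnstile> App (App (sh 1 g') (sh 1 a)) (Var 0) \<^bold>: sh 1 Y"
    using weaken1[OF D(5) cT] weaken1[OF a cT] cT
    by (auto intro!: AlgW_app var_type)
  from inh_ap[OF T D(3) this ft t' h]
  have q: "inh \<Gamma> (Id Y (App (App g' a) (f \<circ>\<^sub>t ?t)) (App (App g' a) ?t'))" by simp
  note s = morph_sides[OF d a t] and s' = AlgW_app[OF D(5) a t']
  obtain e' where e': "\<Gamma> \<turnstile> e' \<^bold>: Id Y (App f (App (App g a) ?t)) (App (App g' a) ?t')"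
    using inh_trans[OF D(3) s s' inhI[OF MorphW_app[OF m a t]] q] by (auto simp: inh_def)
  \<comment> \<open>The computation rule of the recursor is read backwards on both sides, folding
    the algebra applications into \<open>?s\<close>.\<close>
  have "\<Gamma> \<turnstile> e' \<^bold>: Id Y (App f (rec_star X g ?s)) (rec_star Y g' ?s)"
    by (rule id_conv[OF e' D(3)
          arr_eq_app[OF eq_refl[OF D(6)] eq_sym[OF rec_star_sup_W[OF D(1) a r D(2,4)]]]
          eq_sym[OF rec_star_sup_W[OF D(1) a r D(3,5)]]])
  then show ?thesis by (auto simp: lim_eq_def intro: inhI)
qed

lemma inh_LimW_sup:
  assumes p: "params \<Gamma> A B" and a: "\<Gamma> \<turnstile> a \<^bold>: A" and r: "\<Gamma> \<turnstile> r \<^bold>: arr (App B a) (W A B)"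
  shows "inh \<Gamma> (LimW A B (sup_star a (\<pi>\<^sub>1 \<circ>\<^sub>t r)))"
proof -
  note c = lim_ctx_wf[OF p]
  show ?thesis
    using inh_lim_eq_sup[OF lim_ctx_vars[OF p], of "sh 6 a" "sh 6 r"]
      weakening[OF a c] weakening[OF r c] by (intro inh_LimW) simp
qed

lemma SupLim_eq: "SupLim A B = Pi A (Pi (arr (App (sh 1 B) (Var 0)) (sh 1 (W A B)))
    (LimW (sh 2 A) (sh 2 B) (sup_star (Var 1) (\<pi>\<^sub>1 \<circ>\<^sub>t Var 0))))"
  by (simp add: SupLim_def arr_def)

lemma inh_SupLim:
  assumes p: "params \<Gamma> A B"
  shows "inh \<Gamma> (SupLim A B)"
proof -
  note c = alg_ctx_wf[OF p W_type[OF p]]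
  show ?thesis unfolding SupLim_eq
    using inh_LimW_sup[OF params_weaken[OF p c, simplified] alg_ctx_vars(1)[OF c, simplified]]
      alg_ctx_vars(2)[OF c] by (intro inh_lam) simp
qed

lemma alg_beta:
  assumes e: "alg_ctx A B X @ \<Gamma> \<turnstile> e \<^bold>: sh 2 X" and a: "\<Gamma> \<turnstile> a \<^bold>: A" and t: "\<Gamma> \<turnstile> t \<^bold>: arr (App B a) X"
    and u: "u = sub (t \<cdot> a \<cdot> Var) e"
  shows "\<Gamma> \<turnstile> App (App (Lam (Lam e)) a) t \<simeq> u \<^bold>: X"
  by (rule beta2[OF e[simplified] a]) (use t u in simp_all)

section \<open>The initial algebra\<close>

lemma SupLim_type:
  assumes p: "params \<Gamma> A B"
  shows "\<Gamma> \<turnstile> SupLim A B \<^bold>: \<U>"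
proof -
  note c = alg_ctx_wf[OF p W_type[OF p]]
  note q = params_weaken[OF p c, simplified] and v = alg_ctx_vars[OF c, simplified]
  show ?thesis unfolding SupLim_eq
    using LimW_type[OF q sup_star_type[OF q v(1) branch_type[OF q v]]] by (intro pi_type0) simp
qed

text \<open>Here \<open>p\<close> is an arbitrary element of \<open>SupLim\<close>, not the one just
  constructed, so induction comes out for every choice of the proof stored by
  \<open>sup_W\<close>.\<close>

definition sup_data :: "tm list \<Rightarrow> tm \<Rightarrow> tm \<Rightarrow> tm \<Rightarrow> bool" where
  "sup_data \<Gamma> A B p \<longleftrightarrow> params \<Gamma> A B \<and> \<Gamma> \<turnstile> p \<^bold>: SupLim A B"

lemma sup_data_weaken: "sup_data \<Gamma> A B p \<Longrightarrow> \<turnstile> \<Delta> @ \<Gamma> ctx \<Longrightarrow>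
    sup_data (\<Delta> @ \<Gamma>) (sh (length \<Delta>) A) (sh (length \<Delta>) B) (sh (length \<Delta>) p)"
  using weakening[of \<Gamma> p "SupLim A B" \<Delta>] by (auto simp: sup_data_def params_weaken)

lemma sup_W_type:
  assumes d: "sup_data \<Gamma> A B p" and a: "\<Gamma> \<turnstile> a \<^bold>: A" and r: "\<Gamma> \<turnstile> r \<^bold>: arr (App B a) (W A B)"
  shows "\<Gamma> \<turnstile> App (App p a) r \<^bold>: LimW A B (sup_star a (\<pi>\<^sub>1 \<circ>\<^sub>t r))"
    and "\<Gamma> \<turnstile> sup_W p a r \<^bold>: W A B"
    and "\<Gamma> \<turnstile> App \<pi>\<^sub>1 (sup_W p a r) \<simeq> sup_star a (\<pi>\<^sub>1 \<circ>\<^sub>t r) \<^bold>: Wstar A B"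
proof -
  have p: "params \<Gamma> A B" and q: "\<Gamma> \<turnstile> p \<^bold>: SupLim A B" using d by (auto simp: sup_data_def)
  note s = sup_star_type[OF p a branch_type[OF p a r]]
  show l: "\<Gamma> \<turnstile> App (App p a) r \<^bold>: LimW A B (sup_star a (\<pi>\<^sub>1 \<circ>\<^sub>t r))"
    using ty_app[OF ty_app[OF q[unfolded SupLim_eq] a, simplified] r] by simp
  show "\<Gamma> \<turnstile> sup_W p a r \<^bold>: W A B" unfolding sup_W_def by (rule W_pair_type[OF p s l])
  show "\<Gamma> \<turnstile> App \<pi>\<^sub>1 (sup_W p a r) \<simeq> sup_star a (\<pi>\<^sub>1 \<circ>\<^sub>t r) \<^bold>: Wstar A B"
    unfolding sup_W_def by (rule W_proj1_beta[OF p s l])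
qed

text \<open>The constructor as an algebra in the sense of \<open>AlgW\<close>. Its carrier is in
  \<open>\<U>\<close>, so \<open>rec_star\<close> and \<open>LimW\<close> can be instantiated at
  it.\<close>

definition sup_alg :: "tm \<Rightarrow> tm" where
  "sup_alg p = Lam (Lam (sup_W (sh 2 p) (Var 1) (Var 0)))"

lemma sub_sup_alg [simp]: "sub \<sigma> (sup_alg p) = sup_alg (sub \<sigma> p)"
  by (simp add: sup_alg_def)

lemma sup_alg_body:
  assumes d: "sup_data \<Gamma> A B p"
  shows "alg_ctx A B (W A B) @ \<Gamma> \<turnstile> sup_W (sh 2 p) (Var 1) (Var 0) \<^bold>: sh 2 (W A B)"
proof -
  have p: "params \<Gamma> A B" using d by (auto simp: sup_data_def)
  note c = alg_ctx_wf[OF p W_type[OF p]]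
  show ?thesis
    using sup_W_type(2)[OF sup_data_weaken[OF d c, simplified] alg_ctx_vars(1)[OF c, simplified]]
      alg_ctx_vars(2)[OF c] by simp
qed

lemma sup_alg_type: "sup_data \<Gamma> A B p \<Longrightarrow> \<Gamma> \<turnstile> sup_alg p \<^bold>: AlgW A B (W A B)"
  unfolding sup_alg_def by (rule AlgW_lam[OF sup_alg_body])

lemma sup_alg_beta: "sup_data \<Gamma> A B p \<Longrightarrow> \<Gamma> \<turnstile> a \<^bold>: A \<Longrightarrow> \<Gamma> \<turnstile> r \<^bold>: arr (App B a) (W A B) \<Longrightarrow>
    \<Gamma> \<turnstile> App (App (sup_alg p) a) r \<simeq> sup_W p a r \<^bold>: W A B"
  unfolding sup_alg_def by (rule alg_beta[OF sup_alg_body]) simp_all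

section \<open>Evaluation maps out of the initial algebra\<close>

definition eval_W :: "tm \<Rightarrow> tm \<Rightarrow> tm" where
  "eval_W X g = Lam (rec_star (sh 1 X) (sh 1 g) (App \<pi>\<^sub>1 (Var 0)))"

lemma sub_eval_W [simp]: "sub \<sigma> (eval_W X g) = eval_W (sub \<sigma> X) (sub \<sigma> g)"
  by (simp add: eval_W_def)

context
  fixes \<Gamma> A B X g
  assumes p: "params \<Gamma> A B" and X: "\<Gamma> \<turnstile> X \<^bold>: \<U>" and g: "\<Gamma> \<turnstile> g \<^bold>: AlgW A B X"
begin

lemma eval_W_body: "W A B # \<Gamma> \<turnstile> rec_star (sh 1 X) (sh 1 g) (App \<pi>\<^sub>1 (Var 0)) \<^bold>: sh 1 X"
proof -
  have c: "\<turnstile> [W A B] @ \<Gamma> ctx" using ctx_consI[OF W_type[OF p]] by simp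
  have "W A B # \<Gamma> \<turnstile> Var 0 \<^bold>: W (sh (Suc 0) A) (sh (Suc 0) B)" using c by (auto intro!: var_type)
  from rec_star_type[OF arr_app[OF W_proj1_type[OF params_weaken[OF p c, simplified]] this]
      weakening[OF X c, simplified] weakening[OF g c, simplified]]
  show ?thesis by simp
qed

lemma eval_W_type: "\<Gamma> \<turnstile> eval_W X g \<^bold>: arr (W A B) X"
  unfolding eval_W_def by (rule arr_lam[OF eval_W_body])

lemma eval_W_beta: "\<Gamma> \<turnstile> v \<^bold>: W A B \<Longrightarrow> \<Gamma> \<turnstile> App (eval_W X g) v \<simeq> rec_star X g (App \<pi>\<^sub>1 v) \<^bold>: X"
  unfolding eval_W_def by (rule beta_arr[OF eval_W_body]) simp_all

end

text \<open>Both sides reduce to \<open>g\<close> applied to \<open>a\<close> and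
  \<open>W_branches t X g\<close>, so reflexivity is a witness. On the right the beta step takes
  place under the binder of the composite.\<close>

lemma eval_W_morph_eq:
  assumes d: "sup_data \<Gamma> A B p" and X: "\<Gamma> \<turnstile> X \<^bold>: \<U>" and g: "\<Gamma> \<turnstile> g \<^bold>: AlgW A B X"
    and a: "\<Gamma> \<turnstile> a \<^bold>: A" and t: "\<Gamma> \<turnstile> t \<^bold>: arr (App B a) (W A B)"
  shows "inh \<Gamma> (Id X (App (eval_W X g) (App (App (sup_alg p) a) t)) (App
    (App g a) (eval_W X g \<circ>\<^sub>t t)))"
proof -
  have p: "params \<Gamma> A B" using d by (auto simp: sup_data_def)
  note E = eval_W_type[OF p X g] and s = sup_W_type(2,3)[OF d a t]
  have l: "\<Gamma> \<turnstile> App (eval_W X g) (App (App (sup_alg p) a) t) \<simeq> App (App g a) (W_branches t X g) \<^bold>: X"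
    by (rule eq_trans[OF eq_trans[OF
          arr_eq_app[OF eq_refl[OF E] sup_alg_beta[OF d a t]]
          eval_W_beta[OF p X g s(1)]]
        eq_trans[OF rec_star_cong[OF s(2) X g] rec_star_sup_W[OF p a t X g]]])
  note c = fam_ctx[OF p a]
  note q = params_weaken[OF p c, simplified] and x = fam_ctx_app[OF c t, simplified]
  have "\<Gamma> \<turnstile> eval_W X g \<circ>\<^sub>t t \<simeq> W_branches t X g \<^bold>: arr (App B a) X"
    unfolding comp_def W_branches_def lift_eq_wk
    using eval_W_beta[OF q weakening[OF X c, simplified] weakening[OF g c, simplified] x]
    by (intro eq_lam_arr) simp
  from AlgW_eq_app[OF g a this]
  have r: "\<Gamma> \<turnstile> App (App g a) (eval_W X g \<circ>\<^sub>t t) \<simeq> App (App g a) (W_branches t X g) \<^bold>: X" .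
  show ?thesis
    by (rule inhI[OF refl_conv[OF X AlgW_app[OF g a W_branches_type[OF p a t X g]] l r]])
qed

lemma inh_MorphW_eval_W:
  assumes d: "sup_data \<Gamma> A B p" and X: "\<Gamma> \<turnstile> X \<^bold>: \<U>" and g: "\<Gamma> \<turnstile> g \<^bold>: AlgW A B X"
  shows "inh \<Gamma> (MorphW A B (W A B) (sup_alg p) X g (eval_W X g))"
proof -
  have p: "params \<Gamma> A B" using d by (auto simp: sup_data_def)
  note c = alg_ctx_wf[OF p W_type[OF p]]
  show ?thesis
    using eval_W_morph_eq[OF sup_data_weaken[OF d c, simplified] weakening[OF X c, simplified]
        weakening[OF g c, simplified] alg_ctx_vars(1)[OF c, simplified]] alg_ctx_vars(2)[OF c]
    by (intro inh_MorphW) simp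
qed

text \<open>The limit condition \<open>l\<close> at the morphism \<open>eval_W X g\<close> from
  \<open>sup_alg p\<close> to \<open>g\<close>, with its left side contracted by beta.\<close>

lemma inh_rec_star_sup_alg:
  assumes d: "sup_data \<Gamma> A B p" and X: "\<Gamma> \<turnstile> X \<^bold>: \<U>" and g: "\<Gamma> \<turnstile> g \<^bold>: AlgW A B X"
    and w: "\<Gamma> \<turnstile> w \<^bold>: Wstar A B" and l: "\<Gamma> \<turnstile> l \<^bold>: LimW A B w"
  shows "inh \<Gamma> (Id X (rec_star X g (App \<pi>\<^sub>1 (rec_star (W A B) (sup_alg p) w))) (rec_star X g w))"
proof -
  have p: "params \<Gamma> A B" using d by (auto simp: sup_data_def)
  note T = W_type[OF p] and S = sup_alg_type[OF d]
  have "lim_data \<Gamma> A B (W A B) X (sup_alg p) g (eval_W X g)"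
    using p T S X g eval_W_type[OF p X g] by (simp add: lim_data_def)
  from inh_LimW_app[OF l this inh_MorphW_eval_W[OF d X g]]
  obtain e where "\<Gamma> \<turnstile> e \<^bold>: Id X (App (eval_W X g) (rec_star (W A B) (sup_alg p) w))
    (rec_star X g w)"
    by (auto simp: inh_def lim_eq_def)
  from id_conv[OF this X eval_W_beta[OF p X g rec_star_type[OF w T S]] eq_refl[OF
    rec_star_type[OF w X g]]]
  show ?thesis by (rule inhI)
qed

text \<open>Function extensionality twice, once over the carrier and once over the algebra; hence
  the hypothesis lives over \<open>rec_ctx\<close>, at a generic algebra.\<close>

lemma inh_Wstar_ext:
  assumes p: "params \<Gamma> A B" and u: "\<Gamma> \<turnstile> u \<^bold>: Wstar A B" and w: "\<Gamma> \<turnstile> w \<^bold>: Wstar A B"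
    and e: "inh (rec_ctx A B @ \<Gamma>) (Id (Var 1) (rec_star (Var 1) (Var 0) (sh 2 u))
      (rec_star (Var 1) (Var 0) (sh 2 w)))"
  shows "inh \<Gamma> (Id (Wstar A B) u w)"
proof -
  have c2: "\<turnstile> rec_ctx A B @ \<Gamma> ctx" by (rule rec_ctx_wf[OF p])
  then have c1: "\<turnstile> \<U> # \<Gamma> ctx" by (auto elim: wf_ctx_ConsE)
  note u' = u[unfolded Wstar_eq] and w' = w[unfolded Wstar_eq]
  show ?thesis unfolding Wstar_eq
    using e by (intro inh_funext u' w' app_Var0 c1) (simp add: rec_star_def)
qed

section \<open>Extensionality for pairs\<close>

text \<open>Quantifying over the second component lets \<open>J\<close> and \<open>Split\<close> act on the first component alone.\<close>

definition eta_type :: "tm \<Rightarrow> tm \<Rightarrow> tm \<Rightarrow> tm \<Rightarrow> tm" where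
  "eta_type A B v x = Pi (LimW A B x) (Id (sh 1 (W A B)) (sh 1 v) (Pair (sh 1 x) (Var 0)))"

lemma sub_eta_type [simp]:
  "sub \<sigma> (eta_type A B v x) = eta_type (sub \<sigma> A) (sub \<sigma> B) (sub \<sigma> v) (sub \<sigma> x)"
  by (simp add: eta_type_def)

lemma eta_type_type:
  assumes p: "params \<Gamma> A B" and v: "\<Gamma> \<turnstile> v \<^bold>: W A B" and x: "\<Gamma> \<turnstile> x \<^bold>: Wstar A B"
  shows "\<Gamma> \<turnstile> eta_type A B v x \<^bold>: \<U>"
proof -
  have c: "\<turnstile> [LimW A B x] @ \<Gamma> ctx" using ctx_consI[OF LimW_type[OF p x]] by simp
  note q = params_weaken[OF p c, simplified]
  have "LimW A B x # \<Gamma> \<turnstile> Var 0 \<^bold>: LimW (sh (Suc 0) A) (sh (Suc 0) B) (sh (Suc 0) x)"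
    using c by (auto intro!: var_type)
  from W_pair_type[OF q weakening[OF x c, simplified] this] W_type[OF q] weakening[OF v c]
  show ?thesis unfolding eta_type_def by (intro pi_type0 ty_id) simp_all
qed

text \<open>Since \<open>App \<pi>\<^sub>1 (Pair x k)\<close> is judgementally \<open>x\<close>, the
  terms \<open>k\<close> and \<open>l\<close> inhabit the same proposition. Pairing with
  \<open>x\<close> turns their equality into one of pairs, and the first component on the right is
  then replaced by conversion.\<close>

lemma inh_pair_eq:
  assumes p: "params \<Gamma> A B" and x: "\<Gamma> \<turnstile> x \<^bold>: Wstar A B" and k: "\<Gamma> \<turnstile> k \<^bold>: LimW A B x"
    and l: "\<Gamma> \<turnstile> l \<^bold>: LimW A B (App \<pi>\<^sub>1 (Pair x k))"
  shows "inh \<Gamma> (Id (W A B) (Pair x k) (Pair (App \<pi>\<^sub>1 (Pair x k)) l))"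
proof -
  note b = W_proj1_beta[OF p x k] and T = LimW_type[OF p x] and V = W_type[OF p]
  note xk = W_pair_type[OF p x k]
  note p1 = arr_app[OF W_proj1_type[OF p] xk]
  have l': "\<Gamma> \<turnstile> l \<^bold>: LimW A B x" by (rule ty_conv[OF l LimW_cong[OF p b p1 x]])
  have c: "\<turnstile> [LimW A B x] @ \<Gamma> ctx" using ctx_consI[OF T] by simp
  have "LimW A B x # \<Gamma> \<turnstile> Var 0 \<^bold>: LimW (sh (Suc 0) A) (sh (Suc 0) B) (sh (Suc 0) x)"
    using c by (auto intro!: var_type)
  from W_pair_type[OF params_weaken[OF p c, simplified] weakening[OF x c, simplified] this]
  have "LimW A B x # \<Gamma> \<turnstile> Pair (sh 1 x) (Var 0) \<^bold>: sh 1 (W A B)" by simp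
  from inh_ap[OF T V this k l'] isprop_LimW[OF p] k l'
  obtain e where e: "\<Gamma> \<turnstile> e \<^bold>: Id (W A B) (Pair x k) (Pair x l)"
    by (auto simp: isprop_def inh_def)
  have "\<Gamma> \<turnstile> Pair x l \<simeq> Pair (App \<pi>\<^sub>1 (Pair x k)) l \<^bold>: W A B"
    unfolding W_eq by (rule eq_pair[OF LimW_family_type[OF p] eq_sym[OF b]]) (use l'
      in \<open>simp add: eq_refl\<close>)
  from id_conv[OF e V eq_refl[OF xk] this] show ?thesis by (rule inhI)
qed

lemma split_inh:
  assumes s: "is_sig \<Gamma> A B" and C: "Sig A B # \<Gamma> \<turnstile> C \<^bold>: Univ k"
    and d: "inh (B # A # \<Gamma>) (sub (Pair (Var 1) (Var 0) \<cdot> wk 2) C)" and v: "\<Gamma> \<turnstile> v \<^bold>: Sig A B"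
  shows "inh \<Gamma> (C\<langle>v\<rangle>)"
  using d ty_split[OF C _ v] by (auto simp: inh_def)

lemma W_split_ctx:
  assumes p: "params \<Gamma> A B"
  shows "\<turnstile> [LimW (sh 1 A) (sh 1 B) (Var 0), Wstar A B] @ \<Gamma> ctx"
  using ctx_consI[OF LimW_family_type[OF p]] by simp

lemma W_split_vars:
  assumes c: "\<turnstile> [LimW (sh 1 A) (sh 1 B) (Var 0), Wstar A B] @ \<Gamma> ctx"
  shows "[LimW (sh 1 A) (sh 1 B) (Var 0), Wstar A B] @ \<Gamma> \<turnstile> Var (Suc 0) \<^bold>:
      Wstar (sh (Suc (Suc 0)) A) (sh (Suc (Suc 0)) B)"
    and "[LimW (sh 1 A) (sh 1 B) (Var 0), Wstar A B] @ \<Gamma> \<turnstile> Var 0 \<^bold>: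
      LimW (sh (Suc (Suc 0)) A) (sh (Suc (Suc 0)) B) (Var (Suc 0))"
  using c by (auto intro!: var_type)

text \<open>Surjective pairing in propositional form. \<open>Split\<close> reduces it to a genuine
  pair \<open>Pair x k\<close>, where an arbitrary second component \<open>l\<close> is handled by
  \<open>inh_pair_eq\<close>.\<close>

lemma inh_eta_proj1:
  assumes p: "params \<Gamma> A B" and v: "\<Gamma> \<turnstile> v \<^bold>: W A B"
  shows "inh \<Gamma> (eta_type A B v (App \<pi>\<^sub>1 v))"
proof -
  let ?C = "eta_type (sh 1 A) (sh 1 B) (Var 0) (App \<pi>\<^sub>1 (Var 0))"
  have c: "\<turnstile> [W A B] @ \<Gamma> ctx" using ctx_consI[OF W_type[OF p]] by simp
  note q = params_weaken[OF p c, simplified]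
  have x: "W A B # \<Gamma> \<turnstile> Var 0 \<^bold>: W (sh (Suc 0) A) (sh (Suc 0) B)" using c by (auto intro!: var_type)
  have C: "W A B # \<Gamma> \<turnstile> ?C \<^bold>: \<U>"
    using eta_type_type[OF q x arr_app[OF W_proj1_type[OF q] x]] by simp
  note c2 = W_split_ctx[OF p]
  note q2 = params_weaken[OF p c2, simplified] and y = W_split_vars[OF c2, simplified]
  have eta: "inh \<Gamma> (eta_type A B (Pair x k) (App \<pi>\<^sub>1 (Pair x k)))"
    if p: "params \<Gamma> A B" and x: "\<Gamma> \<turnstile> x \<^bold>: Wstar A B" and k: "\<Gamma> \<turnstile> k \<^bold>: LimW A B x" for \<Gamma> A B x k
  proof -
    have c: "\<turnstile> [LimW A B (App \<pi>\<^sub>1 (Pair x k))] @ \<Gamma> ctx"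
      using ctx_consI[OF LimW_type[OF p arr_app[OF W_proj1_type[OF p] W_pair_type[OF p x k]]]]
        by simp
    have "LimW A B (App \<pi>\<^sub>1 (Pair x k)) # \<Gamma> \<turnstile> Var 0 \<^bold>: LimW (sh (Suc 0) A) (sh (Suc 0) B)
        (App \<pi>\<^sub>1 (Pair (sh (Suc 0) x) (sh (Suc 0) k)))"
      using c by (auto intro!: var_type)
    from inh_pair_eq[OF params_weaken[OF p c, simplified] weakening[OF x c, simplified]
        weakening[OF k c, simplified] this]
    show ?thesis unfolding eta_type_def by (intro inh_lam) simp
  qed
  show ?thesis
    using split_inh[OF is_sig_W[OF p] C[unfolded W_eq] _ v[unfolded W_eq]] eta[OF q2 y] by simp
qed

text \<open>The type \<open>eta_type\<close> is transported from \<open>App \<pi>\<^sub>1 v\<close>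
  to \<open>w\<close>, and only then instantiated at \<open>l\<close>, which is a limit proof over
  \<open>w\<close> and not over the projection.\<close>

lemma inh_W_ext:
  assumes p: "params \<Gamma> A B" and v: "\<Gamma> \<turnstile> v \<^bold>: W A B" and w: "\<Gamma> \<turnstile> w \<^bold>: Wstar A B"
    and l: "\<Gamma> \<turnstile> l \<^bold>: LimW A B w" and e: "inh \<Gamma> (Id (Wstar A B) (App \<pi>\<^sub>1 v) w)"
  shows "inh \<Gamma> (Id (W A B) v (Pair w l))"
proof -
  note T = Wstar_type[OF p]
  have c: "\<turnstile> [Wstar A B] @ \<Gamma> ctx" using ctx_consI[OF T] by simp
  have x: "Wstar A B # \<Gamma> \<turnstile> Var 0 \<^bold>: Wstar (sh (Suc 0) A) (sh (Suc 0) B)"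
    using c by (auto intro!: var_type)
  have C: "Wstar A B # \<Gamma> \<turnstile> eta_type (sh (Suc 0) A) (sh (Suc 0) B) (sh (Suc 0) v) (Var 0) \<^bold>: \<U>"
    using eta_type_type[OF params_weaken[OF p c, simplified] _ x] weakening[OF v c] by simp
  from inh_transp[OF C T arr_app[OF W_proj1_type[OF p] v] w e] inh_eta_proj1[OF p v]
  obtain h where "\<Gamma> \<turnstile> h \<^bold>: eta_type A B v w" by (auto simp: inh_def)
  from ty_app[OF this[unfolded eta_type_def] l] show ?thesis by (auto intro: inhI)
qed

text \<open>Recursion into the constructor algebra gives back the element. The first components
  agree by testing against the generic algebra \<open>Var 0\<close> on the type
  \<open>Var 1\<close>, and \<open>inh_W_ext\<close> takes care of the limit proofs.\<close>

lemma inh_rec_star_eta: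
  assumes d: "sup_data \<Gamma> A B p" and w: "\<Gamma> \<turnstile> w \<^bold>: Wstar A B" and l: "\<Gamma> \<turnstile> l \<^bold>: LimW A B w"
  shows "inh \<Gamma> (Id (W A B) (rec_star (W A B) (sup_alg p) w) (Pair w l))"
proof -
  have p: "params \<Gamma> A B" using d by (auto simp: sup_data_def)
  note v = rec_star_type[OF w W_type[OF p] sup_alg_type[OF d]]
  note c = rec_ctx_wf[OF p]
  have X: "rec_ctx A B @ \<Gamma> \<turnstile> Var 1 \<^bold>: \<U>"
    and g: "rec_ctx A B @ \<Gamma> \<turnstile> Var 0 \<^bold>: AlgW (sh 2 A) (sh 2 B) (Var 1)"
    using c by (auto intro!: var_type)
  have "inh \<Gamma> (Id (Wstar A B) (App \<pi>\<^sub>1 (rec_star (W A B) (sup_alg p) w)) w)"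
    using inh_rec_star_sup_alg[OF sup_data_weaken[OF d c, simplified] X[simplified] g[simplified]
        weakening[OF w c, simplified] weakening[OF l c, simplified]]
    by (intro inh_Wstar_ext[OF p arr_app[OF W_proj1_type[OF p] v] w]) simp
  from inh_W_ext[OF p v w l this] show ?thesis .
qed

section \<open>Induction\<close>

lemma IndStep_eq: "IndStep A B p P = Pi A (Pi (arr (App (sh 1 B) (Var 0)) (sh 1 (W A B)))
    (arr (Pi (App (sh 2 B) (Var 1)) (App (sh 3 P) (App (Var 1) (Var 0))))
      (App (sh 2 P) (sup_W (sh 2 p) (Var 1) (Var 0)))))"
  by (simp add: IndStep_def arr_def)

definition ind_hyp :: "tm \<Rightarrow> tm \<Rightarrow> tm \<Rightarrow> tm \<Rightarrow> tm" where
  "ind_hyp B P a r = Pi (App B a) (App (sh 1 P) (App (sh 1 r) (Var 0)))"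

lemma ind_hyp_type:
  assumes p: "params \<Gamma> A B" and P: "\<Gamma> \<turnstile> P \<^bold>: arr (W A B) \<U>" and a: "\<Gamma> \<turnstile> a \<^bold>: A"
    and r: "\<Gamma> \<turnstile> r \<^bold>: arr (App B a) (W A B)"
  shows "\<Gamma> \<turnstile> ind_hyp B P a r \<^bold>: \<U>"
proof -
  note c = fam_ctx[OF p a]
  show ?thesis unfolding ind_hyp_def
    using fam_app[of _ "sh (Suc 0) P", OF _ fam_ctx_app[OF c r]] weakening[OF P c]
    by (intro pi_type0) simp
qed

lemma IndStep_type:
  assumes d: "sup_data \<Gamma> A B p" and P: "\<Gamma> \<turnstile> P \<^bold>: arr (W A B) \<U>"
  shows "\<Gamma> \<turnstile> IndStep A B p P \<^bold>: \<U>"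
proof -
  have p: "params \<Gamma> A B" using d by (auto simp: sup_data_def)
  note c = alg_ctx_wf[OF p W_type[OF p]]
  note q = params_weaken[OF p c, simplified] and v = alg_ctx_vars[OF c, simplified]
    and P' = weakening[OF P c, simplified]
  show ?thesis unfolding IndStep_eq
    using ind_hyp_type[OF q P' v] fam_app[OF P' sup_W_type(2)[OF
      sup_data_weaken[OF d c, simplified] v]]
    by (intro pi_type0 arr_type0) (simp_all add: ind_hyp_def)
qed

lemma IndStep_app:
  assumes s: "\<Gamma> \<turnstile> s \<^bold>: IndStep A B p P" and a: "\<Gamma> \<turnstile> a \<^bold>: A" and r: "\<Gamma> \<turnstile> r \<^bold>: arr (App B a) (W A B)"
    and h: "\<Gamma> \<turnstile> h \<^bold>: ind_hyp B P a r"
  shows "\<Gamma> \<turnstile> App (App (App s a) r) h \<^bold>: App P (sup_W p a r)"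
  using ty_app[OF ty_app[OF s[unfolded IndStep_eq] a, simplified] r] h
  by (auto simp: ind_hyp_def intro: arr_app)

definition ind_data :: "tm list \<Rightarrow> tm \<Rightarrow> tm \<Rightarrow> tm \<Rightarrow> tm \<Rightarrow> tm \<Rightarrow> bool" where
  "ind_data \<Gamma> A B p P s \<longleftrightarrow> sup_data \<Gamma> A B p \<and> \<Gamma> \<turnstile> P \<^bold>: arr (W A B) \<U> \<and> \<Gamma> \<turnstile> s \<^bold>: IndStep A B p P"

lemma ind_dataD:
  assumes "ind_data \<Gamma> A B p P s"
  shows "params \<Gamma> A B" "sup_data \<Gamma> A B p" "\<Gamma> \<turnstile> P \<^bold>: arr (W A B) \<U>" "\<Gamma> \<turnstile> s \<^bold>: IndStep A B p P"
  using assms by (auto simp: ind_data_def sup_data_def)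

lemma ind_data_weaken: "ind_data \<Gamma> A B p P s \<Longrightarrow> \<turnstile> \<Delta> @ \<Gamma> ctx \<Longrightarrow>
    ind_data (\<Delta> @ \<Gamma>) (sh (length \<Delta>) A) (sh (length \<Delta>) B) (sh (length \<Delta>) p)
      (sh (length \<Delta>) P) (sh (length \<Delta>) s)"
  using weakening[of \<Gamma> P "arr (W A B) \<U>" \<Delta>] weakening[of \<Gamma> s "IndStep A B p P" \<Delta>]
  by (auto simp: ind_data_def sup_data_weaken)

section \<open>The total space of the predicate and its algebra\<close>

definition total :: "tm \<Rightarrow> tm \<Rightarrow> tm \<Rightarrow> tm" where
  "total A B P = Sig (W A B) (App (sh 1 P) (Var 0))"

lemma sub_total [simp]: "sub \<sigma> (total A B P) = total (sub \<sigma> A) (sub \<sigma> B) (sub \<sigma> P)"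
  by (simp add: total_def)

context
  fixes \<Gamma> A B P
  assumes p: "params \<Gamma> A B" and P: "\<Gamma> \<turnstile> P \<^bold>: arr (W A B) \<U>"
begin

lemma total_family: "W A B # \<Gamma> \<turnstile> App (sh 1 P) (Var 0) \<^bold>: \<U>"
  using fam_ctx_app[OF _ P] ctx_consI[OF W_type[OF p]] by simp

lemma is_sig_total: "is_sig \<Gamma> (W A B) (App (sh 1 P) (Var 0))"
  using W_type[OF p] total_family by (auto simp: is_sig_def)

text \<open>This level is what admits the total space as a carrier in the limit condition of an
  element of \<open>W A B\<close>.\<close>

lemma total_type: "\<Gamma> \<turnstile> total A B P \<^bold>: \<U>"
  unfolding total_def using ty_sig[OF W_type[OF p] total_family] by simp

lemma total_proj1_type: "\<Gamma> \<turnstile> \<pi>\<^sub>1 \<^bold>: arr (total A B P) (W A B)"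
  unfolding total_def by (rule proj1_type[OF is_sig_total])

lemma total_proj2_type: "\<Gamma> \<turnstile> q \<^bold>: total A B P \<Longrightarrow> \<Gamma> \<turnstile> proj2 q \<^bold>: App P (App \<pi>\<^sub>1 q)"
  unfolding total_def by (drule proj2_type[OF is_sig_total]) simp

end

text \<open>The first component applies the constructor to the underlying branches, which makes
  \<open>\<pi>\<^sub>1\<close> a morphism. The second is the induction step at those branches, with
  the second projections of \<open>t\<close> as induction hypotheses.\<close>

definition ind_body :: "tm \<Rightarrow> tm \<Rightarrow> tm \<Rightarrow> tm \<Rightarrow> tm" where
  "ind_body p s a t = Pair (sup_W p a (\<pi>\<^sub>1 \<circ>\<^sub>t t))
     (App (App (App s a) (\<pi>\<^sub>1 \<circ>\<^sub>t t)) (Lam (proj2 (App (sh 1 t) (Var 0)))))"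

lemma sub_ind_body [simp]:
  "sub \<sigma> (ind_body p s a t) = ind_body (sub \<sigma> p) (sub \<sigma> s) (sub \<sigma> a) (sub \<sigma> t)"
  by (simp add: ind_body_def)

lemma ind_body_type:
  assumes d: "ind_data \<Gamma> A B p P s" and a: "\<Gamma> \<turnstile> a \<^bold>: A"
    and t: "\<Gamma> \<turnstile> t \<^bold>: arr (App B a) (total A B P)"
  shows "\<Gamma> \<turnstile> \<pi>\<^sub>1 \<circ>\<^sub>t t \<^bold>: arr (App B a) (W A B)"
    and "\<Gamma> \<turnstile> ind_body p s a t \<^bold>: total A B P"
    and "\<Gamma> \<turnstile> App \<pi>\<^sub>1 (ind_body p s a t) \<simeq> sup_W p a (\<pi>\<^sub>1 \<circ>\<^sub>t t) \<^bold>: W A B"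
proof -
  note D = ind_dataD[OF d]
  show r: "\<Gamma> \<turnstile> \<pi>\<^sub>1 \<circ>\<^sub>t t \<^bold>: arr (App B a) (W A B)"
    by (rule comp_type[OF total_proj1_type[OF D(1,3)] t params_fam[OF D(1) a]])
  note c = fam_ctx[OF D(1) a]
  note D' = ind_dataD[OF ind_data_weaken[OF d c, simplified]]
  note x = fam_ctx_app[OF c t, simplified]
  have v: "App B a # \<Gamma> \<turnstile> Var 0 \<^bold>: App (sh (Suc 0) B) (sh (Suc 0) a)" using c
    by (auto intro!: var_type)
  \<comment> \<open>The second projection of a branch is typed over \<open>\<pi>\<^sub>1\<close> of
    that branch, whereas the induction hypothesis asks for \<open>P\<close> at the composite applied
    to the index. This beta step converts between them.\<close>
  have "App B a # \<Gamma> \<turnstile> App (\<pi>\<^sub>1 \<circ>\<^sub>t sh (Suc 0) t) (Var 0) \<simeq> App \<pi>\<^sub>1 (App (sh (Suc 0) t) (Var 0))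
      \<^bold>: W (sh (Suc 0) A) (sh (Suc 0) B)"
    by (rule comp_beta[OF total_proj1_type[OF D'(1,3)] weakening[OF t c, simplified]
          params_fam[OF D'(1) weakening[OF a c, simplified]] v])
  from fam_conv[OF D'(3) total_proj2_type[OF D'(1,3) x] eq_sym[OF this]]
  have "\<Gamma> \<turnstile> Lam (proj2 (App (sh 1 t) (Var 0))) \<^bold>: ind_hyp B P a (\<pi>\<^sub>1 \<circ>\<^sub>t t)"
    unfolding ind_hyp_def by (intro ty_lam) simp
  note h = IndStep_app[OF D(4) a r this] and s = sup_W_type(2)[OF D(2) a r]
  show "\<Gamma> \<turnstile> ind_body p s a t \<^bold>: total A B P"
    unfolding ind_body_def total_def by (rule ty_pair[OF total_family[OF D(1,3)] s]) (use h in simp)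
  show "\<Gamma> \<turnstile> App \<pi>\<^sub>1 (ind_body p s a t) \<simeq> sup_W p a (\<pi>\<^sub>1 \<circ>\<^sub>t t) \<^bold>: W A B"
    unfolding ind_body_def by (rule proj1_beta[OF is_sig_total[OF D(1,3)] s]) (use h in simp)
qed

definition ind_alg :: "tm \<Rightarrow> tm \<Rightarrow> tm" where
  "ind_alg p s = Lam (Lam (ind_body (sh 2 p) (sh 2 s) (Var 1) (Var 0)))"

lemma sub_ind_alg [simp]: "sub \<sigma> (ind_alg p s) = ind_alg (sub \<sigma> p) (sub \<sigma> s)"
  by (simp add: ind_alg_def)

lemma ind_alg_body:
  assumes d: "ind_data \<Gamma> A B p P s"
  shows "alg_ctx A B (total A B P) @ \<Gamma> \<turnstile> ind_body (sh 2 p) (sh 2 s) (Var 1) (Var 0) \<^bold>: sh 2 (total A B P)"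
proof -
  note D = ind_dataD[OF d]
  note c = alg_ctx_wf[OF D(1) total_type[OF D(1,3)]]
  show ?thesis
    using ind_body_type(2)[OF ind_data_weaken[OF d c, simplified] alg_ctx_vars(1)[OF c, simplified]]
      alg_ctx_vars(2)[OF c] by simp
qed

lemma ind_alg_type: "ind_data \<Gamma> A B p P s \<Longrightarrow> \<Gamma> \<turnstile> ind_alg p s \<^bold>: AlgW A B (total A B P)"
  unfolding ind_alg_def by (rule AlgW_lam[OF ind_alg_body])

lemma ind_alg_beta: "ind_data \<Gamma> A B p P s \<Longrightarrow> \<Gamma> \<turnstile> a \<^bold>: A \<Longrightarrow> \<Gamma> \<turnstile> t \<^bold>: arr (App B a) (total A B P) \<Longrightarrow>
    \<Gamma> \<turnstile> App (App (ind_alg p s) a) t \<simeq> ind_body p s a t \<^bold>: total A B P"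
  unfolding ind_alg_def by (rule alg_beta[OF ind_alg_body]) simp_all

text \<open>Both sides reduce to \<open>sup_W p a (\<pi>\<^sub>1 \<circ>\<^sub>t t)\<close>: the
  left by unfolding the algebra and projecting the pair, the right by unfolding
  \<open>sup_alg\<close>. Reflexivity is therefore a witness.\<close>

lemma ind_morph_eq:
  assumes d: "ind_data \<Gamma> A B p P s" and a: "\<Gamma> \<turnstile> a \<^bold>: A"
    and t: "\<Gamma> \<turnstile> t \<^bold>: arr (App B a) (total A B P)"
  shows "inh \<Gamma> (Id (W A B) (App \<pi>\<^sub>1 (App (App (ind_alg p s) a) t)) (App
    (App (sup_alg p) a) (\<pi>\<^sub>1 \<circ>\<^sub>t t)))"
proof -
  note D = ind_dataD[OF d] and b = ind_body_type[OF d a t]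
  have "\<Gamma> \<turnstile> App \<pi>\<^sub>1 (App (App (ind_alg p s) a) t) \<simeq> sup_W p a (\<pi>\<^sub>1 \<circ>\<^sub>t t) \<^bold>: W A B"
    by (rule eq_trans[OF arr_eq_app[OF eq_refl[OF total_proj1_type[OF D(1,3)]]
      ind_alg_beta[OF d a t]] b(3)])
  from refl_conv[OF W_type[OF D(1)] sup_W_type(2)[OF D(2) a b(1)] this sup_alg_beta[OF D(2) a b(1)]]
  show ?thesis by (rule inhI)
qed

lemma inh_MorphW_ind:
  assumes d: "ind_data \<Gamma> A B p P s"
  shows "inh \<Gamma> (MorphW A B (total A B P) (ind_alg p s) (W A B) (sup_alg p) \<pi>\<^sub>1)"
proof -
  note D = ind_dataD[OF d]
  note c = alg_ctx_wf[OF D(1) total_type[OF D(1,3)]]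
  show ?thesis
    using ind_morph_eq[OF ind_data_weaken[OF d c, simplified] alg_ctx_vars(1)[OF c, simplified]]
      alg_ctx_vars(2)[OF c] by (intro inh_MorphW) simp
qed

lemma inh_induction_pair:
  assumes d: "ind_data \<Gamma> A B p P s" and w: "\<Gamma> \<turnstile> w \<^bold>: Wstar A B" and l: "\<Gamma> \<turnstile> l \<^bold>: LimW A B w"
  shows "inh \<Gamma> (App P (Pair w l))"
proof -
  note D = ind_dataD[OF d]
  note T = total_type[OF D(1,3)] and V = W_type[OF D(1)] and g = ind_alg_type[OF d]
    and S = sup_alg_type[OF D(2)]
  let ?q = "rec_star (total A B P) (ind_alg p s) w" and ?v = "rec_star (W A B) (sup_alg p) w"
  note q = rec_star_type[OF w T g] and v = rec_star_type[OF w V S] and wl = W_pair_type[OF D(1) w l]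
  note q1 = arr_app[OF total_proj1_type[OF D(1,3)] q]
  have "lim_data \<Gamma> A B (total A B P) (W A B) (ind_alg p s) (sup_alg p) \<pi>\<^sub>1"
    using D(1) T V g S total_proj1_type[OF D(1,3)] by (simp add: lim_data_def)
  from inh_LimW_app[OF l this inh_MorphW_ind[OF d]]
  have "inh \<Gamma> (Id (W A B) (App \<pi>\<^sub>1 ?q) ?v)" by (simp add: lim_eq_def)
  from inh_trans[OF V q1 v wl this inh_rec_star_eta[OF D(2) w l]]
  have "inh \<Gamma> (Id (W A B) (App \<pi>\<^sub>1 ?q) (Pair w l))" .
  \<comment> \<open>The second component of \<open>?q\<close> is a proof of \<open>P\<close> over
    its own first projection, the only place where \<open>P\<close> is known to hold at this
    point.\<close>
  from inh_transp[OF total_family[OF D(1,3)] V q1 wl this]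
    total_proj2_type[OF D(1,3) q] show ?thesis by (auto intro: inhI)
qed

text \<open>An arbitrary \<open>v\<close> is not judgementally a pair. \<open>Split\<close> with
  motive \<open>P\<close> passes to a pair of variables, to which \<open>inh_induction_pair\<close>
  applies.\<close>

lemma inh_induction:
  assumes d: "ind_data \<Gamma> A B p P s" and v: "\<Gamma> \<turnstile> v \<^bold>: W A B"
  shows "inh \<Gamma> (App P v)"
proof -
  note D = ind_dataD[OF d]
  note c = W_split_ctx[OF D(1)]
  show ?thesis
    using split_inh[OF is_sig_W[OF D(1)] total_family[OF D(1,3), unfolded W_eq] _ v[unfolded W_eq]]
      inh_induction_pair[OF ind_data_weaken[OF d c, simplified] W_split_vars[OF c, simplified]]
        by simp
qed

lemma inh_IndConcl:
  assumes d: "ind_data \<Gamma> A B p P s"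
  shows "inh \<Gamma> (IndConcl A B P)"
proof -
  note D = ind_dataD[OF d]
  have c: "\<turnstile> [W A B] @ \<Gamma> ctx" using ctx_consI[OF W_type[OF D(1)]] by simp
  have "W A B # \<Gamma> \<turnstile> Var 0 \<^bold>: W (sh (Suc 0) A) (sh (Suc 0) B)" using c by (auto intro!: var_type)
  from inh_induction[OF ind_data_weaken[OF d c, simplified] this]
  show ?thesis unfolding IndConcl_def by (intro inh_lam) simp
qed

section \<open>Closing the statement over its parameters\<close>

lemma base_ctx_params: "params [arr (Var 0) \<U>, \<U>] (Var 1) (Var 0)"
proof -
  have c: "\<turnstile> [\<U>] ctx" by (intro ctx_consI[OF ty_univ] ctx_nil)
  have "[\<U>] \<turnstile> Var 0 \<^bold>: \<U>" using c by (auto intro!: var_type)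
  from arr_type[OF this ty_univ[OF c]]
  have "\<turnstile> [arr (Var 0) \<U>, \<U>] ctx" by (auto intro: ctx_consI)
  then show ?thesis by (auto simp: params_def intro!: var_type)
qed

lemma inhabited_iff_inh: "inhabited T \<longleftrightarrow> inh [] T"
  by (simp add: inhabited_def inh_def)

(* Bound variables, by index below the last Pi of each type:
   first conjunct A = 1, B = 0; second conjunct A = 3, B = 2, p = 1, P = 0. *)

theorem theorem8p5p5:
  shows "inhabited
           (Pi \<U> (Pi (Var 0 \<rightarrow>\<^sub>t \<U>) (SupLim (Var 1) (Var 0))))
       \<and> inhabited
           (Pi \<U> (Pi (Var 0 \<rightarrow>\<^sub>t \<U>)
             (Pi (SupLim (Var 1) (Var 0))
             (Pi (W (Var 2) (Var 1) \<rightarrow>\<^sub>t \<U>)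
               (IndStep (Var 3) (Var 2) (Var 1) (Var 0) \<rightarrow>\<^sub>t
                IndConcl (Var 3) (Var 2) (Var 0))))))"
proof
  note p = base_ctx_params
  show "inhabited (Pi \<U> (Pi (Var 0 \<rightarrow>\<^sub>t \<U>) (SupLim (Var 1) (Var 0))))"
    unfolding inhabited_iff_inh arrow_eq_arr by (intro inh_lam inh_SupLim p)
  let ?G3 = "[SupLim (Var 1) (Var 0), arr (Var 0) \<U>, \<U>]"
  have c3: "\<turnstile> ?G3 ctx" by (rule ctx_consI[OF SupLim_type[OF p]])
  have d3: "sup_data ?G3 (Var 2) (Var 1) (Var 0)"
    using c3 by (auto simp: sup_data_def params_def intro!: var_type)
  let ?G4 = "arr (W (Var 2) (Var 1)) \<U> # ?G3"
  have "?G3 \<turnstile> W (Var 2) (Var 1) \<^bold>: \<U>" using d3 by (intro W_type) (simp add: sup_data_def)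
  \<comment> \<open>Predicates on \<open>W A B\<close> form a type in \<open>Univ 1\<close>, so the
    general \<open>arr_type\<close> is used in place of \<open>arr_type0\<close>.\<close>
  from arr_type[OF this ty_univ[OF c3, of 0]] have c4: "\<turnstile> ?G4 ctx" by (auto intro: ctx_consI)
  have d4: "sup_data ?G4 (Var 3) (Var 2) (Var 1)"
    using c4 by (auto simp: sup_data_def params_def intro!: var_type)
  have P4: "?G4 \<turnstile> Var 0 \<^bold>: arr (W (Var 3) (Var 2)) \<U>"
    using c4 by (auto intro!: var_type)
  let ?G5 = "IndStep (Var 3) (Var 2) (Var 1) (Var 0) # ?G4"
  have c5: "\<turnstile> ?G5 ctx" by (rule ctx_consI[OF IndStep_type[OF d4 P4]])
  \<comment> \<open>The induction step itself has become \<open>Var 0\<close>, so every parameter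
    index is one higher than in the statement; the shift \<open>sh 1\<close> that the arrow places
    on its codomain accounts for this.\<close>
  have "ind_data ?G5 (Var 4) (Var 3) (Var 2) (Var 1) (Var 0)"
    using c5 by (auto simp: ind_data_def sup_data_def params_def intro!: var_type)
  from inh_IndConcl[OF this]
  have "inh ?G5 (sh 1 (IndConcl (Var 3) (Var 2) (Var 0)))" by (simp add: IndConcl_def)
  then show "inhabited (Pi \<U> (Pi (Var 0 \<rightarrow>\<^sub>t \<U>) (Pi (SupLim (Var 1) (Var 0))
      (Pi (W (Var 2) (Var 1) \<rightarrow>\<^sub>t \<U>)
        (IndStep (Var 3) (Var 2) (Var 1) (Var 0) \<rightarrow>\<^sub>t IndConcl (Var 3) (Var 2) (Var 0))))))"
    unfolding inhabited_iff_inh arrow_eq_arr arr_def[of "IndStep _ _ _ _"] by (intro inh_lam)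
qed

end
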